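(* Let $A$ be an $N \times M$ complex or real matrix, let $r \ge 1$ with $\mathrm{rank}\,A \ge r$, and let $Z$ be a best rank-$r$ approximation of $A$ in the spectral and Frobenius norms. Let $n, m$ be integers with $r \le n < N$ and $r \le m < M$. Let $\widetilde{A}$ be a rectangular CGR-approximant of $A$ built from $Z$ with $n$ rows and $m$ columns, the basis rows and basis columns being selected spectrally optimally (see context). Then $$\Vert A - \widetilde{A} \Vert_2 \le 2\, t(r, N, n)\, t(r, M, m)\, \sigma_{r+1}(A).$$
   Context: $\Vert\cdot\Vert_2$ is the spectral norm, $X^\dagger$ is the Moore–Penrose pseudo-inverse, $\sigma_i$ is the $i$-th largest singular value, and $\sigma_{\min}$ is the smallest singular value. Definition of $t(r,n,k)$ for integers $n \ge k \ge r \ge 1$: let $\mathcal{P}(n,r)$ be the set of all $n \times r$ complex matrices with orthonormal columns, and for $U \in \mathcal{P}(n,r)$ let $\mathcal{M}_k(U)$ be the set of all $k \times r$ submatrices of $U$ (formed by $k$ distinct rows). Then $$t(r,n,k) = \Big[ \min_{U \in \mathcal{P}(n,r)} \max_{\widehat{U} \in \mathcal{M}_k(U)} \sigma_{\min}(\widehat{U}) \Big]^{-1}.$$ Basis rows: for a $p \times q$ matrix $B$ of full column rank $q$, a choice of $k \ge q$ rows is called a set of basis rows if every other row of $B$ is a linear combination of them (equivalently, the submatrix $\widehat{B} \in \mathbb{C}^{k \times q}$ on these rows has rank $q$). The selection is spectrally optimal if the spectral norm of $B\widehat{B}^\dagger$ (the minimum norm solution $C$ of $C\widehat{B} = B$)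 is the smallest possible among all sets of $k$ basis rows. Basis columns of a matrix of full row rank, and their spectrally optimal selection, are defined analogously by transposition. Rectangular CGR-approximant of $A$ built from $Z$ with $n$ rows and $m$ columns: factorize $Z = Z_U Z_V$ with $Z_U \in \mathbb{C}^{N \times r}$ and $Z_V \in \mathbb{C}^{r \times M}$ (both of rank $r$); select $n$ basis rows of $Z_U$; let $R \in \mathbb{C}^{n \times M}$ be the submatrix of $A$ on the corresponding rows; compute a singular value decomposition of $R$ and truncate it after the $r$ leading singular values, so that $R = USV + E$, where $U \in \mathbb{C}^{n \times r}$ has orthonormal columns (leading left singular vectors), $S \in \mathbb{R}^{r \times r}$ is diagonal with the $r$ leading singular values of $R$, $V \in \mathbb{C}^{r \times M}$ has orthonormal rows (leading right singular vectors), and $E$ is the truncated part; select $m$ basis columns of $V$ and let $W \in \mathbb{C}^{r \times m}$ be the corresponding submatrix of $V$; let $C \in \mathbb{C}^{N \times m}$ be the submatrix of $A$ on the corresponding columns. The approximant is $\widetilde{A} = C\,(USW)^\dagger R$. *)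

theory Defs
  imports
    "Jordan_Normal_Form.DL_Rank"
    "Jordan_Normal_Form.DL_Submatrix"
    "Jordan_Normal_Form.Schur_Decomposition"
begin

definition mat_rank :: "complex mat \<Rightarrow> nat" where
  "mat_rank A = vec_space.rank (dim_row A) A"

definition vec_norm2 :: "complex vec \<Rightarrow> real" where
  "vec_norm2 v = sqrt (\<Sum>i<dim_vec v. (cmod (v $ i))\<^sup>2)"

(* The operator norm induced by the Euclidean vector norms. *)
definition spectral_norm :: "complex mat \<Rightarrow> real" where
  "spectral_norm A =
     (SUP v \<in> {v \<in> carrier_vec (dim_col A). vec_norm2 v \<le> 1}. vec_norm2 (A *\<^sub>v v))"

definition frobenius_norm :: "complex mat \<Rightarrow> real" where
  "frobenius_norm A = sqrt (\<Sum>i<dim_row A. \<Sum>j<dim_col A. (cmod (A $$ (i, j)))\<^sup>2)"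

(* Square roots of the eigenvalues of A* A, with multiplicity and in decreasing order.
   The list has length dim_col A; for a wide matrix it is the list of the
   min (dim_row A) (dim_col A) singular values padded with zeros. *)
definition sing_vals :: "complex mat \<Rightarrow> real list" where
  "sing_vals A =
     rev (sorted_list_of_multiset
       (image_mset (\<lambda>x. sqrt (Re x)) (proots (char_poly (mat_adjoint A * A)))))"

(* Singular values are counted from 1. *)
definition sing_val :: "nat \<Rightarrow> complex mat \<Rightarrow> real" where
  "sing_val i A = sing_vals A ! (i - 1)"

definition sing_val_min :: "complex mat \<Rightarrow> real" where
  "sing_val_min A = sing_val (min (dim_row A) (dim_col A)) A"

definition pinv :: "complex mat \<Rightarrow> complex mat" where
  "pinv A = (THE X. X \<in> carrier_mat (dim_col A) (dim_row A) \<and>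
     A * X * A = A \<and> X * A * X = X \<and>
     mat_adjoint (A * X) = A * X \<and> mat_adjoint (X * A) = X * A)"

definition orthonormal_cols :: "nat \<Rightarrow> nat \<Rightarrow> complex mat set" where
  "orthonormal_cols n r = {U \<in> carrier_mat n r. mat_adjoint U * U = 1\<^sub>m r}"

definition row_submats :: "nat \<Rightarrow> complex mat \<Rightarrow> complex mat set" where
  "row_submats k U = {submatrix U I UNIV | I. I \<subseteq> {..<dim_row U} \<and> card I = k}"

(* The infimum is a minimum by compactness of orthonormal_cols n r.
   Meaningful for 1 <= r <= k <= n. *)
definition t_const :: "nat \<Rightarrow> nat \<Rightarrow> nat \<Rightarrow> real" where
  "t_const r n k =
     inverse (INF U \<in> orthonormal_cols n r. Max (sing_val_min ` row_submats k U))"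

definition basis_rows :: "nat \<Rightarrow> complex mat \<Rightarrow> nat set \<Rightarrow> bool" where
  "basis_rows k B I \<longleftrightarrow> I \<subseteq> {..<dim_row B} \<and> card I = k \<and>
     (\<forall>i<dim_row B. i \<notin> I \<longrightarrow>
        row B i \<in> vec_space.row_space (dim_col B) (submatrix B I UNIV))"

definition optimal_basis_rows :: "nat \<Rightarrow> complex mat \<Rightarrow> nat set \<Rightarrow> bool" where
  "optimal_basis_rows k B I \<longleftrightarrow> basis_rows k B I \<and>
     (\<forall>J. basis_rows k B J \<longrightarrow>
        spectral_norm (B * pinv (submatrix B I UNIV)) \<le>
        spectral_norm (B * pinv (submatrix B J UNIV)))"

definition optimal_basis_cols :: "nat \<Rightarrow> complex mat \<Rightarrow> nat set \<Rightarrow> bool" where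
  "optimal_basis_cols k B J \<longleftrightarrow> optimal_basis_rows k (transpose_mat B) J"

(* Z is a best approximation of A in the norm nrm among the matrices of rank at most r
   with entries in the scalar field K, a subset of the complex numbers. *)
definition best_rank_approx ::
    "(complex mat \<Rightarrow> real) \<Rightarrow> complex set \<Rightarrow> nat \<Rightarrow> complex mat \<Rightarrow> complex mat \<Rightarrow> bool" where
  "best_rank_approx nrm K r A Z \<longleftrightarrow>
     (let X = {B \<in> carrier_mat (dim_row A) (dim_col A). elements_mat B \<subseteq> K \<and> mat_rank B \<le> r}
      in Z \<in> X \<and> (\<forall>B\<in>X. nrm (A - Z) \<le> nrm (A - B)))"

(* A full singular value decomposition R = P * D * Q; the right singular vectors are the
   conjugate transposes of the rows of Q. *)
definition is_svd :: "complex mat \<Rightarrow> complex mat \<Rightarrow> complex mat \<Rightarrow> complex mat \<Rightarrow> bool" where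
  "is_svd R P D Q \<longleftrightarrow>
     P \<in> carrier_mat (dim_row R) (dim_row R) \<and> mat_adjoint P * P = 1\<^sub>m (dim_row R) \<and>
     Q \<in> carrier_mat (dim_col R) (dim_col R) \<and> mat_adjoint Q * Q = 1\<^sub>m (dim_col R) \<and>
     D = mat (dim_row R) (dim_col R)
           (\<lambda>(i, j). if i = j then complex_of_real (sing_val (i + 1) R) else 0) \<and>
     R = P * D * Q"

(* A' is a rectangular CGR-approximant of A built from Z with n rows and m columns, the basis
   rows and columns (index sets I and J) being selected spectrally optimally.  U, S, V are the
   factors of a singular value decomposition of R truncated after r singular values. *)
definition optimal_CGR_approximant ::
    "nat \<Rightarrow> nat \<Rightarrow> nat \<Rightarrow> complex mat \<Rightarrow> complex mat \<Rightarrow> complex mat \<Rightarrow> bool" where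
  "optimal_CGR_approximant r n m A Z A' \<longleftrightarrow>
     (\<exists>ZU ZV I P D Q J.
        ZU \<in> carrier_mat (dim_row A) r \<and> ZV \<in> carrier_mat r (dim_col A) \<and>
        mat_rank ZU = r \<and> mat_rank ZV = r \<and> Z = ZU * ZV \<and>
        optimal_basis_rows n ZU I \<and>
        (let R = submatrix A I UNIV;
             U = submatrix P UNIV {..<r};
             S = submatrix D {..<r} {..<r};
             V = submatrix Q {..<r} UNIV;
             W = submatrix V UNIV J;
             C = submatrix A UNIV J
         in is_svd R P D Q \<and>
            optimal_basis_cols m V J \<and>
            A' = C * pinv (U * S * W) * R))"

end

(*
With T = ZU * pinv(ZU restricted to the selected rows), the map T P_I (P_I selecting the rows I) is an
oblique projection onto the column space of ZU. Normalising ZU to orthonormal columns does not change T,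
so optimality of the selection gives |T| <= t1 = t(r,N,n), and an oblique projection has the same norm as
its complement. Hence A - T R = (1 - T P_I)(A - Z) has norm at most t1 * sigma_{r+1}(A). Truncating R costs
another T E with |E| <= sigma_{r+1}(R) <= |R - Z_I| <= sigma_{r+1}(A). On the column side the approximant is
A Pi, where Pi is again an oblique projection with V Pi = V, so that
A - A' = (A - T U S V)(1 - Pi), and the complement 1 - Pi contributes the factor t(r,M,m).

Optimality of Z in the Frobenius norm is used for (A - Z) Z* = 0, which makes S invertible.
That t(r,n,k) is not a junk inverse of 0 follows from a lower bound on the largest r x r minor of a matrix
with orthonormal columns.
*)
theory Submission
  imports Defs "HOL-Analysis.L2_Norm"
begin

section \<open>Euclidean norms and operator bounds\<close>

text \<open>Write ^H for the adjoint. \<open>sing_vals\<close> lists square roots of characteristic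
  roots, which carry no variational content by themselves. The bridge is a unitary \<open>W\<close>
  diagonalising the Gram matrix in the order of the list: |A W y|^2 is then the sum of sigma_i^2
  |y_i|^2, and each singular value inequality is read off from these coordinates.

  S is invertible because A Z^H = Z Z^H, restricted to the selected rows, gives R Z^H ZU = (P_I ZU)
  (ZV ZV^H) (ZU^H ZU), a product of injective matrices, so R has rank at least r. A matrix Z that is
  best in the spectral norm only can violate the orthogonality: A = diag(1,1), Z = diag(1/2,0), r =
  1.

  The form A Pi of the approximant comes from pinv(U S W) = pinv(W) S^-1 U^H together with U^H R = S
  V: the factor S cancels, and A' = A P_J^T pinv(W) V.

  Over the reals Z competes with real matrices only, so the comparison matrix that yields
  sigma_{r+1} must be real when A is. An arbitrary choice of complex eigenvectors would not ensure
  that.\<close>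

lemma assoc_mult_mat_dim:
  "dim_col A = dim_row B \<Longrightarrow> dim_col B = dim_row C \<Longrightarrow> A * B * C = A * (B * (C :: 'a :: semiring_0 mat))"
  by (rule assoc_mult_mat[of A "dim_row A" "dim_col A" B "dim_col B" C "dim_col C"])
    (rule carrier_matI; simp)+

lemma assoc_mult_mat_vec_dim:
  "dim_col A = dim_row B \<Longrightarrow> dim_col B = dim_vec v \<Longrightarrow>
    (A * B) *\<^sub>v v = A *\<^sub>v (B *\<^sub>v (v :: 'a :: semiring_0 vec))"
  by (rule assoc_mult_mat_vec[of A "dim_row A" "dim_col A" B "dim_col B" v])
    (rule carrier_matI carrier_vecI; simp)+

lemma one_mult_mat_dim [simp]:
  "dim_row A = n \<Longrightarrow> 1\<^sub>m n * A = (A :: 'a :: semiring_1 mat)"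
  by (rule left_mult_one_mat[of A n "dim_col A"]) (rule carrier_matI; simp)

lemma mult_one_mat_dim [simp]:
  "dim_col A = n \<Longrightarrow> A * 1\<^sub>m n = (A :: 'a :: semiring_1 mat)"
  by (rule right_mult_one_mat[of A "dim_row A" n]) (rule carrier_matI; simp)

lemma one_mult_mat_vec_dim [simp]:
  "dim_vec v = n \<Longrightarrow> 1\<^sub>m n *\<^sub>v v = (v :: 'a :: semiring_1 vec)"
  by (rule one_mult_mat_vec, rule carrier_vecI)

lemma zero_mult_mat_dim [simp]:
  "dim_row A = n \<Longrightarrow> 0\<^sub>m m n * A = (0\<^sub>m m (dim_col A) :: 'a :: semiring_0 mat)"
  by (rule left_mult_zero_mat) (rule carrier_matI; simp)

lemma mult_zero_mat_dim [simp]: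
  "dim_col A = n \<Longrightarrow> A * 0\<^sub>m n m = (0\<^sub>m (dim_row A) m :: 'a :: semiring_0 mat)"
  by (rule right_mult_zero_mat) (rule carrier_matI; simp)

lemma zero_add_mat_dim [simp]:
  "dim_row A = n \<Longrightarrow> dim_col A = m \<Longrightarrow> 0\<^sub>m n m + A = (A :: 'a :: monoid_add mat)"
  "dim_row A = n \<Longrightarrow> dim_col A = m \<Longrightarrow> A + 0\<^sub>m n m = A"
  by (auto intro!: eq_matI)

lemma dim_mat_diag [simp]: "dim_row (mat_diag n f) = n" "dim_col (mat_diag n f) = n"
  by (simp_all add: mat_diag_def)

lemma dim_mat_adjoint [simp]:
  "dim_row (mat_adjoint A) = dim_col A" "dim_col (mat_adjoint A) = dim_row A"
  by (auto simp: mat_adjoint_def)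

lemma mat_adjoint_carrier [simp]:
  "A \<in> carrier_mat n m \<Longrightarrow> mat_adjoint A \<in> carrier_mat m n"
  by (rule carrier_matI) simp_all

lemma mat_adjoint_index [simp]:
  "i < dim_col A \<Longrightarrow> j < dim_row A \<Longrightarrow> mat_adjoint A $$ (i, j) = conjugate (A $$ (j, i))"
  by (simp add: mat_adjoint_def mat_of_rows_index)

lemma mat_adjoint_adjoint [simp]: "mat_adjoint (mat_adjoint A) = A"
  by (rule eq_matI) auto

lemma mat_adjoint_mult:
  fixes A B :: "complex mat"
  assumes "dim_col A = dim_row B"
  shows "mat_adjoint (A * B) = mat_adjoint B * mat_adjoint A"
  by (rule eq_matI) (use assms in \<open>auto simp: scalar_prod_def mult.commute\<close>)

lemma mat_adjoint_one [simp]: "mat_adjoint (1\<^sub>m n :: complex mat) = 1\<^sub>m n"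
  by (rule eq_matI) auto

section \<open>Inner products and the Euclidean norm\<close>

lemma cscalar_prod_adjoint:
  fixes A :: "complex mat"
  assumes "dim_vec x = dim_col A" "dim_vec y = dim_row A"
  shows "(A *\<^sub>v x) \<bullet>c y = x \<bullet>c (mat_adjoint A *\<^sub>v y)"
proof -
  have "(A *\<^sub>v x) \<bullet>c y = (\<Sum>i = 0..<dim_row A. \<Sum>j = 0..<dim_col A. A $$ (i, j) * x $ j * cnj (y $ i))"
    using assms by (simp add: scalar_prod_def sum_distrib_right)
  also have "\<dots> = (\<Sum>j = 0..<dim_col A. \<Sum>i = 0..<dim_row A. A $$ (i, j) * x $ j * cnj (y $ i))"
    by (rule sum.swap)
  also have "\<dots> = x \<bullet>c (mat_adjoint A *\<^sub>v y)"
    using assms by (simp add: scalar_prod_def sum_distrib_left mult_ac)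
  finally show ?thesis .
qed

lemma vec_norm2_L2_set: "vec_norm2 v = L2_set (\<lambda>i. cmod (v $ i)) {..<dim_vec v}"
  by (simp add: vec_norm2_def L2_set_def)

lemma vec_norm2_nonneg [simp]: "0 \<le> vec_norm2 v"
  by (simp add: vec_norm2_L2_set)

lemma vec_norm2_zero [simp]: "vec_norm2 (0\<^sub>v n) = 0"
  by (simp add: vec_norm2_def)

lemma vec_norm2_eq_0_iff: "vec_norm2 v = 0 \<longleftrightarrow> v = 0\<^sub>v (dim_vec v)"
  by (auto simp: vec_norm2_L2_set L2_set_eq_0_iff vec_eq_iff)

lemma vec_norm2_sq: "(vec_norm2 v)\<^sup>2 = (\<Sum>i<dim_vec v. (cmod (v $ i))\<^sup>2)"
  by (simp add: vec_norm2_def sum_nonneg)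

lemma vec_norm2_sq_cscalar_prod: "complex_of_real ((vec_norm2 v)\<^sup>2) = v \<bullet>c v"
  unfolding vec_norm2_sq
  by (simp add: scalar_prod_def lessThan_atLeast0 complex_norm_square flip: of_real_power)

lemma vec_norm2_smult: "vec_norm2 (c \<cdot>\<^sub>v v) = cmod c * vec_norm2 v"
  by (simp add: vec_norm2_L2_set L2_set_right_distrib norm_mult cong: L2_set_cong_simp)

lemma vec_norm2_triangle:
  assumes "dim_vec v = dim_vec w"
  shows "vec_norm2 (v + w) \<le> vec_norm2 v + vec_norm2 w"
proof -
  have "vec_norm2 (v + w) \<le> L2_set (\<lambda>i. cmod (v $ i) + cmod (w $ i)) {..<dim_vec w}"
    unfolding vec_norm2_L2_set using assms by (auto intro!: L2_set_mono norm_triangle_ineq simp del: L2_set_def)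
  also have "\<dots> \<le> vec_norm2 v + vec_norm2 w"
    unfolding vec_norm2_L2_set assms by (rule L2_set_triangle_ineq)
  finally show ?thesis .
qed

lemma norm_cscalar_prod_le:
  assumes "dim_vec v = dim_vec w"
  shows "cmod (v \<bullet>c w) \<le> vec_norm2 v * vec_norm2 w"
proof -
  have "cmod (v \<bullet>c w) \<le> (\<Sum>i<dim_vec w. cmod (v $ i) * cmod (w $ i))"
    unfolding scalar_prod_def
    by (rule order.trans[OF norm_sum]) (auto simp: norm_mult lessThan_atLeast0)
  also have "\<dots> = (\<Sum>i<dim_vec w. \<bar>cmod (v $ i)\<bar> * \<bar>cmod (w $ i)\<bar>)" by simp
  also have "\<dots> \<le> vec_norm2 v * vec_norm2 w"
    unfolding vec_norm2_L2_set assms by (rule L2_set_mult_ineq)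
  finally show ?thesis .
qed

lemma vec_norm2_isometry:
  assumes "mat_adjoint U * U = 1\<^sub>m n" "dim_vec x = n" "dim_col U = n"
  shows "vec_norm2 (U *\<^sub>v x) = vec_norm2 x"
proof -
  have "mat_adjoint U *\<^sub>v (U *\<^sub>v x) = (mat_adjoint U * U) *\<^sub>v x"
    using assms by (intro assoc_mult_mat_vec_dim[symmetric]) simp_all
  then have "(U *\<^sub>v x) \<bullet>c (U *\<^sub>v x) = x \<bullet>c x"
    using assms(2,3) by (simp add: assms(1) cscalar_prod_adjoint)
  then have "(vec_norm2 (U *\<^sub>v x))\<^sup>2 = (vec_norm2 x)\<^sup>2"
    by (metis of_real_eq_iff vec_norm2_sq_cscalar_prod)
  then show ?thesis by (simp add: power2_eq_iff_nonneg)
qed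

text \<open>A norm bound without a supremum: such bounds compose, add and pass to adjoints directly,
  and \<open>spectral_norm\<close> is met only at the two ends, through
  \<open>spectral_norm_le\<close> and \<open>op_bound_spectral_norm\<close>.\<close>

definition op_bound :: "complex mat \<Rightarrow> real \<Rightarrow> bool" where
  "op_bound A c \<longleftrightarrow> 0 \<le> c \<and> (\<forall>v. dim_vec v = dim_col A \<longrightarrow> vec_norm2 (A *\<^sub>v v) \<le> c * vec_norm2 v)"

lemma op_boundD: "op_bound A c \<Longrightarrow> dim_vec v = dim_col A \<Longrightarrow> vec_norm2 (A *\<^sub>v v) \<le> c * vec_norm2 v"
  by (simp add: op_bound_def)

lemma op_bound_mult:
  assumes "op_bound A a" "op_bound B b" "dim_col A = dim_row B"
  shows "op_bound (A * B) (a * b)"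
  unfolding op_bound_def
proof (intro conjI allI impI)
  show "0 \<le> a * b" using assms by (simp add: op_bound_def)
  fix v :: "complex vec" assume v: "dim_vec v = dim_col (A * B)"
  have "vec_norm2 (A *\<^sub>v (B *\<^sub>v v)) \<le> a * vec_norm2 (B *\<^sub>v v)"
    using assms by (intro op_boundD) auto
  also have "\<dots> \<le> a * (b * vec_norm2 v)"
    using assms v by (intro mult_left_mono op_boundD) (auto simp: op_bound_def)
  finally show "vec_norm2 (A * B *\<^sub>v v) \<le> a * b * vec_norm2 v"
    using assms v by (simp add: assoc_mult_mat_vec_dim mult.assoc)
qed

lemma op_bound_add:
  assumes "op_bound A a" "op_bound B b" "dim_row A = dim_row B" "dim_col A = dim_col B"
  shows "op_bound (A + B) (a + b)"
  unfolding op_bound_def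
proof (intro conjI allI impI)
  show "0 \<le> a + b" using assms by (simp add: op_bound_def)
  fix v :: "complex vec" assume v: "dim_vec v = dim_col (A + B)"
  have "(A + B) *\<^sub>v v = A *\<^sub>v v + B *\<^sub>v v"
    using assms v by (intro add_mult_distrib_mat_vec) (auto intro!: carrier_vecI)
  then have "vec_norm2 ((A + B) *\<^sub>v v) \<le> vec_norm2 (A *\<^sub>v v) + vec_norm2 (B *\<^sub>v v)"
    using assms by (simp add: vec_norm2_triangle)
  also have "\<dots> \<le> a * vec_norm2 v + b * vec_norm2 v"
    using assms v by (intro add_mono op_boundD) auto
  finally show "vec_norm2 ((A + B) *\<^sub>v v) \<le> (a + b) * vec_norm2 v"
    by (simp add: distrib_right)
qed

lemma op_bound_mono: "op_bound A a \<Longrightarrow> a \<le> b \<Longrightarrow> op_bound A b"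
  unfolding op_bound_def by (meson mult_right_mono order.trans vec_norm2_nonneg)

text \<open>With z = A^H y one has |z|^2 = <A z, y> \<le> c |z| |y|; divide by |z|.\<close>

lemma op_bound_adjoint:
  assumes "op_bound A c"
  shows "op_bound (mat_adjoint A) c"
  unfolding op_bound_def
proof (intro conjI allI impI)
  show "0 \<le> c" using assms by (simp add: op_bound_def)
  fix y :: "complex vec" assume y: "dim_vec y = dim_col (mat_adjoint A)"
  let ?z = "mat_adjoint A *\<^sub>v y"
  have "complex_of_real ((vec_norm2 ?z)\<^sup>2) = (A *\<^sub>v ?z) \<bullet>c y"
    using y cscalar_prod_adjoint[of ?z A y] unfolding vec_norm2_sq_cscalar_prod by simp
  then have "(vec_norm2 ?z)\<^sup>2 = cmod ((A *\<^sub>v ?z) \<bullet>c y)"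
    by (metis abs_of_nonneg norm_of_real zero_le_power2)
  also have "\<dots> \<le> vec_norm2 (A *\<^sub>v ?z) * vec_norm2 y"
    using y by (intro norm_cscalar_prod_le) auto
  also have "\<dots> \<le> (c * vec_norm2 ?z) * vec_norm2 y"
    using assms by (intro mult_right_mono op_boundD) auto
  finally have *: "vec_norm2 ?z * vec_norm2 ?z \<le> vec_norm2 ?z * (c * vec_norm2 y)"
    by (simp add: power2_eq_square mult_ac)
  show "vec_norm2 ?z \<le> c * vec_norm2 y"
  proof (cases "vec_norm2 ?z = 0")
    case True
    then show ?thesis using \<open>0 \<le> c\<close> by simp
  next
    case False
    then have "0 < vec_norm2 ?z" using vec_norm2_nonneg[of ?z] by linarith
    with * show ?thesis by (simp add: mult_le_cancel_left)
  qed
qed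

text \<open>The conjugate of A^T y is A^H applied to the conjugate of y, and conjugation keeps
  norms. Column selections are treated by plain transposition, which is where this is used.\<close>

lemma op_bound_transpose:
  assumes "op_bound A c"
  shows "op_bound A\<^sup>T c"
  unfolding op_bound_def
proof (intro conjI allI impI)
  show "0 \<le> c" using assms by (simp add: op_bound_def)
  fix y :: "complex vec" assume y: "dim_vec y = dim_col A\<^sup>T"
  have "conjugate (A\<^sup>T *\<^sub>v y) = mat_adjoint A *\<^sub>v conjugate y"
    using y by (intro eq_vecI) (auto simp: scalar_prod_def sum_conjugate)
  moreover have norm_conj: "vec_norm2 (conjugate v) = vec_norm2 v" for v :: "complex vec"
    by (simp add: vec_norm2_def)
  ultimately show "vec_norm2 (A\<^sup>T *\<^sub>v y) \<le> c * vec_norm2 y"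
    using op_boundD[OF op_bound_adjoint[OF assms], of "conjugate y"] y
    by (metis dim_mat_adjoint(2) dim_vec_conjugate index_transpose_mat(3))
qed

lemma op_bound_isometry:
  assumes "mat_adjoint U * U = 1\<^sub>m (dim_col U)"
  shows "op_bound U 1"
  using assms by (simp add: op_bound_def vec_norm2_isometry)

text \<open>Cauchy-Schwarz in each row. Some finite bound is what makes the supremum in
  \<open>spectral_norm\<close> one over a bounded set.\<close>

lemma op_bound_exists: "\<exists>c. op_bound A c"
proof (intro exI)
  show "op_bound A (\<Sum>i<dim_row A. vec_norm2 (conjugate (row A i)))"
    unfolding op_bound_def
  proof (intro conjI allI impI)
    fix v :: "complex vec" assume v: "dim_vec v = dim_col A"
    have "vec_norm2 (A *\<^sub>v v) \<le> (\<Sum>i<dim_row A. cmod ((A *\<^sub>v v) $ i))"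
      unfolding vec_norm2_L2_set by (rule order.trans[OF L2_set_le_sum]) auto
    also have "\<dots> \<le> (\<Sum>i<dim_row A. vec_norm2 v * vec_norm2 (conjugate (row A i)))"
    proof (rule sum_mono)
      fix i assume "i \<in> {..<dim_row A}"
      moreover have "row A i \<bullet> v = v \<bullet> row A i"
        by (rule comm_scalar_prod[OF row_carrier carrier_vecI[OF v]])
      ultimately show "cmod ((A *\<^sub>v v) $ i) \<le> vec_norm2 v * vec_norm2 (conjugate (row A i))"
        using norm_cscalar_prod_le[of v "conjugate (row A i)"] v by simp
    qed
    finally show "vec_norm2 (A *\<^sub>v v) \<le> (\<Sum>i<dim_row A. vec_norm2 (conjugate (row A i))) * vec_norm2 v"
      by (simp add: sum_distrib_left[symmetric] mult.commute)
  qed (auto intro: sum_nonneg)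
qed

lemma op_bound_unit:
  assumes "op_bound A c" "v \<in> carrier_vec (dim_col A)" "vec_norm2 v \<le> 1"
  shows "vec_norm2 (A *\<^sub>v v) \<le> c"
proof -
  have "vec_norm2 (A *\<^sub>v v) \<le> c * vec_norm2 v"
    by (rule op_boundD[OF assms(1) carrier_vecD[OF assms(2)]])
  also have "\<dots> \<le> c" using assms by (intro mult_left_le) (auto simp: op_bound_def)
  finally show ?thesis .
qed

lemma spectral_norm_le:
  assumes "op_bound A c"
  shows "spectral_norm A \<le> c"
  unfolding spectral_norm_def
proof (rule cSUP_least)
  show "{v \<in> carrier_vec (dim_col A). vec_norm2 v \<le> 1} \<noteq> {}"
    by (auto intro!: exI[of _ "0\<^sub>v (dim_col A)"])
  fix v assume "v \<in> {v \<in> carrier_vec (dim_col A). vec_norm2 v \<le> 1}"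
  then show "vec_norm2 (A *\<^sub>v v) \<le> c"
    using op_bound_unit[OF assms] by blast
qed

lemma op_bound_spectral_norm: "op_bound A (spectral_norm A)"
proof -
  obtain c where c: "op_bound A c" using op_bound_exists by blast
  let ?S = "{v \<in> carrier_vec (dim_col A). vec_norm2 v \<le> 1}"
  have bdd: "bdd_above ((\<lambda>v. vec_norm2 (A *\<^sub>v v)) ` ?S)"
    using op_bound_unit[OF c] by (intro bdd_aboveI2) blast
  have upper: "vec_norm2 (A *\<^sub>v v) \<le> spectral_norm A" if "v \<in> ?S" for v
    unfolding spectral_norm_def using that by (rule cSUP_upper[OF _ bdd])
  show ?thesis
    unfolding op_bound_def
  proof (intro conjI allI impI)
    have "0\<^sub>v (dim_col A) \<in> ?S" by simp
    from upper[OF this] show "0 \<le> spectral_norm A" using vec_norm2_nonneg order.trans by blast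
    fix v :: "complex vec" assume v: "dim_vec v = dim_col A"
    show "vec_norm2 (A *\<^sub>v v) \<le> spectral_norm A * vec_norm2 v"
    proof (cases "vec_norm2 v = 0")
      case True
      then show ?thesis using v op_boundD[OF c v] by simp
    next
      case False
      then have pos: "0 < vec_norm2 v" using vec_norm2_nonneg[of v] by linarith
      let ?w = "complex_of_real (inverse (vec_norm2 v)) \<cdot>\<^sub>v v"
      have "A *\<^sub>v ?w = complex_of_real (inverse (vec_norm2 v)) \<cdot>\<^sub>v (A *\<^sub>v v)"
        using v by (intro mult_mat_vec[of A "dim_row A" "dim_col A"]) (auto intro!: carrier_vecI)
      moreover have "vec_norm2 (A *\<^sub>v ?w) \<le> spectral_norm A"
        using pos v by (intro upper) (auto simp: vec_norm2_smult simp del: of_real_inverse intro!: carrier_vecI)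
      ultimately have "inverse (vec_norm2 v) * vec_norm2 (A *\<^sub>v v) \<le> spectral_norm A"
        using pos by (simp add: vec_norm2_smult del: of_real_inverse)
      with pos show ?thesis by (simp add: field_simps)
    qed
  qed
qed

section \<open>The spectral theorem for Hermitian matrices\<close>

text \<open>Complete v to a basis and orthogonalise. Gram-Schmidt keeps the head of the list, and
  the normalisation done afterwards only rescales it; this is the scalar c.\<close>

lemma unitary_with_first_column:
  fixes v :: "complex vec"
  assumes v: "v \<in> carrier_vec n" "v \<noteq> 0\<^sub>v n" and n: "0 < n"
  shows "\<exists>W c. W \<in> carrier_mat n n \<and> mat_adjoint W * W = 1\<^sub>m n \<and> col W 0 = c \<cdot>\<^sub>v v"
proof -
  interpret cof_vec_space n "TYPE(complex)" .
  define b where "b = basis_completion v"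
  define ws where "ws = gram_schmidt n b"
  note bc = basis_completion[OF v, folded b_def]
  have ws: "set ws \<subseteq> carrier_vec n" "corthogonal ws" "length ws = n"
    using gram_schmidt_result[OF bc(2,4,5) ws_def] bc(6) by auto
  obtain vs where "b = v # vs"
    using bc(6,7) n by (cases b) auto
  then have hd: "ws ! 0 = v"
    using gram_schmidt_hd[OF v(1), of vs] ws(3) n by (simp add: ws_def hd_conv_nth flip: length_greater_0_conv)
  have wsn: "dim_vec (ws ! i) = n" if "i < n" for i
    using ws that by (metis carrier_vecD nth_mem subsetD)
  have orth: "(ws ! j \<bullet>c ws ! i = 0) \<longleftrightarrow> i \<noteq> j" if "i < n" "j < n" for i j
    using corthogonalD[OF ws(2), of j i] ws(3) that by auto
  let ?s = "\<lambda>j. complex_of_real (inverse (vec_norm2 (ws ! j)))"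
  define W where "W = mat n n (\<lambda>(i, j). ?s j * (ws ! j) $ i)"
  have "mat_adjoint W * W = 1\<^sub>m n"
  proof (rule eq_matI)
    fix i j assume "i < dim_row (1\<^sub>m n)" "j < dim_col (1\<^sub>m n)"
    then have ij: "i < n" "j < n" by auto
    have "(mat_adjoint W * W) $$ (i, j) = ?s i * ?s j * (ws ! j \<bullet>c ws ! i)"
      using ij wsn by (simp add: W_def scalar_prod_def sum_distrib_left mult_ac)
    also have "\<dots> = (if i = j then 1 else 0)"
    proof (cases "i = j")
      case True
      have "ws ! j \<bullet>c ws ! j \<noteq> 0" using orth[of j j] ij by simp
      then have "vec_norm2 (ws ! j) \<noteq> 0" unfolding vec_norm2_sq_cscalar_prod[symmetric] by simp
      then show ?thesis
        unfolding True vec_norm2_sq_cscalar_prod[symmetric] by (simp add: power2_eq_square field_simps)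
    qed (use orth ij in auto)
    finally show "(mat_adjoint W * W) $$ (i, j) = 1\<^sub>m n $$ (i, j)" using ij by simp
  qed (auto simp: W_def)
  moreover have "col W 0 = ?s 0 \<cdot>\<^sub>v v"
    using n v hd by (intro eq_vecI) (auto simp: W_def)
  moreover have "W \<in> carrier_mat n n" by (simp add: W_def)
  ultimately show ?thesis by blast
qed

lemma unitary_right_inverse:
  assumes "W \<in> carrier_mat n n" "mat_adjoint W * W = 1\<^sub>m n"
  shows "W * mat_adjoint W = 1\<^sub>m n"
  using mat_mult_left_right_inverse[OF mat_adjoint_carrier[OF assms(1)] assms(1,2)] .

text \<open>Deflation: an eigenvector for the head of \<open>es\<close> splits off a 1 x 1 block,
  and the rest is Hermitian with the remaining roots. The order of \<open>es\<close> is prescribed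
  from outside so that the diagonal can later follow the decreasing order of
  \<open>sing_vals\<close>.\<close>

lemma hermitian_diagonalization:
  fixes A :: "complex mat"
  assumes "A \<in> carrier_mat n n" "mat_adjoint A = A" "char_poly A = (\<Prod>e\<leftarrow>es. [:- e, 1:])"
  shows "\<exists>W\<in>carrier_mat n n. mat_adjoint W * W = 1\<^sub>m n \<and> A = W * mat_diag n ((!) es) * mat_adjoint W"
  using assms
proof (induction es arbitrary: n A)
  case Nil
  then have "n = 0" using degree_monic_char_poly[of A n] by simp
  then show ?case using Nil by (intro bexI[of _ "1\<^sub>m 0"]) (auto intro!: eq_matI)
next
  case (Cons e es)
  have A: "A \<in> carrier_mat n n" and herm: "mat_adjoint A = A" by fact+
  have e: "eigenvalue A e"
    using Cons.prems(3) by (simp add: eigenvalue_root_char_poly[OF A])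
  then obtain v where ev: "v \<in> carrier_vec n" "v \<noteq> 0\<^sub>v n" "A *\<^sub>v v = e \<cdot>\<^sub>v v"
    using A by (auto simp: eigenvalue_def eigenvector_def)
  have n: "0 < n" using eigenvalue_imp_nonzero_dim[OF A e] by simp
  then obtain n1 where n1: "n = Suc n1" using gr0_implies_Suc by blast
  obtain W c where W: "W \<in> carrier_mat n n" "mat_adjoint W * W = 1\<^sub>m n" "col W 0 = c \<cdot>\<^sub>v v"
    using unitary_with_first_column[OF ev(1,2) n] by blast
  have WW: "W * mat_adjoint W = 1\<^sub>m n" by (rule unitary_right_inverse[OF W(1,2)])
  have dims [simp]: "dim_row A = n" "dim_col A = n" "dim_row W = n" "dim_col W = n"
    using A W(1) by auto
  define A' where "A' = mat_adjoint W * (A * W)"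
  have A': "A' \<in> carrier_mat n n" by (auto simp: A'_def)
  have dimsA' [simp]: "dim_row A' = n" "dim_col A' = n" by (auto simp: A'_def)
  have A_eq: "A = W * A' * mat_adjoint W"
  proof -
    have "W * A' * mat_adjoint W = W * mat_adjoint W * (A * (W * mat_adjoint W))"
      by (simp add: A'_def assoc_mult_mat_dim)
    then show ?thesis by (simp add: WW)
  qed
  have herm': "mat_adjoint A' = A'"
    by (simp add: A'_def mat_adjoint_mult herm assoc_mult_mat_dim)
  have AW0: "A *\<^sub>v col W 0 = e \<cdot>\<^sub>v col W 0"
    using ev A W(3) by (simp add: mult_mat_vec[OF A ev(1)] smult_smult_assoc mult.commute)
  \<comment> \<open>The first column of W^H A W is e times the first column of W^H W = 1.\<close>
  have col0: "A' $$ (i, 0) = (if i = 0 then e else 0)" if "i < n" for i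
  proof -
    have "A' $$ (i, 0) = row (mat_adjoint W) i \<bullet> (A *\<^sub>v col W 0)"
      using that n by (simp add: A'_def col_mult2[of A n n W n] A W(1))
    also have "\<dots> = e * (mat_adjoint W * W) $$ (i, 0)"
      using that n unfolding AW0 by simp
    also have "\<dots> = (if i = 0 then e else 0)" using that n by (simp add: W(2))
    finally show ?thesis .
  qed
  \<comment> \<open>Hermitian symmetry carries the zeros of the first column over to the first
    row.\<close>
  have row0: "A' $$ (0, i) = 0" if "0 < i" "i < n" for i
  proof -
    have "A' $$ (0, i) = mat_adjoint A' $$ (0, i)" by (simp add: herm')
    also have "\<dots> = 0" using that n col0[of i] by simp
    finally show ?thesis .
  qed
  define A3 where "A3 = mat n1 n1 (\<lambda>(i, j). A' $$ (Suc i, Suc j))"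
  have A3: "A3 \<in> carrier_mat n1 n1" by (simp add: A3_def)
  let ?E = "mat 1 1 (\<lambda>_. e)"
  have A'_block: "A' = four_block_mat ?E (0\<^sub>m 1 n1) (0\<^sub>m n1 1) A3"
    using col0 row0 by (intro eq_matI) (auto simp: A3_def n1)
  have herm3: "mat_adjoint A3 = A3"
  proof (rule eq_matI)
    fix i j assume ij: "i < dim_row A3" "j < dim_col A3"
    have "mat_adjoint A' $$ (Suc i, Suc j) = A' $$ (Suc i, Suc j)" by (simp add: herm')
    then show "mat_adjoint A3 $$ (i, j) = A3 $$ (i, j)" using ij by (simp add: A3_def n1)
  qed (auto simp: A3_def)
  \<comment> \<open>Similarity preserves the characteristic polynomial, so cancelling the factor of
    the split-off block leaves the roots \<open>es\<close> for \<open>A3\<close>.\<close>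
  have "similar_mat A A'"
    unfolding similar_mat_def
    by (intro exI[of _ W] exI[of _ "mat_adjoint W"] similar_mat_witI[OF WW W(2) A_eq A A' W(1)])
      (rule mat_adjoint_carrier[OF W(1)])
  then have "char_poly A' = [:- e, 1:] * (\<Prod>e\<leftarrow>es. [:- e, 1:])"
    using char_poly_similar Cons.prems(3) by fastforce
  moreover have "char_poly A' = char_poly ?E * char_poly A3"
    unfolding A'_block by (rule char_poly_four_block_zeros_col) (auto simp: A3)
  moreover have "char_poly ?E = [:- e, 1:]"
    by (simp add: char_poly_defs det_def sign_def)
  ultimately have "char_poly A3 = (\<Prod>e\<leftarrow>es. [:- e, 1:])"
    by (metis mult_cancel_left pCons_eq_0_iff zero_neq_one)
  from Cons.IH[OF A3 herm3 this] obtain W3 where W3: "W3 \<in> carrier_mat n1 n1"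
    "mat_adjoint W3 * W3 = 1\<^sub>m n1" "A3 = W3 * mat_diag n1 ((!) es) * mat_adjoint W3" by blast
  define F where "F = four_block_mat (1\<^sub>m 1) (0\<^sub>m 1 n1) (0\<^sub>m n1 1) W3"
  have F: "F \<in> carrier_mat n n" using W3(1) by (auto simp: F_def n1)
  have F_adj: "mat_adjoint F = four_block_mat (1\<^sub>m 1) (0\<^sub>m 1 n1) (0\<^sub>m n1 1) (mat_adjoint W3)"
    using W3(1) by (intro eq_matI) (auto simp: F_def)
  have D: "mat_diag n ((!) (e # es)) = four_block_mat ?E (0\<^sub>m 1 n1) (0\<^sub>m n1 1) (mat_diag n1 ((!) es))"
    by (intro eq_matI) (auto simp: mat_diag_def n1)
  have FF: "mat_adjoint F * F = 1\<^sub>m n"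
    unfolding F_adj unfolding F_def using W3
    by (subst mult_four_block_mat[of _ 1 1 _ n1 _ n1 _ _ 1 _ n1]) (auto simp: n1 intro!: eq_matI)
  have A'_diag: "A' = F * mat_diag n ((!) (e # es)) * mat_adjoint F"
  proof -
    have "F * mat_diag n ((!) (e # es)) =
        four_block_mat ?E (0\<^sub>m 1 n1) (0\<^sub>m n1 1) (W3 * mat_diag n1 ((!) es))"
      unfolding D F_def using W3
      by (subst mult_four_block_mat[of _ 1 1 _ n1 _ n1 _ _ 1 _ n1]) auto
    then show ?thesis
      unfolding A'_block F_adj using W3
      by (simp add: mult_four_block_mat[of _ 1 1 _ n1 _ n1 _ _ 1 _ n1])
  qed
  show ?case
  proof (intro bexI[of _ "W * F"] conjI)
    show "W * F \<in> carrier_mat n n" using W(1) F by auto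
    have dF [simp]: "dim_row F = n" "dim_col F = n" using F by auto
    have "mat_adjoint (W * F) * (W * F) = mat_adjoint F * ((mat_adjoint W * W) * F)"
      by (simp add: mat_adjoint_mult assoc_mult_mat_dim)
    then show "mat_adjoint (W * F) * (W * F) = 1\<^sub>m n" by (simp add: W(2) FF)
    have "A = W * (F * mat_diag n ((!) (e # es)) * mat_adjoint F) * mat_adjoint W"
      using A_eq A'_diag by simp
    also have "\<dots> = W * F * mat_diag n ((!) (e # es)) * mat_adjoint (W * F)"
      by (simp add: mat_adjoint_mult assoc_mult_mat_dim)
    finally show "A = W * F * mat_diag n ((!) (e # es)) * mat_adjoint (W * F)" .
  qed
qed

section \<open>Singular values\<close>

text \<open>For a unit eigenvector v, e = <A^H A v, v> = |A v|^2. So the roots are real and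
  nonnegative, and the square root of each is a value |A v| at a unit vector.\<close>

lemma gram_eigenvalue:
  fixes A :: "complex mat"
  assumes "eigenvalue (mat_adjoint A * A) e"
  shows "\<exists>v. dim_vec v = dim_col A \<and> vec_norm2 v = 1 \<and> e = complex_of_real ((vec_norm2 (A *\<^sub>v v))\<^sup>2)"
proof -
  obtain u where "eigenvector (mat_adjoint A * A) u e"
    using assms unfolding eigenvalue_def by blast
  then have u: "dim_vec u = dim_col A" "u \<noteq> 0\<^sub>v (dim_col A)"
    "(mat_adjoint A * A) *\<^sub>v u = e \<cdot>\<^sub>v u"
    by (auto simp: eigenvector_def)
  have pos: "vec_norm2 u \<noteq> 0" using u by (auto simp: vec_norm2_eq_0_iff)
  define v where "v = complex_of_real (inverse (vec_norm2 u)) \<cdot>\<^sub>v u"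
  have v: "dim_vec v = dim_col A" using u by (simp add: v_def)
  have nv: "vec_norm2 v = 1"
    using pos by (simp add: v_def vec_norm2_smult del: of_real_inverse)
  have G: "mat_adjoint A * A \<in> carrier_mat (dim_col A) (dim_col A)" by (rule carrier_matI) simp_all
  have Av: "(mat_adjoint A * A) *\<^sub>v v = e \<cdot>\<^sub>v v"
    unfolding v_def mult_mat_vec[OF G carrier_vecI[OF u(1)]] u(3)
    by (simp add: smult_smult_assoc mult.commute)
  have Av': "mat_adjoint A *\<^sub>v (A *\<^sub>v v) = e \<cdot>\<^sub>v v"
    unfolding Av[symmetric] using v by (simp add: assoc_mult_mat_vec_dim)
  have "complex_of_real ((vec_norm2 (A *\<^sub>v v))\<^sup>2) = (mat_adjoint A *\<^sub>v (A *\<^sub>v v)) \<bullet>c v"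
    unfolding vec_norm2_sq_cscalar_prod using v by (simp add: cscalar_prod_adjoint)
  also have "\<dots> = e * (v \<bullet>c v)" unfolding Av' using v by simp
  also have "\<dots> = e" unfolding vec_norm2_sq_cscalar_prod[symmetric] nv by simp
  finally show ?thesis using v nv by metis
qed

text \<open>By \<open>gram_eigenvalue\<close>, taking the real part and the square root in
  \<open>sing_vals\<close> loses nothing: squaring the entries recovers the characteristic roots,
  now in decreasing order.\<close>

lemma sing_vals_basics:
  "length (sing_vals A) = dim_col A" (is ?th1)
  "s \<in> set (sing_vals A) \<Longrightarrow> 0 \<le> s \<and> (\<exists>v. dim_vec v = dim_col A \<and> vec_norm2 v = 1 \<and> vec_norm2 (A *\<^sub>v v) = s)"
    (is "_ \<Longrightarrow> ?th2")
  "char_poly (mat_adjoint A * A) = (\<Prod>e\<leftarrow>map (\<lambda>s. complex_of_real (s\<^sup>2)) (sing_vals A). [:- e, 1:])" (is ?th3)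
proof -
  let ?G = "mat_adjoint A * A"
  have G: "?G \<in> carrier_mat (dim_col A) (dim_col A)" by (rule carrier_matI) simp_all
  obtain as where as: "char_poly ?G = (\<Prod>a\<leftarrow>as. [:- a, 1:])" "length as = dim_col A"
    using char_poly_factorized[OF G] by blast
  have "proots (char_poly ?G) = mset as"
    unfolding as(1)
  proof (induction as)
    case (Cons a as)
    have "(\<Prod>a\<leftarrow>as. [:- a, 1:]) \<noteq> 0" by (auto simp: prod_list_zero_iff)
    then have "proots ([:- a, 1:] * (\<Prod>a\<leftarrow>as. [:- a, 1:])) = {#a#} + mset as"
      by (subst proots_mult) (simp_all add: Cons)
    then show ?case by (simp del: mult_pCons_left)
  qed simp
  then have mset: "mset (sing_vals A) = image_mset (\<lambda>x. sqrt (Re x)) (mset as)"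
    by (simp add: sing_vals_def)
  show ?th1 using as(2) mset by (metis size_image_mset size_mset)
  have ev: "\<exists>v. dim_vec v = dim_col A \<and> vec_norm2 v = 1 \<and> a = complex_of_real ((vec_norm2 (A *\<^sub>v v))\<^sup>2)"
    if "a \<in> set as" for a
  proof -
    have "poly (char_poly ?G) a = 0"
      unfolding as(1) using that by (auto simp: poly_prod_list prod_list_zero_iff)
    then show ?thesis by (intro gram_eigenvalue) (simp add: eigenvalue_root_char_poly[OF G])
  qed
  show ?th2 if "s \<in> set (sing_vals A)"
  proof -
    from that have "s \<in> (\<lambda>x. sqrt (Re x)) ` set as"
      using mset by (metis set_image_mset set_mset_mset)
    then obtain a where "a \<in> set as" "s = sqrt (Re a)" by blast
    with ev show ?thesis by fastforce
  qed
  have sq: "complex_of_real ((sqrt (Re a))\<^sup>2) = a" if "a \<in> set as" for a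
    using ev[OF that] by auto
  have "mset (map (\<lambda>s. complex_of_real (s\<^sup>2)) (sing_vals A)) = image_mset (\<lambda>a. a) (mset as)"
    unfolding mset_map mset multiset.map_comp
    by (rule image_mset_cong) (use sq in auto)
  then have mset_eq: "mset (map (\<lambda>s. complex_of_real (s\<^sup>2)) (sing_vals A)) = mset as"
    by (simp only: multiset.map_ident)
  have "(\<Prod>e\<leftarrow>xs. [:- e, 1:]) = prod_mset (image_mset (\<lambda>e. [:- e, 1:]) (mset xs))" for xs :: "complex list"
    by (simp only: prod_mset_prod_list mset_map[symmetric])
  then show ?th3 unfolding as(1) by (simp only: mset_eq)
qed

lemmas length_sing_vals [simp] = sing_vals_basics(1)

lemma sing_vals_nonneg: "i < dim_col A \<Longrightarrow> 0 \<le> sing_vals A ! i"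
  using sing_vals_basics(2)[of "sing_vals A ! i" A] by simp

lemma sing_vals_attained:
  assumes "i < dim_col A"
  obtains v where "dim_vec v = dim_col A" "vec_norm2 v = 1" "vec_norm2 (A *\<^sub>v v) = sing_vals A ! i"
  using sing_vals_basics(2)[of "sing_vals A ! i" A] assms by auto

lemma sing_vals_antimono:
  assumes "i \<le> j" "j < dim_col A"
  shows "sing_vals A ! j \<le> sing_vals A ! i"
proof -
  have "sorted (rev (sing_vals A))" by (simp add: sing_vals_def)
  then show ?thesis using assms by (simp add: sorted_rev_nth_mono)
qed

text \<open>The columns of \<open>W\<close> are right singular vectors of \<open>A\<close>, ordered
  as in \<open>sing_vals\<close>.\<close>

definition gram_diagonalizer :: "complex mat \<Rightarrow> complex mat \<Rightarrow> bool" where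
  "gram_diagonalizer A W \<longleftrightarrow> W \<in> carrier_mat (dim_col A) (dim_col A) \<and>
     mat_adjoint W * W = 1\<^sub>m (dim_col A) \<and>
     mat_adjoint A * A =
       W * mat_diag (dim_col A) (\<lambda>i. complex_of_real ((sing_vals A ! i)\<^sup>2)) * mat_adjoint W"

lemma gram_diagonalizer_exists: "\<exists>W. gram_diagonalizer A W"
proof -
  let ?G = "mat_adjoint A * A" and ?es = "map (\<lambda>s. complex_of_real (s\<^sup>2)) (sing_vals A)"
  have G: "?G \<in> carrier_mat (dim_col A) (dim_col A)" by (rule carrier_matI) simp_all
  have "mat_adjoint ?G = ?G" by (simp add: mat_adjoint_mult)
  from hermitian_diagonalization[OF G this sing_vals_basics(3)]
  obtain W where "W \<in> carrier_mat (dim_col A) (dim_col A)" "mat_adjoint W * W = 1\<^sub>m (dim_col A)"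
    "?G = W * mat_diag (dim_col A) ((!) ?es) * mat_adjoint W" by blast
  moreover have "mat_diag (dim_col A) ((!) ?es) =
      mat_diag (dim_col A) (\<lambda>i. complex_of_real ((sing_vals A ! i)\<^sup>2))"
    unfolding mat_diag_def by (rule cong_mat) simp_all
  ultimately show ?thesis unfolding gram_diagonalizer_def by metis
qed

lemma mat_diag_mult_vec:
  "dim_vec y = n \<Longrightarrow> mat_diag n f *\<^sub>v y = vec n (\<lambda>i. f i * (y $ i :: 'a :: semiring_0))"
  by (rule eq_vecI) (simp_all add: mat_diag_def scalar_prod_def if_distrib[of "\<lambda>x. x * _"] cong: if_cong)

lemma gram_diagonalizer_dims:
  assumes "gram_diagonalizer A W"
  shows "dim_row W = dim_col A" "dim_col W = dim_col A"
  using assms by (auto simp: gram_diagonalizer_def)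

text \<open>|A W y|^2 = <y, W^H A^H A W y>, and the inner matrix is diagonal. All singular value
  estimates below start from this identity.\<close>

lemma gram_diagonalizer_norm:
  assumes W: "gram_diagonalizer A W" and y: "dim_vec y = dim_col A"
  shows "(vec_norm2 (A *\<^sub>v (W *\<^sub>v y)))\<^sup>2 = (\<Sum>i<dim_col A. (sing_vals A ! i)\<^sup>2 * (cmod (y $ i))\<^sup>2)"
proof -
  note [simp] = gram_diagonalizer_dims[OF W]
  let ?D = "mat_diag (dim_col A) (\<lambda>i. complex_of_real ((sing_vals A ! i)\<^sup>2))"
  have WW: "mat_adjoint W * W = 1\<^sub>m (dim_col A)" and G: "mat_adjoint A * A = W * ?D * mat_adjoint W"
    using W by (auto simp: gram_diagonalizer_def)
  have "mat_adjoint W * (mat_adjoint A * A * W) = mat_adjoint W * W * ?D * (mat_adjoint W * W)"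
    unfolding G by (simp add: assoc_mult_mat_dim)
  then have WAAW: "mat_adjoint W * (mat_adjoint A * A * W) = ?D" by (simp add: WW)
  have "complex_of_real ((vec_norm2 (A *\<^sub>v (W *\<^sub>v y)))\<^sup>2) =
      y \<bullet>c (mat_adjoint W *\<^sub>v (mat_adjoint A *\<^sub>v (A *\<^sub>v (W *\<^sub>v y))))"
    unfolding vec_norm2_sq_cscalar_prod using y by (simp add: cscalar_prod_adjoint)
  also have "mat_adjoint W *\<^sub>v (mat_adjoint A *\<^sub>v (A *\<^sub>v (W *\<^sub>v y))) =
      (mat_adjoint W * (mat_adjoint A * A * W)) *\<^sub>v y"
    using y by (simp add: assoc_mult_mat_vec_dim)
  also have "\<dots> = vec (dim_col A) (\<lambda>i. complex_of_real ((sing_vals A ! i)\<^sup>2) * y $ i)"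
    unfolding WAAW using y by (rule mat_diag_mult_vec)
  also have "y \<bullet>c vec (dim_col A) (\<lambda>i. complex_of_real ((sing_vals A ! i)\<^sup>2) * y $ i) =
      (\<Sum>i<dim_col A. y $ i * cnj (complex_of_real ((sing_vals A ! i)\<^sup>2) * y $ i))"
    by (simp add: scalar_prod_def lessThan_atLeast0)
  also have "\<dots> = complex_of_real (\<Sum>i<dim_col A. (sing_vals A ! i)\<^sup>2 * (cmod (y $ i))\<^sup>2)"
    by (simp add: complex_norm_square mult_ac flip: of_real_power)
  finally show ?thesis by (simp only: of_real_eq_iff)
qed

lemma gram_diagonalizer_right_inverse:
  assumes "gram_diagonalizer A W"
  shows "W * mat_adjoint W = 1\<^sub>m (dim_col A)"
  using assms unitary_right_inverse by (auto simp: gram_diagonalizer_def)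

text \<open>Expand x in right singular vectors and bound every singular value below by the last one.
  For a tall matrix the list is not padded, so its last entry, of index
  \<open>dim_col A - 1\<close>, is \<open>sing_val_min A\<close>.\<close>

lemma sing_val_min_bound:
  assumes "dim_col A \<le> dim_row A" "0 < dim_col A" "dim_vec x = dim_col A"
  shows "sing_val_min A * vec_norm2 x \<le> vec_norm2 (A *\<^sub>v x)"
proof -
  obtain W where W: "gram_diagonalizer A W" using gram_diagonalizer_exists by blast
  note [simp] = gram_diagonalizer_dims[OF W] assms(3)
  have unitary: "mat_adjoint (mat_adjoint W) * mat_adjoint W = 1\<^sub>m (dim_col A)"
    using gram_diagonalizer_right_inverse[OF W] by simp
  define y where "y = mat_adjoint W *\<^sub>v x"
  have y: "dim_vec y = dim_col A" by (simp add: y_def)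
  have x: "x = W *\<^sub>v y"
    unfolding y_def using gram_diagonalizer_right_inverse[OF W]
    by (simp add: assoc_mult_mat_vec_dim[symmetric])
  have ny: "vec_norm2 y = vec_norm2 x"
    unfolding y_def by (rule vec_norm2_isometry[OF unitary]) simp_all
  have min: "sing_val_min A = sing_vals A ! (dim_col A - 1)"
    using assms by (simp add: sing_val_min_def sing_val_def min_def)
  have nonneg: "0 \<le> sing_val_min A" unfolding min using assms by (intro sing_vals_nonneg) auto
  have "(sing_val_min A * vec_norm2 x)\<^sup>2 = (\<Sum>i<dim_col A. (sing_val_min A)\<^sup>2 * (cmod (y $ i))\<^sup>2)"
    unfolding ny[symmetric] power_mult_distrib vec_norm2_sq y by (rule sum_distrib_left)
  also have "\<dots> \<le> (\<Sum>i<dim_col A. (sing_vals A ! i)\<^sup>2 * (cmod (y $ i))\<^sup>2)"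
    using nonneg assms unfolding min
    by (intro sum_mono mult_right_mono power_mono sing_vals_antimono) auto
  also have "\<dots> = (vec_norm2 (A *\<^sub>v x))\<^sup>2"
    using gram_diagonalizer_norm[OF W y, folded x] by simp
  finally show ?thesis by (simp add: power2_le_iff_abs_le nonneg)
qed

text \<open>Turns a lower bound on |A v| over unit vectors into a lower bound on
  \<open>sing_val_min A\<close>, as \<open>t_const_rows\<close> requires.\<close>

lemma sing_val_min_attained:
  assumes "dim_col A \<le> dim_row A" "0 < dim_col A"
  obtains v where "dim_vec v = dim_col A" "vec_norm2 v = 1" "vec_norm2 (A *\<^sub>v v) = sing_val_min A"
proof -
  have min: "sing_val_min A = sing_vals A ! (dim_col A - 1)"
    using assms by (simp add: sing_val_min_def sing_val_def min_def)
  have "dim_col A - 1 < dim_col A" using assms by simp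
  then show ?thesis by (rule sing_vals_attained, intro that) (simp_all add: min)
qed

section \<open>Well-conditioned row selections\<close>

text \<open>The Leibniz formula has n! summands, each of modulus at most 1.\<close>

lemma norm_det_le_fact:
  fixes A :: "complex mat"
  assumes "A \<in> carrier_mat n n" "\<And>i j. i < n \<Longrightarrow> j < n \<Longrightarrow> cmod (A $$ (i, j)) \<le> 1"
  shows "cmod (det A) \<le> fact n"
proof -
  have "cmod (det A) \<le> (\<Sum>p | p permutes {0..<n}. 1)"
    unfolding det_def'[OF assms(1)]
  proof (rule order.trans[OF norm_sum], rule sum_mono)
    fix p assume "p \<in> {p. p permutes {0..<n}}"
    then have p: "p permutes {0..<n}" by simp
    have "(\<Prod>i = 0..<n. cmod (A $$ (i, p i))) \<le> 1"
      using p by (intro prod_le_1) (auto intro!: assms(2) dest: permutes_in_image)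
    then show "cmod (of_int (sign p) * (\<Prod>i = 0..<n. A $$ (i, p i))) \<le> 1"
      by (auto simp: norm_mult prod_norm sign_def)
  qed
  also have "\<dots> = fact n" by (simp add: card_permutations)
  finally show ?thesis .
qed

lemma norm_cofactor_le_fact:
  fixes A :: "complex mat"
  assumes "A \<in> carrier_mat n n" "\<And>i j. i < n \<Longrightarrow> j < n \<Longrightarrow> cmod (A $$ (i, j)) \<le> 1"
    and "i < n" "j < n"
  shows "cmod (cofactor A i j) \<le> fact (n - 1)"
proof -
  have "cmod (det (mat_delete A i j)) \<le> fact (n - 1)"
    using assms by (intro norm_det_le_fact mat_delete_carrier) (auto simp: mat_delete_def)
  then show ?thesis by (simp add: cofactor_def norm_mult norm_power)
qed

lemma norm_index_le_vec_norm2: "i < dim_vec v \<Longrightarrow> cmod (v $ i) \<le> vec_norm2 v"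
  unfolding vec_norm2_L2_set by (rule member_le_L2_set) auto

text \<open>The norm is at most the sum of the moduli of the entries. The bound is crude, but it
  depends on the dimensions and on e only, as a uniform constant requires.\<close>

lemma vec_norm2_mult_le_entries:
  assumes "\<And>i j. i < dim_row A \<Longrightarrow> j < dim_col A \<Longrightarrow> cmod (A $$ (i, j)) \<le> e"
    and v: "dim_vec v = dim_col A"
  shows "vec_norm2 (A *\<^sub>v v) \<le> real (dim_row A) * (real (dim_col A) * e) * vec_norm2 v"
proof -
  have "vec_norm2 (A *\<^sub>v v) \<le> (\<Sum>i<dim_row A. cmod ((A *\<^sub>v v) $ i))"
    unfolding vec_norm2_L2_set by (rule order.trans[OF L2_set_le_sum]) auto
  also have "\<dots> \<le> (\<Sum>i<dim_row A. \<Sum>j<dim_col A. e * vec_norm2 v)"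
  proof (rule sum_mono)
    fix i assume i: "i \<in> {..<dim_row A}"
    have "cmod ((A *\<^sub>v v) $ i) \<le> (\<Sum>j<dim_col A. cmod (A $$ (i, j)) * cmod (v $ j))"
      using i v by (auto simp: scalar_prod_def lessThan_atLeast0 norm_mult intro: order.trans[OF norm_sum])
    also have "\<dots> \<le> (\<Sum>j<dim_col A. e * vec_norm2 v)"
    proof (intro sum_mono mult_mono norm_index_le_vec_norm2)
      fix j assume "j \<in> {..<dim_col A}"
      then have "cmod (A $$ (i, j)) \<le> e" using assms(1) i by simp
      then show "cmod (A $$ (i, j)) \<le> e" "0 \<le> e" using norm_ge_zero order.trans by blast+
    qed (use v in auto)
    finally show "cmod ((A *\<^sub>v v) $ i) \<le> (\<Sum>j<dim_col A. e * vec_norm2 v)" .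
  qed
  finally show ?thesis by (simp add: mult_ac)
qed

text \<open>The entry is a coordinate of the image of a unit vector under an isometry.\<close>

lemma orthonormal_cols_entry_le_1:
  assumes "U \<in> orthonormal_cols N r" "i < N" "j < r"
  shows "cmod (U $$ (i, j)) \<le> 1"
proof -
  have U: "U \<in> carrier_mat N r" "mat_adjoint U * U = 1\<^sub>m r"
    using assms(1) by (auto simp: orthonormal_cols_def)
  have "cmod ((U *\<^sub>v unit_vec r j) $ i) \<le> vec_norm2 (U *\<^sub>v unit_vec r j)"
    using U assms by (intro norm_index_le_vec_norm2) auto
  also have "\<dots> = vec_norm2 (unit_vec r j)"
    using U by (intro vec_norm2_isometry[OF U(2)]) auto
  also have "\<dots> = 1"
    using assms(3) by (simp add: vec_norm2_def unit_vec_def if_distrib[of cmod] if_distrib[of "\<lambda>x. x\<^sup>2"] cong: if_cong)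
  finally show ?thesis using U assms by simp
qed

text \<open>Expanding \<open>1 = det (U\<^sup>* U)\<close> by multilinearity in the rows of \<open>U\<close> produces a large minor; the
  bound depends only on the dimensions.\<close>
lemma orthonormal_cols_large_minor:
  fixes N r :: nat
  obtains c :: real where "0 < c"
    "\<And>U. U \<in> orthonormal_cols N r \<Longrightarrow>
      \<exists>f. (\<forall>i<r. f i < N) \<and> c \<le> cmod (det (mat r r (\<lambda>(i, j). U $$ (f i, j))))"
proof -
  \<comment> \<open>The index functions of the multilinear expansion; fixing them as the identity
    outside \<open>{0..<r}\<close> makes the set finite. They may repeat a row, and the minor is
    then 0.\<close>
  define F :: "(nat \<Rightarrow> nat) set"
    where "F = {f. (\<forall>i\<in>{0..<r}. f i \<in> {0..<N}) \<and> (\<forall>i. i \<notin> {0..<r} \<longrightarrow> f i = i)}"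
  have fin: "finite F" unfolding F_def by (rule finite_bounded_functions) auto
  \<comment> \<open>If every minor were below 1 / (1 + card F), the card F summands would add up to
    less than 1.\<close>
  have main: "\<exists>f. (\<forall>i<r. f i < N) \<and> 1 / (1 + real (card F)) \<le> cmod (det (mat r r (\<lambda>(i, j). U $$ (f i, j))))"
    if U: "U \<in> orthonormal_cols N r" for U
  proof (rule ccontr)
    assume contr: "\<not> ?thesis"
    have carr: "U \<in> carrier_mat N r" and UU: "mat_adjoint U * U = 1\<^sub>m r"
      using U by (auto simp: orthonormal_cols_def)
    let ?m = "\<lambda>f. det (mat r r (\<lambda>(i, j). U $$ (f i, j)))"
    have "det (mat_adjoint U * U) =
        (\<Sum>f\<in>F. det (mat\<^sub>r r r (\<lambda>i. mat_adjoint U $$ (i, f i) \<cdot>\<^sub>v row U (f i))))"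
      unfolding mat_mul_finsum_alt[OF mat_adjoint_carrier[OF carr] carr] F_def
      by (rule det_linear_rows_sum) (use carr in auto)
    then have one: "1 = (\<Sum>f\<in>F. det (mat\<^sub>r r r (\<lambda>i. mat_adjoint U $$ (i, f i) \<cdot>\<^sub>v row U (f i))))"
      by (simp add: UU)
    have summand: "cmod (det (mat\<^sub>r r r (\<lambda>i. mat_adjoint U $$ (i, f i) \<cdot>\<^sub>v row U (f i)))) \<le> 1 / (1 + real (card F))"
      if f: "f \<in> F" for f
    proof -
      have fN: "f i < N" if "i < r" for i using f that by (simp add: F_def)
      have "mat\<^sub>r r r (\<lambda>i. row U (f i)) = mat r r (\<lambda>(i, j). U $$ (f i, j))"
        using carr fN by (intro eq_matI) auto
      then have "cmod (det (mat\<^sub>r r r (\<lambda>i. mat_adjoint U $$ (i, f i) \<cdot>\<^sub>v row U (f i)))) =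
          (\<Prod>i = 0..<r. cmod (mat_adjoint U $$ (i, f i))) * cmod (?m f)"
        using carr by (subst det_rows_mul) (auto simp: norm_mult prod_norm)
      \<comment> \<open>The coefficients are conjugates of entries of U, hence of modulus at most
        1.\<close>
      also have "\<dots> \<le> 1 * cmod (?m f)"
        using carr fN orthonormal_cols_entry_le_1[OF U]
        by (intro mult_right_mono prod_le_1) auto
      also have "\<dots> \<le> 1 / (1 + real (card F))"
      proof -
        have "\<not> 1 / (1 + real (card F)) \<le> cmod (?m f)" using contr fN by blast
        then show ?thesis by simp
      qed
      finally show ?thesis .
    qed
    have "1 \<le> (\<Sum>f\<in>F. cmod (det (mat\<^sub>r r r (\<lambda>i. mat_adjoint U $$ (i, f i) \<cdot>\<^sub>v row U (f i)))))"
      using norm_sum[of "\<lambda>f. det (mat\<^sub>r r r (\<lambda>i. mat_adjoint U $$ (i, f i) \<cdot>\<^sub>v row U (f i)))" F]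
      unfolding one[symmetric] by simp
    also have "\<dots> \<le> real (card F) * (1 / (1 + real (card F)))"
      using sum_bounded_above[OF summand] by simp
    also have "\<dots> < 1" by (simp add: field_simps)
    finally show False by simp
  qed
  show ?thesis by (rule that[OF _ main]) auto
qed

section \<open>Norms of row submatrices\<close>

lemma submatrix_rows_eq_mat:
  assumes "I \<subseteq> {..<dim_row A}"
  shows "submatrix A I UNIV = mat (card I) (dim_col A) (\<lambda>(i, j). A $$ (pick I i, j))"
proof -
  have "{i. i < dim_row A \<and> i \<in> I} = I" using assms by auto
  then show ?thesis by (simp add: submatrix_def pick_UNIV)
qed

lemma bij_betw_pick:
  assumes "finite I"
  shows "bij_betw (pick I) {..<card I} I"
proof -
  have "inj_on (pick I) {..<card I}"
  proof (rule inj_onI)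
    fix i j assume "i \<in> {..<card I}" "j \<in> {..<card I}" "pick I i = pick I j"
    then show "i = j" using pick_mono_le[of i I j] pick_mono_le[of j I i]
      by (metis lessThan_iff less_irrefl nat_neq_iff)
  qed
  moreover have "pick I ` {..<card I} \<subseteq> I" using pick_in_set_le by auto
  ultimately show ?thesis using assms
    by (simp add: bij_betw_def card_image card_subset_eq)
qed

lemma vec_norm2_submatrix_rows:
  assumes I: "I \<subseteq> {..<dim_row A}" and x: "dim_vec x = dim_col A"
  shows "(vec_norm2 (submatrix A I UNIV *\<^sub>v x))\<^sup>2 = (\<Sum>i\<in>I. (cmod ((A *\<^sub>v x) $ i))\<^sup>2)"
proof -
  have fin: "finite I" using I finite_subset by blast
  have ent: "(submatrix A I UNIV *\<^sub>v x) $ i = (A *\<^sub>v x) $ pick I i" if "i < card I" for i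
  proof -
    have "pick I i < dim_row A" using pick_in_set_le[OF that] I by auto
    then show ?thesis using that x by (simp add: submatrix_rows_eq_mat[OF I] scalar_prod_def)
  qed
  have "(vec_norm2 (submatrix A I UNIV *\<^sub>v x))\<^sup>2 = (\<Sum>i<card I. (cmod ((A *\<^sub>v x) $ pick I i))\<^sup>2)"
    unfolding vec_norm2_sq using ent by (simp add: submatrix_rows_eq_mat[OF I])
  also have "\<dots> = (\<Sum>i\<in>I. (cmod ((A *\<^sub>v x) $ i))\<^sup>2)"
    by (rule sum.reindex_bij_betw[OF bij_betw_pick[OF fin]])
  finally show ?thesis .
qed

lemma norm_index_le_submatrix_rows:
  assumes I: "I \<subseteq> {..<dim_row A}" and x: "dim_vec x = dim_col A" and i: "i \<in> I"
  shows "cmod ((A *\<^sub>v x) $ i) \<le> vec_norm2 (submatrix A I UNIV *\<^sub>v x)"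
proof -
  have fin: "finite I" using I finite_subset by blast
  have "(cmod ((A *\<^sub>v x) $ i))\<^sup>2 \<le> (\<Sum>i\<in>I. (cmod ((A *\<^sub>v x) $ i))\<^sup>2)"
    using fin i by (intro member_le_sum) auto
  then show ?thesis
    unfolding vec_norm2_submatrix_rows[OF I x, symmetric] by (simp add: power2_le_iff_abs_le)
qed

lemma vec_norm2_submatrix_rows_le:
  assumes I: "I \<subseteq> {..<dim_row A}" and x: "dim_vec x = dim_col A"
  shows "vec_norm2 (submatrix A I UNIV *\<^sub>v x) \<le> vec_norm2 (A *\<^sub>v x)"
proof -
  have "(vec_norm2 (submatrix A I UNIV *\<^sub>v x))\<^sup>2 \<le> (vec_norm2 (A *\<^sub>v x))\<^sup>2"
    unfolding vec_norm2_submatrix_rows[OF I x] unfolding vec_norm2_sq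
    using I by (intro sum_mono2) auto
  then show ?thesis by (simp add: power2_le_iff_abs_le)
qed

text \<open>The adjugate makes a large minor quantitative: det(B) x = adj(B) (B x), and the entries
  of adj(B) are at most (r-1)! because those of U have modulus at most 1. Enlarging the rows of B to
  k rows keeps the lower bound. The constant does not depend on U, so it also bounds the infimum in
  \<open>t_const\<close> away from 0.\<close>

lemma orthonormal_cols_good_rows:
  assumes "r \<le> k" "k \<le> N"
  obtains c :: real where "0 < c"
    "\<And>U. U \<in> orthonormal_cols N r \<Longrightarrow> \<exists>I\<subseteq>{..<N}. card I = k \<and>
      (\<forall>x. dim_vec x = r \<longrightarrow> c * vec_norm2 x \<le> vec_norm2 (submatrix U I UNIV *\<^sub>v x))"
proof -
  obtain c :: real where c: "0 < c" and minor: "\<And>U. U \<in> orthonormal_cols N r \<Longrightarrow>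
      \<exists>f. (\<forall>i<r. f i < N) \<and> c \<le> cmod (det (mat r r (\<lambda>(i, j). U $$ (f i, j))))"
    using orthonormal_cols_large_minor by blast
  \<comment> \<open>The product r (r (r-1)!) bounds the adjugate, and the last factor r bounds |B x|
    by the norm on the selected rows. Dividing by 1 + b below avoids a zero denominator.\<close>
  define b where "b = real r * (real r * fact (r - 1)) * real r"
  have b: "0 \<le> b" by (simp add: b_def)
  have main: "\<exists>I\<subseteq>{..<N}. card I = k \<and>
      (\<forall>x. dim_vec x = r \<longrightarrow> c / (1 + b) * vec_norm2 x \<le> vec_norm2 (submatrix U I UNIV *\<^sub>v x))"
    if U: "U \<in> orthonormal_cols N r" for U
  proof -
    have carr: "U \<in> carrier_mat N r" using U by (auto simp: orthonormal_cols_def)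
    obtain f where f: "\<And>i. i < r \<Longrightarrow> f i < N"
      and det: "c \<le> cmod (det (mat r r (\<lambda>(i, j). U $$ (f i, j))))"
      using minor[OF U] by blast
    \<comment> \<open>The image of f has at most r \<le> k elements, whether or not f is injective,
      and is filled up to exactly k rows.\<close>
    have "card (f ` {..<r}) \<le> k" using card_image_le[of "{..<r}" f] assms(1) by simp
    then obtain I where I: "f ` {..<r} \<subseteq> I" "I \<subseteq> {..<N}" "card I = k"
      using exists_subset_between[of "f ` {..<r}" k "{..<N}"] assms(2) f by auto
    define B where "B = mat r r (\<lambda>(i, j). U $$ (f i, j))"
    have B: "B \<in> carrier_mat r r" by (simp add: B_def)
    have "c / (1 + b) * vec_norm2 x \<le> vec_norm2 (submatrix U I UNIV *\<^sub>v x)"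
      if x: "dim_vec x = r" for x
    proof -
      let ?s = "vec_norm2 (submatrix U I UNIV *\<^sub>v x)"
      have "adj_mat B *\<^sub>v (B *\<^sub>v x) = det B \<cdot>\<^sub>v x"
      proof -
        have "adj_mat B *\<^sub>v (B *\<^sub>v x) = (det B \<cdot>\<^sub>m 1\<^sub>m r) *\<^sub>v x"
          unfolding adj_mat(3)[OF B, symmetric] using B adj_mat(1)[OF B] x
          by (intro assoc_mult_mat_vec_dim[symmetric]) auto
        also have "\<dots> = det B \<cdot>\<^sub>v x"
          using x by (intro eq_vecI) auto
        finally show ?thesis .
      qed
      then have "c * vec_norm2 x \<le> vec_norm2 (adj_mat B *\<^sub>v (B *\<^sub>v x))"
        using det by (simp add: vec_norm2_smult mult_right_mono B_def)
      also have "\<dots> \<le> real r * (real r * fact (r - 1)) * vec_norm2 (B *\<^sub>v x)"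
      proof -
        have B_le: "cmod (B $$ (i, j)) \<le> 1" if "i < r" "j < r" for i j
          using that f orthonormal_cols_entry_le_1[OF U] by (simp add: B_def)
        have "cmod (adj_mat B $$ (i, j)) \<le> fact (r - 1)" if "i < r" "j < r" for i j
        proof -
          have "adj_mat B $$ (i, j) = cofactor B j i" using that B by (simp add: adj_mat_def)
          then show ?thesis using norm_cofactor_le_fact[OF B B_le that(2,1)] by simp
        qed
        then show ?thesis
          using vec_norm2_mult_le_entries[of "adj_mat B" "fact (r - 1)" "B *\<^sub>v x"] adj_mat(1)[OF B] B by auto
      qed
      also have "\<dots> \<le> real r * (real r * fact (r - 1)) * (real r * ?s)"
      proof (intro mult_left_mono)
        have "vec_norm2 (B *\<^sub>v x) \<le> (\<Sum>i<r. cmod ((B *\<^sub>v x) $ i))"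
          unfolding vec_norm2_L2_set using B by (intro order.trans[OF L2_set_le_sum]) auto
        also have "\<dots> \<le> (\<Sum>i<r. ?s)"
        proof (rule sum_mono)
          fix i assume "i \<in> {..<r}"
          then have i: "i < r" by simp
          \<comment> \<open>Row i of B is row f i of U, and f i lies in I.\<close>
          have "(B *\<^sub>v x) $ i = (U *\<^sub>v x) $ f i"
            using i x f[OF i] carr by (simp add: B_def scalar_prod_def)
          also have "cmod \<dots> \<le> ?s"
            using I i carr x by (intro norm_index_le_submatrix_rows) auto
          finally show "cmod ((B *\<^sub>v x) $ i) \<le> ?s" .
        qed
        finally show "vec_norm2 (B *\<^sub>v x) \<le> real r * ?s" by simp
      qed simp
      also have "\<dots> = b * ?s" by (simp add: b_def)
      also have "\<dots> \<le> (1 + b) * ?s" by (simp add: mult_right_mono)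
      finally show ?thesis using b by (simp add: field_simps)
    qed
    then show ?thesis using I by blast
  qed
  show ?thesis by (rule that[OF _ main]) (use c b in auto)
qed

text \<open>The infimum m lies below the maximum for the given U and is positive by the uniform
  constant c, so inverting it gives a genuine bound. A maximising set of rows for U then has the
  required property. The inequality 1 \<le> t is what the passage to complementary projections asks
  for.\<close>

lemma t_const_rows:
  assumes r: "1 \<le> r" "r \<le> k" "k \<le> N" and U: "U \<in> orthonormal_cols N r"
  obtains I where "I \<subseteq> {..<N}" "card I = k"
    "\<And>x. dim_vec x = r \<Longrightarrow> vec_norm2 x \<le> t_const r N k * vec_norm2 (submatrix U I UNIV *\<^sub>v x)"
    "1 \<le> t_const r N k"
proof -
  obtain c :: real where c: "0 < c" and good: "\<And>U. U \<in> orthonormal_cols N r \<Longrightarrow> \<exists>I\<subseteq>{..<N}. card I = k \<and>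
      (\<forall>x. dim_vec x = r \<longrightarrow> c * vec_norm2 x \<le> vec_norm2 (submatrix U I UNIV *\<^sub>v x))"
    using orthonormal_cols_good_rows[OF r(2,3)] by blast
  let ?g = "\<lambda>U. Max (sing_val_min ` row_submats k U)"
  have fin: "finite (sing_val_min ` row_submats k U)" for U
  proof -
    have "row_submats k U \<subseteq> (\<lambda>I. submatrix U I UNIV) ` Pow {..<dim_row U}"
      by (auto simp: row_submats_def)
    then show ?thesis by (meson finite_Pow_iff finite_imageI finite_lessThan finite_subset)
  qed
  have dims: "dim_row (submatrix U I UNIV) = card I" "dim_col (submatrix U I UNIV) = r"
    if "U \<in> orthonormal_cols N r" "I \<subseteq> {..<N}" for U I
    using that submatrix_rows_eq_mat[of I U] by (auto simp: orthonormal_cols_def)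
  have lower: "c \<le> ?g U" if U: "U \<in> orthonormal_cols N r" for U
  proof -
    obtain I where I: "I \<subseteq> {..<N}" "card I = k"
      and bound: "\<And>x. dim_vec x = r \<Longrightarrow> c * vec_norm2 x \<le> vec_norm2 (submatrix U I UNIV *\<^sub>v x)"
      using good[OF U] by blast
    obtain v where v: "dim_vec v = r" "vec_norm2 v = 1"
      "vec_norm2 (submatrix U I UNIV *\<^sub>v v) = sing_val_min (submatrix U I UNIV)"
      using sing_val_min_attained[of "submatrix U I UNIV"] dims[OF U I(1)] I(2) r by auto
    have "c \<le> sing_val_min (submatrix U I UNIV)" using bound[OF v(1)] v by simp
    also have "submatrix U I UNIV \<in> row_submats k U"
      using U I by (auto simp: row_submats_def orthonormal_cols_def)
    then have "sing_val_min (submatrix U I UNIV) \<le> ?g U" by (intro Max_ge fin) simp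
    finally show ?thesis .
  qed
  define m where "m = (INF U \<in> orthonormal_cols N r. ?g U)"
  have m: "0 < m"
    unfolding m_def using U lower by (intro order.strict_trans2[OF c] cINF_greatest) auto
  have "m \<le> ?g U"
    unfolding m_def using U lower by (intro cINF_lower bdd_belowI2[of _ c]) auto
  have ne: "sing_val_min ` row_submats k U \<noteq> {}"
    using good[OF U] U by (auto simp: row_submats_def orthonormal_cols_def)
  from Max_in[OF fin ne] obtain I where I: "I \<subseteq> {..<N}" "card I = k" "?g U = sing_val_min (submatrix U I UNIV)"
    using U by (auto simp: row_submats_def orthonormal_cols_def)
  have t: "t_const r N k = inverse m" by (simp add: t_const_def m_def)
  have main: "vec_norm2 x \<le> t_const r N k * vec_norm2 (submatrix U I UNIV *\<^sub>v x)" if x: "dim_vec x = r" for x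
  proof -
    have "m * vec_norm2 x \<le> ?g U * vec_norm2 x"
      using \<open>m \<le> ?g U\<close> by (simp add: mult_right_mono)
    also have "\<dots> \<le> vec_norm2 (submatrix U I UNIV *\<^sub>v x)"
      unfolding I(3) using dims[OF U I(1)] I(2) r x by (intro sing_val_min_bound) auto
    finally show ?thesis using m by (simp add: t field_simps)
  qed
  \<comment> \<open>A row submatrix of an isometry is a contraction; test the bound at a unit
    vector.\<close>
  have "1 \<le> t_const r N k"
  proof -
    have carr: "U \<in> carrier_mat N r" "mat_adjoint U * U = 1\<^sub>m r"
      using U by (auto simp: orthonormal_cols_def)
    let ?x = "unit_vec r 0"
    have x: "vec_norm2 ?x = 1"
      using r by (simp add: vec_norm2_def unit_vec_def if_distrib[of cmod] if_distrib[of "\<lambda>x. x\<^sup>2"] cong: if_cong)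
    have "vec_norm2 (submatrix U I UNIV *\<^sub>v ?x) \<le> vec_norm2 (U *\<^sub>v ?x)"
      using carr I by (intro vec_norm2_submatrix_rows_le) auto
    also have "\<dots> = vec_norm2 ?x" using carr by (intro vec_norm2_isometry) auto
    finally have "t_const r N k * vec_norm2 (submatrix U I UNIV *\<^sub>v ?x) \<le> t_const r N k * 1"
      using m by (intro mult_left_mono) (auto simp: t x)
    then show ?thesis using main[of ?x] x by simp
  qed
  with main I show ?thesis using that by blast
qed

section \<open>Pseudo-inverses and projections\<close>

text \<open>\<open>pinv\<close> is a definite description, so uniqueness is the point. For two
  solutions X and Y, A X = (A Y)(A X) is the adjoint of (A X)(A Y) = A Y, hence equals A Y. Likewise
  X A = Y A, and therefore Y = Y A Y = X A X = X.\<close>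

lemma pinv_eqI:
  fixes A X :: "complex mat"
  assumes X: "X \<in> carrier_mat (dim_col A) (dim_row A)" "A * X * A = A" "X * A * X = X"
    "mat_adjoint (A * X) = A * X" "mat_adjoint (X * A) = X * A"
  shows "pinv A = X"
  unfolding pinv_def
proof (rule the_equality)
  fix Y assume "Y \<in> carrier_mat (dim_col A) (dim_row A) \<and> A * Y * A = A \<and> Y * A * Y = Y \<and>
    mat_adjoint (A * Y) = A * Y \<and> mat_adjoint (Y * A) = Y * A"
  then have Y: "Y \<in> carrier_mat (dim_col A) (dim_row A)" "A * Y * A = A" "Y * A * Y = Y"
    "mat_adjoint (A * Y) = A * Y" "mat_adjoint (Y * A) = Y * A" by auto
  have [simp]: "dim_row X = dim_col A" "dim_col X = dim_row A" "dim_row Y = dim_col A" "dim_col Y = dim_row A"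
    using X(1) Y(1) by auto
  have "A * X = A * Y * A * X" by (simp only: Y(2))
  also have "\<dots> = (A * Y) * (A * X)" by (simp add: assoc_mult_mat_dim)
  also have "\<dots> = mat_adjoint ((A * X) * (A * Y))"
    by (subst mat_adjoint_mult) (simp_all add: X(4) Y(4))
  also have "(A * X) * (A * Y) = A * X * A * Y" by (simp add: assoc_mult_mat_dim)
  also have "\<dots> = A * Y" by (simp only: X(2))
  also have "mat_adjoint \<dots> = A * Y" by (rule Y(4))
  finally have AX: "A * X = A * Y" .
  have "X * A = X * (A * Y * A)" by (simp only: Y(2))
  also have "\<dots> = (X * A) * (Y * A)" by (simp add: assoc_mult_mat_dim)
  also have "\<dots> = mat_adjoint ((Y * A) * (X * A))"
    by (subst mat_adjoint_mult) (simp_all add: X(5) Y(5))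
  also have "(Y * A) * (X * A) = Y * (A * X * A)" by (simp add: assoc_mult_mat_dim)
  also have "\<dots> = Y * A" by (simp only: X(2))
  also have "mat_adjoint \<dots> = Y * A" by (rule Y(5))
  finally have XA: "X * A = Y * A" .
  have "Y = Y * A * Y" by (rule Y(3)[symmetric])
  also have "\<dots> = X * A * Y" by (simp only: XA)
  also have "\<dots> = X * (A * Y)" by (simp add: assoc_mult_mat_dim)
  also have "\<dots> = X * A * X" by (simp add: AX[symmetric] assoc_mult_mat_dim)
  also have "\<dots> = X" by (rule X(3))
  finally show "Y = X" .
qed (use X in blast)

text \<open>Once L B = 1, the Hermitian condition on B L is all that remains of the four Penrose
  equations.\<close>

lemma pinv_eq_left_inverse:
  fixes B L :: "complex mat"
  assumes "L \<in> carrier_mat (dim_col B) (dim_row B)" "L * B = 1\<^sub>m (dim_col B)"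
    "mat_adjoint (B * L) = B * L"
  shows "pinv B = L"
proof (rule pinv_eqI)
  have [simp]: "dim_row L = dim_col B" "dim_col L = dim_row B" using assms(1) by auto
  show "B * L * B = B" by (simp add: assoc_mult_mat_dim assms(2))
  show "L * B * L = L" by (simp add: assms(2))
  show "mat_adjoint (L * B) = L * B" by (simp add: assms(2))
qed (use assms in auto)

text \<open>Full column rank as a trivial kernel, the form that passes through products and Gram
  matrices without dimension counts.\<close>

definition inj_mat :: "complex mat \<Rightarrow> bool" where
  "inj_mat B \<longleftrightarrow> (\<forall>x. dim_vec x = dim_col B \<longrightarrow> B *\<^sub>v x = 0\<^sub>v (dim_row B) \<longrightarrow> x = 0\<^sub>v (dim_col B))"

lemma inj_matD:
  "inj_mat B \<Longrightarrow> dim_vec x = dim_col B \<Longrightarrow> B *\<^sub>v x = 0\<^sub>v (dim_row B) \<Longrightarrow> x = 0\<^sub>v (dim_col B)"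
  by (simp add: inj_mat_def)

lemma inj_mat_square_inverse:
  assumes G: "G \<in> carrier_mat n n" and inj: "inj_mat G"
  obtains H where "H \<in> carrier_mat n n" "H * G = 1\<^sub>m n" "G * H = 1\<^sub>m n"
proof -
  have "det G \<noteq> 0"
  proof
    assume "det G = 0"
    then obtain v where "v \<in> carrier_vec n" "v \<noteq> 0\<^sub>v n" "G *\<^sub>v v = 0\<^sub>v n"
      using det_0_iff_vec_prod_zero[OF G] by blast
    then show False using inj_matD[OF inj, of v] G by auto
  qed
  then have "G \<in> Units (ring_mat TYPE(complex) n ())" by (rule det_non_zero_imp_unit[OF G])
  then show ?thesis using that unfolding Units_def ring_mat_def by auto
qed

lemma vec_norm2_eq_0D: "vec_norm2 v = 0 \<Longrightarrow> dim_vec v = n \<Longrightarrow> v = 0\<^sub>v n"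
  using vec_norm2_eq_0_iff by metis

lemma mat_mult_zero_vec_dim [simp]:
  "dim_col A = n \<Longrightarrow> A *\<^sub>v 0\<^sub>v n = (0\<^sub>v (dim_row A) :: 'a :: semiring_0 vec)"
  by (rule eq_vecI) (simp_all add: scalar_prod_def)

text \<open><x, B^H B x> = |B x|^2, so both matrices have the same kernel.\<close>

lemma inj_mat_gram:
  assumes "inj_mat B"
  shows "inj_mat (mat_adjoint B * B)"
  unfolding inj_mat_def
proof (intro allI impI)
  fix x assume x: "dim_vec x = dim_col (mat_adjoint B * B)"
    and zero: "mat_adjoint B * B *\<^sub>v x = 0\<^sub>v (dim_row (mat_adjoint B * B))"
  have "complex_of_real ((vec_norm2 (B *\<^sub>v x))\<^sup>2) = x \<bullet>c (mat_adjoint B * B *\<^sub>v x)"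
    unfolding vec_norm2_sq_cscalar_prod using x by (simp add: cscalar_prod_adjoint assoc_mult_mat_vec_dim)
  also have "\<dots> = 0" unfolding zero using x by (simp add: scalar_prod_def)
  finally have "vec_norm2 (B *\<^sub>v x) = 0" by simp
  then have "B *\<^sub>v x = 0\<^sub>v (dim_row B)" by (rule vec_norm2_eq_0D) simp
  with inj_matD[OF assms, of x] x show "x = 0\<^sub>v (dim_col (mat_adjoint B * B))" by simp
qed

text \<open>For full column rank the pseudo-inverse is (B^H B)^-1 B^H.\<close>

lemma pinv_inj_mat:
  assumes "inj_mat B"
  shows "pinv B \<in> carrier_mat (dim_col B) (dim_row B)" "pinv B * B = 1\<^sub>m (dim_col B)"
    "mat_adjoint (B * pinv B) = B * pinv B"
proof -
  let ?G = "mat_adjoint B * B"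
  have "?G \<in> carrier_mat (dim_col B) (dim_col B)" by (rule carrier_matI) simp_all
  from inj_mat_square_inverse[OF this inj_mat_gram[OF assms]]
  obtain H where H: "H \<in> carrier_mat (dim_col B) (dim_col B)" "H * ?G = 1\<^sub>m (dim_col B)" "?G * H = 1\<^sub>m (dim_col B)"
    by blast
  have [simp]: "dim_row H = dim_col B" "dim_col H = dim_col B" using H by auto
  \<comment> \<open>The inverse of the Hermitian Gram matrix is again Hermitian.\<close>
  have "mat_adjoint (?G * H) = mat_adjoint H * ?G"
    by (subst mat_adjoint_mult) (simp_all add: mat_adjoint_mult)
  then have "mat_adjoint H * ?G = 1\<^sub>m (dim_col B)" by (simp add: H(3))
  then have "mat_adjoint H * ?G * H = H" by simp
  then have herm: "mat_adjoint H = H" by (simp add: assoc_mult_mat_dim H(3)[simplified assoc_mult_mat_dim])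
  let ?L = "H * mat_adjoint B"
  have L: "?L \<in> carrier_mat (dim_col B) (dim_row B)" by (rule carrier_matI) simp_all
  have LB: "?L * B = 1\<^sub>m (dim_col B)" using H(2) by (simp add: assoc_mult_mat_dim)
  have BL: "mat_adjoint (B * ?L) = B * ?L"
    by (simp add: mat_adjoint_mult herm assoc_mult_mat_dim)
  have "pinv B = ?L" by (rule pinv_eq_left_inverse[OF L LB BL])
  then show "pinv B \<in> carrier_mat (dim_col B) (dim_row B)" "pinv B * B = 1\<^sub>m (dim_col B)"
    "mat_adjoint (B * pinv B) = B * pinv B"
    using L LB BL by auto
qed

text \<open>|P v|^2 = <v, P v> \<le> |v| |P v|.\<close>

lemma op_bound_orthogonal_projection:
  fixes P :: "complex mat"
  assumes P: "P * P = P" "mat_adjoint P = P"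
  shows "op_bound P 1"
  unfolding op_bound_def
proof (intro conjI allI impI)
  fix v :: "complex vec" assume v: "dim_vec v = dim_col P"
  have sq: "dim_row P = dim_col P" using P(2) dim_mat_adjoint(1)[of P] by simp
  have "complex_of_real ((vec_norm2 (P *\<^sub>v v))\<^sup>2) = v \<bullet>c (mat_adjoint P *\<^sub>v (P *\<^sub>v v))"
    unfolding vec_norm2_sq_cscalar_prod by (rule cscalar_prod_adjoint) (simp_all add: v)
  also have "mat_adjoint P *\<^sub>v (P *\<^sub>v v) = (P * P) *\<^sub>v v"
    unfolding P(2) by (rule assoc_mult_mat_vec_dim[symmetric]) (simp_all add: v sq)
  also have "\<dots> = P *\<^sub>v v" by (simp only: P(1))
  finally have "(vec_norm2 (P *\<^sub>v v))\<^sup>2 = cmod (v \<bullet>c (P *\<^sub>v v))"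
    by (metis abs_of_nonneg norm_of_real zero_le_power2)
  also have "\<dots> \<le> vec_norm2 v * vec_norm2 (P *\<^sub>v v)"
    by (rule norm_cscalar_prod_le) (simp add: v sq)
  finally have le: "vec_norm2 (P *\<^sub>v v) * vec_norm2 (P *\<^sub>v v) \<le> vec_norm2 v * vec_norm2 (P *\<^sub>v v)"
    by (simp add: power2_eq_square)
  show "vec_norm2 (P *\<^sub>v v) \<le> 1 * vec_norm2 v"
  proof (cases "vec_norm2 (P *\<^sub>v v) = 0")
    case False
    then have "0 < vec_norm2 (P *\<^sub>v v)" using vec_norm2_nonneg[of "P *\<^sub>v v"] by linarith
    with le show ?thesis by simp
  qed simp
qed simp

text \<open>B pinv(B) is an orthogonal projection, so |pinv(B) y| \<le> t |B pinv(B) y| \<le> t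
  |y|.\<close>

lemma op_bound_pinv:
  assumes inj: "inj_mat B" and t: "0 \<le> t"
    and bound: "\<And>x. dim_vec x = dim_col B \<Longrightarrow> vec_norm2 x \<le> t * vec_norm2 (B *\<^sub>v x)"
  shows "op_bound (pinv B) t"
proof -
  note L = pinv_inj_mat[OF inj]
  have [simp]: "dim_row (pinv B) = dim_col B" "dim_col (pinv B) = dim_row B" using L(1) by auto
  have "B * pinv B * (B * pinv B) = B * (pinv B * B * pinv B)" by (simp add: assoc_mult_mat_dim)
  then have proj: "op_bound (B * pinv B) 1"
    using L(2,3) by (intro op_bound_orthogonal_projection) simp_all
  show ?thesis
    unfolding op_bound_def
  proof (intro conjI allI impI t)
    fix y :: "complex vec" assume y: "dim_vec y = dim_col (pinv B)"
    have "vec_norm2 (pinv B *\<^sub>v y) \<le> t * vec_norm2 (B *\<^sub>v (pinv B *\<^sub>v y))" by (rule bound) simp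
    also have "B *\<^sub>v (pinv B *\<^sub>v y) = (B * pinv B) *\<^sub>v y" using y by (simp add: assoc_mult_mat_vec_dim)
    also have "t * vec_norm2 \<dots> \<le> t * vec_norm2 y"
      using op_boundD[OF proj, of y] y t by (intro mult_left_mono) simp_all
    finally show "vec_norm2 (pinv B *\<^sub>v y) \<le> t * vec_norm2 y" .
  qed
qed

lemma smult_zero_vec: "c \<cdot>\<^sub>v 0\<^sub>v n = (0\<^sub>v n :: 'a :: mult_zero vec)"
  by (rule eq_vecI) simp_all

lemma cmod_add_sq: "(cmod (a + b))\<^sup>2 = (cmod a)\<^sup>2 + (cmod b)\<^sup>2 + 2 * Re (a * cnj b)"
  unfolding cmod_power2 by (simp add: power2_eq_square algebra_simps)

lemma vec_norm2_add_sq: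
  assumes "dim_vec v = dim_vec w"
  shows "(vec_norm2 (v + w))\<^sup>2 = (vec_norm2 v)\<^sup>2 + (vec_norm2 w)\<^sup>2 + 2 * Re (v \<bullet>c w)"
  using assms unfolding vec_norm2_sq scalar_prod_def
  by (simp add: cmod_add_sq sum.distrib sum_distrib_left lessThan_atLeast0)

text \<open>Exchanging the lengths of the two components \<open>a = P v\<close> and \<open>b = v - P v\<close> preserves the norm of
  their sum, and \<open>P\<close> maps the new vector to a multiple of \<open>a\<close> that is as long as \<open>b\<close>.\<close>
lemma op_bound_complementary_projection:
  fixes P :: "complex mat"
  assumes P: "P \<in> carrier_mat n n" "P * P = P" and bound: "op_bound P t" and t: "1 \<le> t"
  shows "op_bound (1\<^sub>m n - P) t"
  unfolding op_bound_def
proof (intro conjI allI impI)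
  show "0 \<le> t" using t by simp
  fix v :: "complex vec" assume "dim_vec v = dim_col (1\<^sub>m n - P)"
  then have v: "v \<in> carrier_vec n" using P(1) by (intro carrier_vecI) auto
  define a b where "a = P *\<^sub>v v" and "b = v - a"
  have a: "a \<in> carrier_vec n" and b: "b \<in> carrier_vec n"
    using v P(1) by (auto simp: a_def b_def)
  have v_eq: "v = a + b" using v a by (auto simp: b_def)
  have Pa: "P *\<^sub>v a = a"
    unfolding a_def using P v assoc_mult_mat_vec[OF P(1,1) v] by simp
  have Pb: "P *\<^sub>v b = 0\<^sub>v n"
    unfolding b_def using P(1) v a Pa by (simp add: mult_minus_distrib_mat_vec) (simp add: a_def)
  have "(1\<^sub>m n - P) *\<^sub>v v = b"
    using minus_mult_distrib_mat_vec[OF one_carrier_mat P(1) v] v by (simp add: b_def a_def)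
  moreover have "vec_norm2 b \<le> t * vec_norm2 v"
  proof (cases "vec_norm2 a = 0 \<or> vec_norm2 b = 0")
    case True
    then show ?thesis
    proof
      \<comment> \<open>The ratio of lengths is undefined here; b = v, and 1 \<le> t gives the
        bound.\<close>
      assume "vec_norm2 a = 0"
      then have "a = 0\<^sub>v n" using a by (intro vec_norm2_eq_0D) auto
      then have "b = v" using v by (auto simp: b_def)
      then show ?thesis using t mult_right_mono[of 1 t "vec_norm2 v"] by simp
    qed (use t in simp)
  next
    case False
    then have pos: "0 < vec_norm2 a" "0 < vec_norm2 b"
      using vec_norm2_nonneg[of a] vec_norm2_nonneg[of b] by linarith+
    let ?c = "vec_norm2 b / vec_norm2 a"
    define w where "w = complex_of_real ?c \<cdot>\<^sub>v a + complex_of_real (1 / ?c) \<cdot>\<^sub>v b"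
    have w: "w \<in> carrier_vec n" using a b by (auto simp: w_def)
    \<comment> \<open>The two scalars are real and reciprocal, so the cross term of |w|^2 is that of
      |v|^2.\<close>
    have ab: "(complex_of_real ?c \<cdot>\<^sub>v a) \<bullet>c (complex_of_real (1 / ?c) \<cdot>\<^sub>v b) = a \<bullet>c b"
      using a b pos by (simp add: conjugate_smult_vec)
    have "(vec_norm2 w)\<^sup>2 = (vec_norm2 v)\<^sup>2"
      unfolding w_def v_eq using a b pos ab
      by (simp add: vec_norm2_add_sq vec_norm2_smult norm_divide del: of_real_divide)
    then have nw: "vec_norm2 w = vec_norm2 v" by (simp add: power2_eq_iff_nonneg)
    have "P *\<^sub>v w = complex_of_real ?c \<cdot>\<^sub>v a"
      unfolding w_def using P(1) a b
      by (simp add: mult_add_distrib_mat_vec[OF P(1)] mult_mat_vec[OF P(1)] Pa Pb smult_zero_vec del: of_real_divide)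
    then have "vec_norm2 b = vec_norm2 (P *\<^sub>v w)"
      using pos by (simp add: vec_norm2_smult norm_divide)
    also have "\<dots> \<le> t * vec_norm2 v"
      using op_boundD[OF bound, of w] w P(1) nw by auto
    finally show ?thesis .
  qed
  ultimately show "vec_norm2 ((1\<^sub>m n - P) *\<^sub>v v) \<le> t * vec_norm2 v" by simp
qed

section \<open>Rank and orthonormalization\<close>

text \<open>The rank is the size of a maximal independent subset of the columns. Counting the
  columns as a set is what excludes repetitions in a matrix of full column rank.\<close>

lemma (in vec_space) rank_le_card_cols:
  assumes "A \<in> carrier_mat n nc"
  shows "rank A \<le> card (set (cols A))"
proof -
  obtain S where S: "maximal S (\<lambda>T. T \<subseteq> set (cols A) \<and> lin_indpt T)"
    using maximal_exists[of "(\<lambda>T. T \<subseteq> set (cols A) \<and> lin_indpt T)" "card (set (cols A))" "{}"]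
    by (meson List.finite_set card_mono empty_iff empty_subsetI finite_lin_indpt2 rev_finite_subset)
  then show ?thesis
    using rank_card_indpt[OF assms S] by (simp add: card_mono maximal_def)
qed

lemma inj_mat_of_full_rank:
  assumes B: "B \<in> carrier_mat N r" and rank: "mat_rank B = r"
  shows "inj_mat B"
proof -
  interpret vec_space "TYPE(complex)" N .
  have rank': "rank B = r" using rank B by (simp add: mat_rank_def)
  \<comment> \<open>Independence of the set of columns is blind to repeated columns, so distinctness
    is shown first.\<close>
  have "r \<le> card (set (cols B))" using rank_le_card_cols[OF B] rank' by simp
  then have dist: "distinct (cols B)"
    using B card_length[of "cols B"] by (intro card_distinct) simp
  have "lin_indpt (set (cols B))" by (rule full_rank_lin_indpt[OF B rank' dist])
  then show ?thesis
    using lin_depI[OF B _ _ _ dist] B unfolding inj_mat_def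
    by (metis carrier_matD carrier_vecI)
qed

text \<open>The column space of A B lies in that of A, whose dimension is at most its number k of
  columns. A factorisation through dimension k thus becomes a rank bound.\<close>

lemma (in vec_space) rank_mult_le:
  assumes A: "A \<in> carrier_mat n k" and B: "B \<in> carrier_mat k nc"
  shows "rank (A * B) \<le> k"
proof -
  have AB: "A * B \<in> carrier_mat n nc" using A B by simp
  have colsA: "set (cols A) \<subseteq> carrier_vec n" using A cols_dim by blast
  have "set (cols (A * B)) \<subseteq> span (set (cols A))"
  proof
    fix x assume "x \<in> set (cols (A * B))"
    then obtain i where "i < nc" "x = col (A * B) i"
      using AB by (auto simp: cols_def)
    then have "x = A *\<^sub>v col B i" using col_mult2[OF A B] by simp
    moreover have "col B i \<in> carrier_vec (dim_col A)" using A B by auto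
    ultimately have "x \<in> col_space A"
      using A unfolding col_space_eq[OF A] by auto
    then show "x \<in> span (set (cols A))" by (simp add: col_space_def)
  qed
  then have sub: "span (set (cols (A * B))) \<subseteq> span (set (cols A))"
    using colsA by (simp add: span_is_subset span_is_submodule)
  have sA: "VectorSpace.subspace class_ring (span (set (cols A))) V" by (rule span_is_subspace[OF colsA])
  have sAB: "VectorSpace.subspace class_ring (span (set (cols (A * B)))) V"
    by (rule span_is_subspace) (use AB cols_dim in blast)
  have fin: "vectorspace.fin_dim class_ring (span_vs (set (cols A)))"
    "vectorspace.fin_dim class_ring (span_vs (set (cols (A * B))))"
    using fin_dim_span_cols[OF A] fin_dim_span_cols[OF AB] by auto
  have "rank (A * B) \<le> rank A"
    unfolding rank_def
    using vectorspace.subspace_dim[OF subspace_is_vs[OF sA] nested_subspaces[OF sA sAB sub]] fin by auto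
  also have "\<dots> \<le> k" by (rule rank_le_nc[OF A])
  finally show ?thesis .
qed

lemma mat_rank_mult_le:
  assumes "dim_col A = dim_row B"
  shows "mat_rank (A * B) \<le> dim_col A"
  unfolding mat_rank_def index_mult_mat(2)
  by (rule vec_space.rank_mult_le[OF carrier_matI[OF refl refl] carrier_matI[OF assms[symmetric] refl]])

text \<open>The columns of V span the whole space, so a kernel vector w of V^H has the form V x, and
  |w|^2 = <x, V^H w> = 0.\<close>

lemma inj_mat_adjoint_of_full_rank:
  assumes V: "V \<in> carrier_mat r M" and rank: "mat_rank V = r"
  shows "inj_mat (mat_adjoint V)"
proof -
  interpret vec_space "TYPE(complex)" r .
  have rank': "rank V = r" using rank V by (simp add: mat_rank_def)
  have colsV: "set (cols V) \<subseteq> carrier_vec r" using V cols_dim by blast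
  obtain S where S: "maximal S (\<lambda>T. T \<subseteq> set (cols V) \<and> lin_indpt T)"
    using maximal_exists[of "(\<lambda>T. T \<subseteq> set (cols V) \<and> lin_indpt T)" "card (set (cols V))" "{}"]
    by (meson List.finite_set card_mono empty_iff empty_subsetI finite_lin_indpt2 rev_finite_subset)
  have card: "card S = r" using rank_card_indpt[OF V S] rank' by simp
  have S': "S \<subseteq> set (cols V)" "lin_indpt S" using S by (auto simp: maximal_def)
  have "basis S"
    using S' colsV card finite_subset[OF S'(1)] by (intro dim_li_is_basis) (auto simp: dim_is_n)
  then have "span S = carrier_vec r" by (simp add: basis_def)
  then have span: "carrier_vec r \<subseteq> col_space V"
    using span_is_monotone[OF S'(1)] by (simp add: col_space_def)
  show ?thesis
    unfolding inj_mat_def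
  proof (intro allI impI)
    fix w :: "complex vec"
    assume w: "dim_vec w = dim_col (mat_adjoint V)"
      and zero: "mat_adjoint V *\<^sub>v w = 0\<^sub>v (dim_row (mat_adjoint V))"
    have wr: "w \<in> carrier_vec r" using w V by (intro carrier_vecI) auto
    then obtain x where x: "x \<in> carrier_vec (dim_col V)" "V *\<^sub>v x = w"
      using span unfolding col_space_eq[OF V] by blast
    have "complex_of_real ((vec_norm2 w)\<^sup>2) = (V *\<^sub>v x) \<bullet>c w"
      unfolding vec_norm2_sq_cscalar_prod x(2) ..
    also have "\<dots> = x \<bullet>c (mat_adjoint V *\<^sub>v w)" using x w by (intro cscalar_prod_adjoint) auto
    also have "\<dots> = 0" unfolding zero using x(1) by (simp add: scalar_prod_def)
    finally have "vec_norm2 w = 0" by simp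
    then show "w = 0\<^sub>v (dim_col (mat_adjoint V))" by (rule vec_norm2_eq_0D[OF _ w])
  qed
qed

lemma submatrix_rows_mult:
  assumes "I \<subseteq> {..<dim_row A}" "dim_col A = dim_row B"
  shows "submatrix (A * B) I UNIV = submatrix A I UNIV * (B :: 'a :: semiring_0 mat)"
proof (rule eq_matI)
  fix i j
  assume ij: "i < dim_row (submatrix A I UNIV * B)" "j < dim_col (submatrix A I UNIV * B)"
  have sub: "I \<subseteq> {..<dim_row (A * B)}" using assms by simp
  have i: "i < card I" "j < dim_col B" using ij by (simp_all add: submatrix_rows_eq_mat[OF assms(1)])
  then have "pick I i < dim_row A" using pick_in_set_le[of i I] assms(1) by auto
  then show "submatrix (A * B) I UNIV $$ (i, j) = (submatrix A I UNIV * B) $$ (i, j)"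
    using i assms unfolding submatrix_rows_eq_mat[OF sub] submatrix_rows_eq_mat[OF assms(1)]
    by (simp add: scalar_prod_def)
qed (use assms in \<open>simp_all add: submatrix_rows_eq_mat\<close>)

text \<open>With \<open>B\<^sup>* B = W D W\<^sup>*\<close> the factor is \<open>T = W D\<^sup>-\<^sup>1\<^sup>/\<^sup>2\<close>.\<close>
lemma inj_mat_orthonormalize:
  assumes B: "B \<in> carrier_mat N r" and inj: "inj_mat B"
  obtains T T' where "T \<in> carrier_mat r r" "T' \<in> carrier_mat r r" "T * T' = 1\<^sub>m r" "T' * T = 1\<^sub>m r"
    "B * T \<in> orthonormal_cols N r"
proof -
  have [simp]: "dim_row B = N" "dim_col B = r" using B by auto
  obtain W where W: "gram_diagonalizer B W" using gram_diagonalizer_exists by blast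
  note [simp] = gram_diagonalizer_dims[OF W, simplified]
  define s where "s = (\<lambda>i. complex_of_real (sing_vals B ! i))"
  \<comment> \<open>A vanishing singular value would be attained at a unit vector, which would lie
    in the kernel of B.\<close>
  have s: "s i \<noteq> 0" if "i < r" for i
  proof
    assume "s i = 0"
    moreover have "i < dim_col B" using that by simp
    then obtain v where v: "dim_vec v = dim_col B" "vec_norm2 v = 1" "vec_norm2 (B *\<^sub>v v) = sing_vals B ! i"
      by (rule sing_vals_attained)
    ultimately have "B *\<^sub>v v = 0\<^sub>v (dim_row B)" by (intro vec_norm2_eq_0D) (simp_all add: s_def)
    then have "v = 0\<^sub>v (dim_col B)" using inj v(1) by (intro inj_matD)
    then show False using v(2) by simp
  qed
  have WW: "mat_adjoint W * W = 1\<^sub>m r" "W * mat_adjoint W = 1\<^sub>m r"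
    using W gram_diagonalizer_right_inverse[OF W] by (simp_all add: gram_diagonalizer_def)
  have G: "mat_adjoint B * B = W * mat_diag r (\<lambda>i. s i * s i) * mat_adjoint W"
    using W by (simp add: gram_diagonalizer_def s_def power2_eq_square)
  let ?D = "mat_diag r s" and ?E = "mat_diag r (\<lambda>i. inverse (s i))"
  have diag_one: "mat_diag r f = 1\<^sub>m r" if "\<And>i. i < r \<Longrightarrow> f i = 1" for f :: "nat \<Rightarrow> complex"
    by (rule eq_matI) (simp_all add: mat_diag_def that)
  have DE: "?D * ?E = 1\<^sub>m r" "?E * ?D = 1\<^sub>m r"
    using s by (auto intro!: diag_one)
  have E_adj: "mat_adjoint ?E = ?E"
    by (rule eq_matI) (auto simp: mat_diag_def s_def)
  show ?thesis
  proof (rule that[of "W * ?E" "?D * mat_adjoint W"])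
    have "W * ?E * (?D * mat_adjoint W) = W * ((?E * ?D) * mat_adjoint W)"
      by (simp add: assoc_mult_mat_dim del: mat_diag_diag)
    then show "W * ?E * (?D * mat_adjoint W) = 1\<^sub>m r" by (simp add: DE WW del: mat_diag_diag)
    have "?D * mat_adjoint W * (W * ?E) = ?D * ((mat_adjoint W * W) * ?E)"
      by (simp add: assoc_mult_mat_dim)
    then show "?D * mat_adjoint W * (W * ?E) = 1\<^sub>m r" by (simp add: DE WW del: mat_diag_diag)
    have "mat_adjoint (B * (W * ?E)) * (B * (W * ?E)) = ?E * (mat_adjoint W * (mat_adjoint B * B * (W * ?E)))"
      by (simp add: mat_adjoint_mult E_adj assoc_mult_mat_dim)
    also have "\<dots> = ?E * ((mat_adjoint W * W) * (mat_diag r (\<lambda>i. s i * s i) * ((mat_adjoint W * W) * ?E)))"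
      unfolding G by (simp add: assoc_mult_mat_dim)
    also have "\<dots> = 1\<^sub>m r" using s by (auto simp: WW field_simps intro!: diag_one)
    finally show "B * (W * ?E) \<in> orthonormal_cols N r"
      by (auto simp: orthonormal_cols_def intro!: carrier_matI)
  qed (rule carrier_matI; simp)+
qed

section \<open>Optimal basis rows\<close>

text \<open>Unselected rows are combinations of selected ones, so a vector annihilated by the
  selected rows is annihilated by all of B.\<close>

lemma basis_rows_inj_mat:
  assumes B: "B \<in> carrier_mat N r" and inj: "inj_mat B" and basis: "basis_rows k B I"
  shows "inj_mat (submatrix B I UNIV)"
  unfolding inj_mat_def
proof (intro allI impI)
  have [simp]: "dim_row B = N" "dim_col B = r" using B by auto
  have I: "I \<subseteq> {..<dim_row B}" using basis by (auto simp: basis_rows_def)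
  have BI: "submatrix B I UNIV \<in> carrier_mat (card I) r" using I by (simp add: submatrix_rows_eq_mat)
  fix x :: "complex vec"
  assume "dim_vec x = dim_col (submatrix B I UNIV)"
    and zero: "submatrix B I UNIV *\<^sub>v x = 0\<^sub>v (dim_row (submatrix B I UNIV))"
  then have x: "dim_vec x = r" using BI by simp
  have "(B *\<^sub>v x) $ i = 0" if i: "i < N" for i
  proof (cases "i \<in> I")
    case True
    then have "cmod ((B *\<^sub>v x) $ i) \<le> vec_norm2 (submatrix B I UNIV *\<^sub>v x)"
      using I x by (intro norm_index_le_submatrix_rows) simp_all
    then show ?thesis unfolding zero by simp
  next
    case False
    then have "row B i \<in> vec_space.row_space r (submatrix B I UNIV)"
      using basis i by (simp add: basis_rows_def)
    then obtain y where "y \<in> carrier_vec (dim_row (submatrix B I UNIV))"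
      and y_eq: "(submatrix B I UNIV)\<^sup>T *\<^sub>v y = row B i"
      unfolding vec_space.row_space_eq[OF BI] by blast
    then have y: "y \<in> carrier_vec (card I)" "(submatrix B I UNIV)\<^sup>T *\<^sub>v y = row B i"
      using BI by simp_all
    have "(B *\<^sub>v x) $ i = ((submatrix B I UNIV)\<^sup>T *\<^sub>v y) \<bullet> x" using i y(2) by simp
    also have "\<dots> = y \<bullet> (submatrix B I UNIV *\<^sub>v x)"
      by (rule transpose_vec_mult_scalar[OF BI carrier_vecI[OF x] y(1)])
    also have "\<dots> = 0" unfolding zero using y(1) BI by (simp add: scalar_prod_def)
    finally show ?thesis .
  qed
  then have "B *\<^sub>v x = 0\<^sub>v (dim_row B)" by (intro eq_vecI) auto
  then show "x = 0\<^sub>v (dim_col (submatrix B I UNIV))"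
    using inj_matD[OF inj] x BI by simp
qed

text \<open>A row b of B equals (b L) B_I, so L^T b is a vector of coefficients over the selected
  rows.\<close>

lemma basis_rows_of_left_inverse:
  assumes B: "B \<in> carrier_mat N r" and I: "I \<subseteq> {..<N}"
    and L: "L \<in> carrier_mat r (card I)" "L * submatrix B I UNIV = 1\<^sub>m r"
  shows "basis_rows (card I) B I"
  unfolding basis_rows_def
proof (intro conjI allI impI)
  show "I \<subseteq> {..<dim_row B}" using B I by simp
  then have BI: "submatrix B I UNIV \<in> carrier_mat (card I) r" using B by (simp add: submatrix_rows_eq_mat)
  fix i assume "i < dim_row B" "i \<notin> I"
  then have i: "row B i \<in> carrier_vec r" using B by (intro carrier_vecI) simp
  have "(submatrix B I UNIV)\<^sup>T *\<^sub>v (L\<^sup>T *\<^sub>v row B i) = ((submatrix B I UNIV)\<^sup>T * L\<^sup>T) *\<^sub>v row B i"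
    using B BI L(1) by (intro assoc_mult_mat_vec_dim[symmetric]) simp_all
  also have "(submatrix B I UNIV)\<^sup>T * L\<^sup>T = 1\<^sub>m r"
    using transpose_mult[OF L(1) BI] L(2) by simp
  finally have "(submatrix B I UNIV)\<^sup>T *\<^sub>v (L\<^sup>T *\<^sub>v row B i) = row B i" using i by simp
  moreover have "L\<^sup>T *\<^sub>v row B i \<in> carrier_vec (dim_row (submatrix B I UNIV))"
    using L(1) BI by (intro carrier_vecI) simp
  moreover have "row B i \<in> carrier_vec (dim_col (submatrix B I UNIV))" using i BI by simp
  ultimately have "row B i \<in> vec_space.row_space r (submatrix B I UNIV)"
    unfolding vec_space.row_space_eq[OF BI] by blast
  then show "row B i \<in> vec_space.row_space (dim_col B) (submatrix B I UNIV)" using B by simp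
qed simp

text \<open>One competitor is enough: the rows J that \<open>t_const_rows\<close> supplies for the
  orthonormalised Q = B T. There |pinv(Q_J)| \<le> t and Q is an isometry, so |Q pinv(Q_J)| \<le> t;
  the factor T cancels in B pinv(B_J), which is the same matrix.\<close>

lemma optimal_basis_rows_bound:
  assumes r: "1 \<le> r" "r \<le> k" "k \<le> N" and B: "B \<in> carrier_mat N r" and inj: "inj_mat B"
    and opt: "optimal_basis_rows k B I"
  shows "op_bound (B * pinv (submatrix B I UNIV)) (t_const r N k)" "1 \<le> t_const r N k"
proof -
  have [simp]: "dim_row B = N" "dim_col B = r" using B by auto
  obtain T T' where T: "T \<in> carrier_mat r r" "T' \<in> carrier_mat r r" "T * T' = 1\<^sub>m r" "T' * T = 1\<^sub>m r"
    "B * T \<in> orthonormal_cols N r"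
    using inj_mat_orthonormalize[OF B inj] by blast
  have [simp]: "dim_row T = r" "dim_col T = r" "dim_row T' = r" "dim_col T' = r" using T by auto
  define Q where "Q = B * T"
  have Q: "Q \<in> orthonormal_cols N r" "Q \<in> carrier_mat N r" "mat_adjoint Q * Q = 1\<^sub>m r"
    using T(5) by (auto simp: Q_def orthonormal_cols_def)
  have [simp]: "dim_row Q = N" "dim_col Q = r" using Q by auto
  obtain J where J: "J \<subseteq> {..<N}" "card J = k"
    and bound: "\<And>x. dim_vec x = r \<Longrightarrow> vec_norm2 x \<le> t_const r N k * vec_norm2 (submatrix Q J UNIV *\<^sub>v x)"
    and t: "1 \<le> t_const r N k"
    using t_const_rows[OF r Q(1)] by blast
  let ?BJ = "submatrix B J UNIV" and ?QJ = "submatrix Q J UNIV"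
  have dJ [simp]: "dim_row ?BJ = k" "dim_col ?BJ = r" "dim_row ?QJ = k" "dim_col ?QJ = r"
    using J by (simp_all add: submatrix_rows_eq_mat)
  have QJ: "?QJ = ?BJ * T" unfolding Q_def using J by (intro submatrix_rows_mult) auto
  have injQ: "inj_mat ?QJ"
    unfolding inj_mat_def
  proof (intro allI impI)
    fix x assume x: "dim_vec x = dim_col ?QJ" and zero: "?QJ *\<^sub>v x = 0\<^sub>v (dim_row ?QJ)"
    then have "vec_norm2 x \<le> 0" using bound[of x] by simp
    then have "vec_norm2 x = 0" using vec_norm2_nonneg[of x] by linarith
    then show "x = 0\<^sub>v (dim_col ?QJ)" using x by (rule vec_norm2_eq_0D)
  qed
  note L = pinv_inj_mat[OF injQ]
  have [simp]: "dim_row (pinv ?QJ) = r" "dim_col (pinv ?QJ) = k" using L(1) by auto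
  have "?QJ * T' = ?BJ * (T * T')" unfolding QJ by (simp add: assoc_mult_mat_dim)
  then have BJ: "?BJ = ?QJ * T'" by (simp add: T)
  have left: "T * pinv ?QJ * ?BJ = 1\<^sub>m r"
  proof -
    have "T * pinv ?QJ * ?BJ = T * (pinv ?QJ * ?QJ * T')" unfolding BJ by (simp add: assoc_mult_mat_dim)
    then show ?thesis by (simp add: L(2) T)
  qed
  have BJ_left: "?BJ * (T * pinv ?QJ) = ?QJ * pinv ?QJ"
    by (simp add: assoc_mult_mat_dim[symmetric] QJ[symmetric])
  have carr: "T * pinv ?QJ \<in> carrier_mat r k" by (rule carrier_matI) simp_all
  \<comment> \<open>T pinv(Q_J) is a left inverse of B_J, and B_J T pinv(Q_J) = Q_J pinv(Q_J) is
    Hermitian.\<close>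
  have pinvB: "pinv ?BJ = T * pinv ?QJ"
    by (rule pinv_eq_left_inverse) (use left BJ_left L(3) carr in simp_all)
  \<comment> \<open>Optimality ranges over sets of basis rows, so J has to be shown to be
    one.\<close>
  have "basis_rows (card J) B J"
    by (rule basis_rows_of_left_inverse[OF B J(1) _ left]) (use carr J in simp)
  then have basis: "basis_rows k B J" by (simp add: J)
  have "op_bound (Q * pinv ?QJ) (1 * t_const r N k)"
    by (intro op_bound_mult op_bound_isometry op_bound_pinv injQ bound) (use Q t in simp_all)
  moreover have "B * pinv ?BJ = Q * pinv ?QJ"
    unfolding pinvB by (simp add: assoc_mult_mat_dim[symmetric] Q_def[symmetric])
  ultimately have "spectral_norm (B * pinv ?BJ) \<le> t_const r N k"
    by (intro spectral_norm_le) simp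
  moreover have "spectral_norm (B * pinv (submatrix B I UNIV)) \<le> spectral_norm (B * pinv ?BJ)"
    using opt basis by (simp add: optimal_basis_rows_def)
  ultimately show "op_bound (B * pinv (submatrix B I UNIV)) (t_const r N k)"
    by (intro op_bound_mono[OF op_bound_spectral_norm]) simp
  show "1 \<le> t_const r N k" by (rule t)
qed

text \<open>Selecting rows becomes a matrix factor, so that oblique projections can be written as
  products.\<close>

definition row_selection :: "nat \<Rightarrow> nat set \<Rightarrow> complex mat" where
  "row_selection N I = submatrix (1\<^sub>m N) I UNIV"

lemma row_selection_dims [simp]:
  assumes "I \<subseteq> {..<N}"
  shows "dim_row (row_selection N I) = card I" "dim_col (row_selection N I) = N"
  using assms by (simp_all add: row_selection_def submatrix_rows_eq_mat)

lemma submatrix_rows_eq_selection: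
  assumes "I \<subseteq> {..<N}" "dim_row A = N"
  shows "submatrix A I UNIV = row_selection N I * A"
  using submatrix_rows_mult[of I "1\<^sub>m N" A] assms by (simp add: row_selection_def)

lemma op_bound_row_selection:
  assumes "I \<subseteq> {..<N}"
  shows "op_bound (row_selection N I) 1"
  using vec_norm2_submatrix_rows_le[of I "1\<^sub>m N"] assms
  by (simp add: op_bound_def row_selection_def submatrix_rows_eq_mat)

text \<open>Collects what is used of one selection, for the rows of ZU and for those of V^T alike.
  The identity L P_I B = 1 makes B L P_I idempotent, and the bound on its complement
  follows.\<close>

lemma optimal_basis_rows_projection:
  assumes r: "1 \<le> r" "r \<le> k" "k \<le> N" and B: "B \<in> carrier_mat N r" and inj: "inj_mat B"
    and opt: "optimal_basis_rows k B I"
  defines "L \<equiv> pinv (submatrix B I UNIV)" and "t \<equiv> t_const r N k"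
  shows "I \<subseteq> {..<N}" "card I = k" "L \<in> carrier_mat r k" "L * (row_selection N I * B) = 1\<^sub>m r"
    "mat_adjoint (row_selection N I * B * L) = row_selection N I * B * L"
    "op_bound (B * L) t" "op_bound (1\<^sub>m N - B * L * row_selection N I) t" "1 \<le> t"
    "inj_mat (row_selection N I * B)"
proof -
  have [simp]: "dim_row B = N" "dim_col B = r" using B by auto
  have basis: "basis_rows k B I" using opt by (simp add: optimal_basis_rows_def)
  then show I: "I \<subseteq> {..<N}" "card I = k" by (simp_all add: basis_rows_def)
  note [simp] = row_selection_dims[OF I(1)] I(2)
  have sub: "submatrix B I UNIV = row_selection N I * B"
    by (rule submatrix_rows_eq_selection[OF I(1)]) simp
  show inj': "inj_mat (row_selection N I * B)"
    using basis_rows_inj_mat[OF B inj basis] by (simp add: sub)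
  note L = pinv_inj_mat[OF inj', folded sub, folded L_def, unfolded sub]
  show L1: "L \<in> carrier_mat r k" and L2: "L * (row_selection N I * B) = 1\<^sub>m r"
    and "mat_adjoint (row_selection N I * B * L) = row_selection N I * B * L"
    using L by simp_all
  have [simp]: "dim_row L = r" "dim_col L = k" using L1 by auto
  show bound: "op_bound (B * L) t" and t: "1 \<le> t"
    using optimal_basis_rows_bound[OF r B inj opt] by (simp_all add: L_def t_def)
  let ?P = "B * L * row_selection N I"
  have "?P * ?P = B * ((L * (row_selection N I * B)) * (L * row_selection N I))"
    by (simp add: assoc_mult_mat_dim)
  also have "\<dots> = ?P" by (simp add: L2 assoc_mult_mat_dim)
  finally have idem: "?P * ?P = ?P" .
  have "op_bound ?P (t * 1)"
    by (intro op_bound_mult bound op_bound_row_selection I) simp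
  then show "op_bound (1\<^sub>m N - ?P) t"
    by (intro op_bound_complementary_projection[OF _ idem _ t]) (auto intro!: carrier_matI)
qed

section \<open>Best low-rank approximations\<close>

lemma map_mat_cnj_mult:
  assumes "dim_col A = dim_row B"
  shows "map_mat cnj (A * B) = map_mat cnj A * map_mat cnj B"
  by (rule eq_matI) (use assms in \<open>simp_all add: scalar_prod_def\<close>)

lemma map_mat_cnj_adjoint: "map_mat cnj (mat_adjoint A) = mat_adjoint (map_mat cnj A)"
  by (rule eq_matI) simp_all

lemma map_mat_cnj_diag_of_real:
  "map_mat cnj (mat_diag n (\<lambda>i. complex_of_real (f i))) = mat_diag n (\<lambda>i. complex_of_real (f i))"
  by (rule eq_matI) (simp_all add: mat_diag_def)

lemma elements_mat_Reals_iff: "elements_mat A \<subseteq> \<real> \<longleftrightarrow> map_mat cnj A = A"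
proof
  assume real: "elements_mat A \<subseteq> \<real>"
  show "map_mat cnj A = A"
  proof (rule eq_matI)
    fix i j assume "i < dim_row A" "j < dim_col A"
    then show "map_mat cnj A $$ (i, j) = A $$ (i, j)"
      using real elements_matI[OF carrier_matI[OF refl refl], of i A j] by (auto simp: Reals_cnj_iff)
  qed simp_all
next
  assume eq: "map_mat cnj A = A"
  show "elements_mat A \<subseteq> \<real>"
  proof
    fix a assume "a \<in> elements_mat A"
    then obtain i j where ij: "i < dim_row A" "j < dim_col A" "a = A $$ (i, j)" by blast
    then have "cnj a = map_mat cnj A $$ (i, j)" by simp
    then show "a \<in> \<real>" using ij by (simp add: eq Reals_cnj_iff)
  qed
qed

text \<open>The intertwining matrix \<open>W\<^sup>* C\<close> commutes with the common diagonal form, hence with every function of it.\<close>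
lemma spectral_projector_unique:
  fixes W C :: "complex mat" and l d :: "nat \<Rightarrow> complex"
  assumes W: "W \<in> carrier_mat n n" "mat_adjoint W * W = 1\<^sub>m n"
    and C: "C \<in> carrier_mat n n" "mat_adjoint C * C = 1\<^sub>m n"
    and eq: "W * mat_diag n l * mat_adjoint W = C * mat_diag n l * mat_adjoint C"
    and d: "\<And>i j. i < n \<Longrightarrow> j < n \<Longrightarrow> l i = l j \<Longrightarrow> d i = d j"
  shows "W * mat_diag n d * mat_adjoint W = C * mat_diag n d * mat_adjoint C"
proof -
  have [simp]: "dim_row W = n" "dim_col W = n" "dim_row C = n" "dim_col C = n" using W C by auto
  note WW = unitary_right_inverse[OF W] and CC = unitary_right_inverse[OF C]
  define X where "X = mat_adjoint W * C"
  have X: "X \<in> carrier_mat n n" by (auto simp: X_def intro!: carrier_matI)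
  have "mat_diag n l * X = (mat_adjoint W * W) * (mat_diag n l * (mat_adjoint W * C))"
    by (simp add: W(2) X_def)
  also have "\<dots> = mat_adjoint W * (W * mat_diag n l * mat_adjoint W) * C"
    by (simp add: assoc_mult_mat_dim)
  also have "\<dots> = X * mat_diag n l * (mat_adjoint C * C)"
    unfolding eq by (simp add: assoc_mult_mat_dim X_def)
  also have "\<dots> = X * mat_diag n l" by (simp add: C(2) X_def)
  finally have comm: "mat_diag n l * X = X * mat_diag n l" .
  have "mat_diag n d * X = X * mat_diag n d"
  proof (rule eq_matI)
    fix i j assume "i < dim_row (X * mat_diag n d)" "j < dim_col (X * mat_diag n d)"
    then have ij: "i < n" "j < n" using X by auto
    have "l i * X $$ (i, j) = X $$ (i, j) * l j"
      using arg_cong[OF comm, of "\<lambda>A. A $$ (i, j)"] ij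
      unfolding mat_diag_mult_left[OF X] mat_diag_mult_right[OF X] by simp
    \<comment> \<open>An entry of X survives only where l i = l j, and there d i = d j.\<close>
    then have "X $$ (i, j) = 0 \<or> d i = d j" using d[OF ij] by (auto simp: mult.commute)
    then show "(mat_diag n d * X) $$ (i, j) = (X * mat_diag n d) $$ (i, j)"
      unfolding mat_diag_mult_left[OF X] mat_diag_mult_right[OF X] using ij by auto
  qed (use X in simp_all)
  then have "W * (mat_diag n d * X) * mat_adjoint C = W * (X * mat_diag n d) * mat_adjoint C" by simp
  moreover have "W * (mat_diag n d * X) * mat_adjoint C = W * mat_diag n d * mat_adjoint W * (C * mat_adjoint C)"
    by (simp add: X_def assoc_mult_mat_dim)
  moreover have "W * (X * mat_diag n d) * mat_adjoint C = W * mat_adjoint W * (C * mat_diag n d * mat_adjoint C)"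
    by (simp add: X_def assoc_mult_mat_dim)
  ultimately show ?thesis by (simp add: WW CC)
qed

text \<open>A factorisation through dimension r, to be fed into
  \<open>mat_rank_mult_le\<close>.\<close>

lemma mat_diag_rank_factor:
  assumes "\<And>i. i < n \<Longrightarrow> r \<le> i \<Longrightarrow> d i = 0"
  obtains E F :: "complex mat" where "E \<in> carrier_mat n r" "F \<in> carrier_mat r n" "mat_diag n d = E * F"
proof (rule that)
  show "mat n r (\<lambda>(i, j). if i = j then 1 else 0) \<in> carrier_mat n r"
    "mat r n (\<lambda>(i, j). if i = j then d i else 0) \<in> carrier_mat r n" by simp_all
  show "mat_diag n d = mat n r (\<lambda>(i, j). if i = j then 1 else 0) * mat r n (\<lambda>(i, j). if i = j then d i else 0)"
    by (rule eq_matI)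
      (use assms in \<open>auto simp: mat_diag_def scalar_prod_def if_distrib[of "\<lambda>x. x * _"] not_less cong: if_cong\<close>)
qed

text \<open>Truncating to the eigenvalues strictly above \<open>\<sigma>\<^sub>r\<^sub>+\<^sub>1\<^sup>2\<close>, rather than to \<open>r\<close> chosen eigenvectors, makes
  the spectral projector canonical, hence real when \<open>A\<close> is.\<close>
lemma low_rank_approximation:
  fixes A :: "complex mat"
  assumes r: "r < dim_col A"
  obtains B where "B \<in> carrier_mat (dim_row A) (dim_col A)" "mat_rank B \<le> r"
    "op_bound (A - B) (sing_vals A ! r)" "elements_mat A \<subseteq> \<real> \<Longrightarrow> elements_mat B \<subseteq> \<real>"
proof -
  define M s l where "M = dim_col A" and "s = (\<lambda>i. sing_vals A ! i)"
    and "l = (\<lambda>i. complex_of_real ((sing_vals A ! i)\<^sup>2))"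
  \<comment> \<open>All ties with entry r of the list are dropped together, so d i depends on the
    value s i only.\<close>
  define d where "d = (\<lambda>i. complex_of_real (if s r < s i then 1 else 0))"
  obtain W where W: "gram_diagonalizer A W" using gram_diagonalizer_exists by blast
  note [simp] = gram_diagonalizer_dims[OF W, folded M_def] M_def[symmetric]
  have W': "W \<in> carrier_mat M M" "mat_adjoint W * W = 1\<^sub>m M"
    and G: "mat_adjoint A * A = W * mat_diag M l * mat_adjoint W"
    using W by (simp_all add: gram_diagonalizer_def l_def)
  have WW: "W * mat_adjoint W = 1\<^sub>m M" by (rule unitary_right_inverse[OF W'])
  define P where "P = W * mat_diag M d * mat_adjoint W"
  have [simp]: "dim_row P = M" "dim_col P = M" by (simp_all add: P_def)
  have s_mono: "s j \<le> s i" if "i \<le> j" "j < M" for i j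
    using that by (simp add: s_def sing_vals_antimono)
  have s_nonneg: "0 \<le> s i" if "i < M" for i using that by (simp add: s_def sing_vals_nonneg)
  have rM: "r < M" using r by simp
  have real: "elements_mat (A * P) \<subseteq> \<real>" if real: "elements_mat A \<subseteq> \<real>"
  proof -
    have A: "map_mat cnj A = A" using real by (simp add: elements_mat_Reals_iff)
    let ?C = "map_mat cnj W"
    have C: "?C \<in> carrier_mat M M" by (rule carrier_matI) simp_all
    have CC: "mat_adjoint ?C * ?C = 1\<^sub>m M"
      unfolding map_mat_cnj_adjoint[symmetric]
      by (subst map_mat_cnj_mult[symmetric]) (simp_all add: W'(2), rule eq_matI, simp_all)
    have cnj_diag: "map_mat cnj (W * mat_diag M f * mat_adjoint W) = ?C * mat_diag M f * mat_adjoint ?C"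
      if "f = l \<or> f = d" for f
    proof -
      have "map_mat cnj (mat_diag M f) = mat_diag M f"
        using that unfolding l_def d_def by (metis map_mat_cnj_diag_of_real)
      then show ?thesis by (simp add: map_mat_cnj_mult map_mat_cnj_adjoint)
    qed
    \<comment> \<open>The Gram matrix of a real A is real, so the conjugate of W diagonalises it
      with the same eigenvalues.\<close>
    have "W * mat_diag M l * mat_adjoint W = map_mat cnj (mat_adjoint A * A)"
      unfolding G[symmetric] by (simp add: map_mat_cnj_mult map_mat_cnj_adjoint A)
    also have "\<dots> = ?C * mat_diag M l * mat_adjoint ?C" unfolding G by (rule cnj_diag) simp
    finally have eq: "W * mat_diag M l * mat_adjoint W = ?C * mat_diag M l * mat_adjoint ?C" .
    have "P = ?C * mat_diag M d * mat_adjoint ?C"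
      unfolding P_def
    proof (rule spectral_projector_unique[OF W' C CC eq])
      fix i j assume "i < M" "j < M" "l i = l j"
      \<comment> \<open>The entries of l are squares of nonnegative numbers, so l determines s and
        hence d.\<close>
      then have "s i = s j" using s_nonneg[of i] s_nonneg[of j]
        unfolding l_def s_def of_real_eq_iff by (simp add: power2_eq_iff_nonneg)
      then show "d i = d j" by (simp add: d_def)
    qed
    moreover have "map_mat cnj P = ?C * mat_diag M d * mat_adjoint ?C"
      unfolding P_def by (rule cnj_diag) simp
    ultimately have "map_mat cnj P = P" by simp
    then have "map_mat cnj (A * P) = A * P" by (simp add: map_mat_cnj_mult A)
    then show ?thesis by (simp add: elements_mat_Reals_iff)
  qed
  have rank: "mat_rank (A * P) \<le> r"
  proof -
    \<comment> \<open>From index r on the singular values are at most s r, so at most r diagonal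
      entries remain.\<close>
    have "d i = 0" if "i < M" "r \<le> i" for i using s_mono[of r i] that by (simp add: d_def)
    then obtain E F where EF: "E \<in> carrier_mat M r" "F \<in> carrier_mat r M" "mat_diag M d = E * F"
      by (rule mat_diag_rank_factor)
    have [simp]: "dim_row E = M" "dim_col E = r" "dim_row F = r" "dim_col F = M" using EF by auto
    have "A * P = (A * (W * E)) * (F * mat_adjoint W)"
      unfolding P_def EF(3) by (simp add: assoc_mult_mat_dim)
    then show ?thesis using mat_rank_mult_le[of "A * (W * E)" "F * mat_adjoint W"] by simp
  qed
  have bound: "op_bound (A - A * P) (s r)"
    unfolding op_bound_def
  proof (intro conjI allI impI)
    show "0 \<le> s r" by (rule s_nonneg[OF rM])
    fix v :: "complex vec" assume "dim_vec v = dim_col (A - A * P)"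
    then have v: "dim_vec v = M" by simp
    define y where "y = mat_adjoint W *\<^sub>v v"
    have y: "dim_vec y = M" by (simp add: y_def)
    have ny: "vec_norm2 y = vec_norm2 v"
      unfolding y_def by (rule vec_norm2_isometry[of _ M]) (simp_all add: WW v)
    \<comment> \<open>Coordinates of v - P v: those with s i > s r are erased, and every remaining
      one is scaled by at most s r.\<close>
    define z where "z = vec M (\<lambda>i. (1 - d i) * y $ i)"
    have z: "dim_vec z = M" by (simp add: z_def)
    have "z = y - mat_diag M d *\<^sub>v y"
      using y by (intro eq_vecI) (simp_all add: z_def mat_diag_mult_vec algebra_simps)
    moreover have "mat_diag M d *\<^sub>v y \<in> carrier_vec M" by (rule carrier_vecI) simp
    ultimately have "W *\<^sub>v z = W *\<^sub>v y - W *\<^sub>v (mat_diag M d *\<^sub>v y)"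
      using mult_minus_distrib_mat_vec[OF W'(1) carrier_vecI[OF y]] by simp
    also have "W *\<^sub>v y = v"
      unfolding y_def using v WW assoc_mult_mat_vec_dim[of W "mat_adjoint W" v] by simp
    also have "W *\<^sub>v (mat_diag M d *\<^sub>v y) = P *\<^sub>v v"
      unfolding P_def y_def using v by (simp add: assoc_mult_mat_vec_dim)
    finally have Wz: "W *\<^sub>v z = v - P *\<^sub>v v" .
    have AM: "A \<in> carrier_mat (dim_row A) M" "A * P \<in> carrier_mat (dim_row A) M"
      by (rule carrier_matI; simp)+
    have "P *\<^sub>v v \<in> carrier_vec M" by (rule carrier_vecI) simp
    then have "A *\<^sub>v (W *\<^sub>v z) = A *\<^sub>v v - A *\<^sub>v (P *\<^sub>v v)"
      unfolding Wz by (rule mult_minus_distrib_mat_vec[OF AM(1) carrier_vecI[OF v]])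
    also have "A *\<^sub>v (P *\<^sub>v v) = (A * P) *\<^sub>v v"
      by (rule assoc_mult_mat_vec_dim[symmetric]) (simp_all add: v)
    also have "A *\<^sub>v v - (A * P) *\<^sub>v v = (A - A * P) *\<^sub>v v"
      by (rule minus_mult_distrib_mat_vec[OF AM carrier_vecI[OF v], symmetric])
    finally have "(vec_norm2 ((A - A * P) *\<^sub>v v))\<^sup>2 = (\<Sum>i<M. (s i)\<^sup>2 * (cmod (z $ i))\<^sup>2)"
      using gram_diagonalizer_norm[OF W, of z] z by (simp add: s_def)
    also have "\<dots> \<le> (\<Sum>i<M. (s r)\<^sup>2 * (cmod (y $ i))\<^sup>2)"
    proof (rule sum_mono)
      fix i assume "i \<in> {..<M}"
      then have i: "i < M" by simp
      then show "(s i)\<^sup>2 * (cmod (z $ i))\<^sup>2 \<le> (s r)\<^sup>2 * (cmod (y $ i))\<^sup>2"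
        using s_nonneg[OF i] by (auto simp: z_def d_def intro!: mult_right_mono power_mono)
    qed
    also have "\<dots> = (s r * vec_norm2 v)\<^sup>2"
      unfolding ny[symmetric] power_mult_distrib vec_norm2_sq y by (rule sum_distrib_left[symmetric])
    finally show "vec_norm2 ((A - A * P) *\<^sub>v v) \<le> s r * vec_norm2 v"
      using s_nonneg[OF rM] by (simp add: power2_le_iff_abs_le)
  qed
  show ?thesis
    by (rule that[OF _ rank bound[unfolded s_def] real]) (rule carrier_matI; simp)
qed

text \<open>The upper half of Eckart-Young: Z does at least as well as the truncation, whose error
  is bounded by the list entry of index r, that is sigma_{r+1}. For K = \<real> the truncation is an
  admissible competitor because it is real when A is.\<close>

lemma best_spectral_approx_bound:
  assumes K: "K = UNIV \<or> K = \<real>" and A: "elements_mat A \<subseteq> K" and r: "r < dim_col A"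
    and best: "best_rank_approx spectral_norm K r A Z"
  shows "op_bound (A - Z) (sing_vals A ! r)"
proof -
  obtain B where B: "B \<in> carrier_mat (dim_row A) (dim_col A)" "mat_rank B \<le> r"
    "op_bound (A - B) (sing_vals A ! r)" "elements_mat A \<subseteq> \<real> \<Longrightarrow> elements_mat B \<subseteq> \<real>"
    using low_rank_approximation[OF r] by blast
  have "elements_mat B \<subseteq> K" using K A B(4) by auto
  then have "spectral_norm (A - Z) \<le> spectral_norm (A - B)"
    using best B(1,2) by (auto simp: best_rank_approx_def Let_def)
  also have "\<dots> \<le> sing_vals A ! r" by (rule spectral_norm_le[OF B(3)])
  finally show ?thesis by (rule op_bound_mono[OF op_bound_spectral_norm])
qed

lemma minus_mult_mat_dim:
  "dim_row A = dim_row B \<Longrightarrow> dim_col A = dim_col B \<Longrightarrow> dim_row C = dim_col B \<Longrightarrow>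
    (A - B) * C = A * C - B * (C :: 'a :: ring mat)"
  by (rule minus_mult_distrib_mat[of A "dim_row B" "dim_col B" B C "dim_col C"]) (rule carrier_matI; simp)+

lemma mult_minus_mat_dim:
  "dim_row B = dim_row C \<Longrightarrow> dim_col B = dim_col C \<Longrightarrow> dim_col A = dim_row C \<Longrightarrow>
    A * (B - C) = A * B - A * (C :: 'a :: ring mat)"
  by (rule mult_minus_distrib_mat[of A "dim_row A" "dim_row C" B "dim_col C" C]) (rule carrier_matI; simp)+

section \<open>First-order optimality in the Frobenius norm\<close>

lemma frobenius_norm_sq: "(frobenius_norm A)\<^sup>2 = (\<Sum>i<dim_row A. \<Sum>j<dim_col A. (cmod (A $$ (i, j)))\<^sup>2)"
  by (simp add: frobenius_norm_def sum_nonneg)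

lemma frobenius_norm_eq_0D:
  assumes "frobenius_norm A = 0"
  shows "A = 0\<^sub>m (dim_row A) (dim_col A)"
proof (rule eq_matI)
  fix i j assume ij: "i < dim_row (0\<^sub>m (dim_row A) (dim_col A))" "j < dim_col (0\<^sub>m (dim_row A) (dim_col A))"
  have "(\<Sum>i<dim_row A. \<Sum>j<dim_col A. (cmod (A $$ (i, j)))\<^sup>2) = 0"
    unfolding frobenius_norm_sq[symmetric] assms by simp
  then have "\<forall>i<dim_row A. \<forall>j<dim_col A. A $$ (i, j) = 0"
    by (simp add: sum_nonneg_eq_0_iff sum_nonneg)
  then show "A $$ (i, j) = 0\<^sub>m (dim_row A) (dim_col A) $$ (i, j)" using ij by simp
qed simp_all

lemma cmod_diff_scaled_sq:
  "(cmod (a - complex_of_real e * b))\<^sup>2 = (cmod a)\<^sup>2 - 2 * e * Re (a * cnj b) + e\<^sup>2 * (cmod b)\<^sup>2"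
  unfolding cmod_power2 by (simp add: power2_eq_square algebra_simps)

text \<open>First-order optimality under the admissible variations \<open>Z + \<epsilon> (E Z\<^sup>*) Z\<close>, where \<open>E = A - Z\<close>.\<close>
lemma best_frobenius_approx_orthogonal:
  assumes K: "K = UNIV \<or> K = \<real>" and A: "elements_mat A \<subseteq> K"
    and best: "best_rank_approx frobenius_norm K r A (X * Y)"
    and dims: "X \<in> carrier_mat (dim_row A) r" "Y \<in> carrier_mat r (dim_col A)"
  shows "(A - X * Y) * mat_adjoint (X * Y) = 0\<^sub>m (dim_row A) (dim_row A)"
proof -
  have [simp]: "dim_row X = dim_row A" "dim_col X = r" "dim_row Y = r" "dim_col Y = dim_col A"
    using dims by auto
  define Z where "Z = X * Y"
  define E where "E = A - Z"
  define F where "F = E * mat_adjoint Z"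
  define H where "H = F * Z"
  have [simp]: "dim_row Z = dim_row A" "dim_col Z = dim_col A" "dim_row E = dim_row A" "dim_col E = dim_col A"
    "dim_row F = dim_row A" "dim_col F = dim_row A" "dim_row H = dim_row A" "dim_col H = dim_col A"
    by (simp_all add: Z_def E_def F_def H_def)
  have Z: "elements_mat Z \<subseteq> K"
    using best by (simp add: best_rank_approx_def Let_def Z_def)
  \<comment> \<open>The direction H = E Z^H Z is real for real A and Z, so the variation stays in
    the scalar field.\<close>
  have "elements_mat (Z + complex_of_real e \<cdot>\<^sub>m H) \<subseteq> K" for e
    using K
  proof
    assume "K = \<real>"
    then have Ar: "map_mat cnj A = A" and Zr: "map_mat cnj Z = Z"
      using A Z by (simp_all add: elements_mat_Reals_iff)
    have diff: "map_mat cnj (B - C) = map_mat cnj B - map_mat cnj C"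
      if "dim_row B = dim_row C" "dim_col B = dim_col C" for B C
      by (rule eq_matI) (use that in simp_all)
    have "map_mat cnj H = H"
      by (simp add: H_def F_def E_def map_mat_cnj_mult map_mat_cnj_adjoint diff Ar Zr)
    then have "cnj (H $$ (i, j)) = H $$ (i, j)" if "i < dim_row A" "j < dim_col A" for i j
      using that index_map_mat(1)[of i H j cnj] by simp
    moreover have "cnj (Z $$ (i, j)) = Z $$ (i, j)" if "i < dim_row A" "j < dim_col A" for i j
      using that index_map_mat(1)[of i Z j cnj] Zr by simp
    ultimately have "map_mat cnj (Z + complex_of_real e \<cdot>\<^sub>m H) = Z + complex_of_real e \<cdot>\<^sub>m H"
      by (intro eq_matI) simp_all
    then show ?thesis using \<open>K = \<real>\<close> by (simp add: elements_mat_Reals_iff)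
  qed simp
  \<comment> \<open>The variation multiplies Z from the left and hence factors through Y as Z
    does.\<close>
  moreover have "mat_rank (Z + complex_of_real e \<cdot>\<^sub>m H) \<le> r" for e
  proof -
    have "Z + complex_of_real e \<cdot>\<^sub>m H = (X + complex_of_real e \<cdot>\<^sub>m (F * X)) * Y"
    proof -
      have "(X + complex_of_real e \<cdot>\<^sub>m (F * X)) * Y = X * Y + complex_of_real e \<cdot>\<^sub>m (F * X) * Y"
        by (rule add_mult_distrib_mat[of _ "dim_row A" r _ _ "dim_col A"]) (rule carrier_matI; simp)+
      also have "complex_of_real e \<cdot>\<^sub>m (F * X) * Y = complex_of_real e \<cdot>\<^sub>m (F * X * Y)"
        by (rule mult_smult_assoc_mat[of _ "dim_row A" r _ "dim_col A"]) (rule carrier_matI; simp)+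
      also have "F * X * Y = H" by (simp add: H_def Z_def assoc_mult_mat_dim)
      finally show ?thesis by (simp add: Z_def)
    qed
    then show ?thesis
      using mat_rank_mult_le[of "X + complex_of_real e \<cdot>\<^sub>m (F * X)" Y] by simp
  qed
  moreover have "Z + complex_of_real e \<cdot>\<^sub>m H \<in> carrier_mat (dim_row A) (dim_col A)" for e
    by (rule carrier_matI) simp_all
  ultimately have "frobenius_norm E \<le> frobenius_norm (A - (Z + complex_of_real e \<cdot>\<^sub>m H))" for e
    using best by (auto simp: best_rank_approx_def Let_def E_def Z_def)
  then have le: "(frobenius_norm E)\<^sup>2 \<le> (frobenius_norm (A - (Z + complex_of_real e \<cdot>\<^sub>m H)))\<^sup>2" for e
    by (intro power_mono) (auto simp: frobenius_norm_def sum_nonneg)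
  define q where "q = (\<Sum>i<dim_row A. \<Sum>j<dim_col A. (cmod (H $$ (i, j)))\<^sup>2)"
  have q: "0 \<le> q" by (simp add: q_def sum_nonneg)
  \<comment> \<open>In the Frobenius inner product, <E, F Z> = <E Z^H, F> = |F|^2.\<close>
  have cross: "(\<Sum>i<dim_row A. \<Sum>j<dim_col A. E $$ (i, j) * cnj (H $$ (i, j))) =
      complex_of_real ((frobenius_norm F)\<^sup>2)"
  proof -
    have "(\<Sum>j<dim_col A. E $$ (i, j) * cnj (H $$ (i, j))) = (\<Sum>k<dim_row A. F $$ (i, k) * cnj (F $$ (i, k)))"
      if i: "i < dim_row A" for i
    proof -
      have "(\<Sum>j<dim_col A. E $$ (i, j) * cnj (H $$ (i, j))) =
          (\<Sum>j<dim_col A. \<Sum>k<dim_row A. E $$ (i, j) * cnj (Z $$ (k, j)) * cnj (F $$ (i, k)))"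
        using i by (simp add: H_def scalar_prod_def lessThan_atLeast0 sum_distrib_left mult_ac)
      also have "\<dots> = (\<Sum>k<dim_row A. \<Sum>j<dim_col A. E $$ (i, j) * cnj (Z $$ (k, j)) * cnj (F $$ (i, k)))"
        by (rule sum.swap)
      also have "\<dots> = (\<Sum>k<dim_row A. F $$ (i, k) * cnj (F $$ (i, k)))"
      proof (rule sum.cong[OF refl])
        fix k assume "k \<in> {..<dim_row A}"
        then have "F $$ (i, k) = (\<Sum>j<dim_col A. E $$ (i, j) * cnj (Z $$ (k, j)))"
          using i by (simp add: F_def scalar_prod_def lessThan_atLeast0)
        then show "(\<Sum>j<dim_col A. E $$ (i, j) * cnj (Z $$ (k, j)) * cnj (F $$ (i, k))) =
            F $$ (i, k) * cnj (F $$ (i, k))"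
          by (simp add: sum_distrib_right)
      qed
      finally show ?thesis .
    qed
    then show ?thesis
      unfolding frobenius_norm_sq by (simp add: complex_norm_square flip: of_real_power)
  qed
  have expand: "(frobenius_norm (A - (Z + complex_of_real e \<cdot>\<^sub>m H)))\<^sup>2 =
      (frobenius_norm E)\<^sup>2 - 2 * e * (frobenius_norm F)\<^sup>2 + e\<^sup>2 * q" for e
  proof -
    have "(frobenius_norm (A - (Z + complex_of_real e \<cdot>\<^sub>m H)))\<^sup>2 =
        (\<Sum>i<dim_row A. \<Sum>j<dim_col A. (cmod (E $$ (i, j) - complex_of_real e * H $$ (i, j)))\<^sup>2)"
      unfolding frobenius_norm_sq by (simp add: E_def algebra_simps)
    also have "\<dots> = (frobenius_norm E)\<^sup>2
        - 2 * e * Re (\<Sum>i<dim_row A. \<Sum>j<dim_col A. E $$ (i, j) * cnj (H $$ (i, j))) + e\<^sup>2 * q"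
      unfolding cmod_diff_scaled_sq frobenius_norm_sq q_def
      by (simp add: sum.distrib sum_subtractf sum_distrib_left distrib_left mult.assoc)
    finally show ?thesis unfolding cross by simp
  qed
  have ineq: "2 * e * (frobenius_norm F)\<^sup>2 \<le> e\<^sup>2 * q" for e
    using le[of e] unfolding expand by simp
  have "(frobenius_norm F)\<^sup>2 = 0"
  proof (rule ccontr)
    let ?f = "(frobenius_norm F)\<^sup>2"
    assume "?f \<noteq> 0"
    then have f: "0 < ?f" by (simp add: zero_less_power2)
    \<comment> \<open>Any e > 0 with e q < 2 |F|^2 contradicts the inequality; the summand 1 covers
      q = 0.\<close>
    define e where "e = ?f / (q + 1)"
    have e: "0 < e" "e * (q + 1) = ?f" using f q by (simp_all add: e_def)
    have "e * (2 * ?f) \<le> e * (e * q)" using ineq[of e] by (simp add: power2_eq_square mult_ac)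
    then have "2 * ?f \<le> e * q" using e(1) by simp
    also have "\<dots> < e * (q + 1)" using e(1) by simp
    finally show False using e(2) f by simp
  qed
  then have "F = 0\<^sub>m (dim_row F) (dim_col F)" by (intro frobenius_norm_eq_0D) simp
  then show ?thesis by (simp add: F_def E_def Z_def)
qed

text \<open>For r \<le> n the inclusion of r coordinates, for n \<le> r the projection onto the
  first n; the adjoint swaps the two. Cutting out leading rows or columns becomes multiplication by
  it.\<close>

definition incl_mat :: "nat \<Rightarrow> nat \<Rightarrow> complex mat" where
  "incl_mat n r = mat n r (\<lambda>(i, j). if i = j then 1 else 0)"

lemma incl_mat_dims [simp]: "dim_row (incl_mat n r) = n" "dim_col (incl_mat n r) = r"
  by (simp_all add: incl_mat_def)

lemma incl_mat_adjoint: "mat_adjoint (incl_mat n r) = incl_mat r n"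
  by (rule eq_matI) (simp_all add: incl_mat_def)

lemma incl_mat_mult_vec:
  "dim_vec y = r \<Longrightarrow> incl_mat n r *\<^sub>v y = vec n (\<lambda>i. if i < r then y $ i else 0)"
  by (rule eq_vecI) (simp_all add: incl_mat_def scalar_prod_def if_distrib[of "\<lambda>x. x * _"] cong: if_cong)

lemma incl_mat_left_inverse: "r \<le> n \<Longrightarrow> incl_mat r n * incl_mat n r = 1\<^sub>m r"
  by (rule eq_matI) (auto simp: incl_mat_def scalar_prod_def if_distrib[of "\<lambda>x. x * _"] cong: if_cong)

text \<open>Appending a zero row makes Y square of rank at most r < r + 1, hence singular; deleting
  that row again gives the kernel vector.\<close>

lemma wide_mat_kernel:
  assumes Y: "Y \<in> carrier_mat r (Suc r)"
  obtains y :: "complex vec" where "dim_vec y = Suc r" "y \<noteq> 0\<^sub>v (Suc r)" "Y *\<^sub>v y = 0\<^sub>v r"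
proof -
  have [simp]: "dim_row Y = r" "dim_col Y = Suc r" using Y by auto
  let ?B = "incl_mat (Suc r) r * Y"
  have B: "?B \<in> carrier_mat (Suc r) (Suc r)" by (rule carrier_matI) simp_all
  have "mat_rank ?B \<le> r" using mat_rank_mult_le[of "incl_mat (Suc r) r" Y] by simp
  then have "vec_space.rank (Suc r) ?B \<noteq> Suc r" by (simp add: mat_rank_def)
  then have "det ?B = 0" using vec_space.det_rank_iff[OF B] by blast
  then obtain y where y: "y \<in> carrier_vec (Suc r)" "y \<noteq> 0\<^sub>v (Suc r)" "?B *\<^sub>v y = 0\<^sub>v (Suc r)"
    using det_0_iff_vec_prod_zero[OF B] by blast
  have dy: "dim_vec y = Suc r" using y(1) by (rule carrier_vecD)
  have "Y *\<^sub>v y = (incl_mat r (Suc r) * incl_mat (Suc r) r * Y) *\<^sub>v y"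
    by (simp add: incl_mat_left_inverse)
  also have "\<dots> = incl_mat r (Suc r) *\<^sub>v (?B *\<^sub>v y)"
    using dy by (simp add: assoc_mult_mat_vec_dim assoc_mult_mat_dim)
  also have "\<dots> = 0\<^sub>v r" unfolding y(3) by simp
  finally show ?thesis using that[OF dy y(2)] by blast
qed

text \<open>The lower half of Eckart-Young. The span of the first r + 1 right singular vectors meets
  the kernel of Y in a nonzero w; there R - X Y acts as R, and |R w| is at least sigma_{r+1}
  |w|.\<close>

lemma sing_val_le_of_low_rank_approx:
  assumes r: "r < dim_col R" and X: "X \<in> carrier_mat (dim_row R) r" "Y \<in> carrier_mat r (dim_col R)"
    and bound: "op_bound (R - X * Y) c"
  shows "sing_vals R ! r \<le> c"
proof -
  define M where "M = dim_col R"
  obtain W where W: "gram_diagonalizer R W" using gram_diagonalizer_exists by blast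
  note [simp] = gram_diagonalizer_dims[OF W, folded M_def] M_def[symmetric]
  have [simp]: "dim_row X = dim_row R" "dim_col X = r" "dim_row Y = r" "dim_col Y = M" using X by auto
  have WW: "mat_adjoint W * W = 1\<^sub>m M" using W by (simp add: gram_diagonalizer_def)
  have "Y * (W * incl_mat M (Suc r)) \<in> carrier_mat r (Suc r)" by (rule carrier_matI) simp_all
  then obtain y where y: "dim_vec y = Suc r" "y \<noteq> 0\<^sub>v (Suc r)" "Y * (W * incl_mat M (Suc r)) *\<^sub>v y = 0\<^sub>v r"
    by (rule wide_mat_kernel)
  define z where "z = incl_mat M (Suc r) *\<^sub>v y"
  have z: "dim_vec z = M" by (simp add: z_def)
  have rM: "Suc r \<le> M" using r by simp
  have nz: "vec_norm2 z = vec_norm2 y"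
    unfolding z_def
    by (rule vec_norm2_isometry[of _ "Suc r"]) (simp_all add: incl_mat_adjoint incl_mat_left_inverse[OF rM] y)
  have nW: "vec_norm2 (W *\<^sub>v z) = vec_norm2 z"
    by (rule vec_norm2_isometry[OF WW z]) simp
  have Yz: "Y *\<^sub>v (W *\<^sub>v z) = 0\<^sub>v r"
    using y by (simp add: z_def assoc_mult_mat_vec_dim)
  have carr: "R \<in> carrier_mat (dim_row R) M" "X * Y \<in> carrier_mat (dim_row R) M" "W *\<^sub>v z \<in> carrier_vec M"
    by (rule carrier_matI carrier_vecI; simp)+
  have "(R - X * Y) *\<^sub>v (W *\<^sub>v z) = R *\<^sub>v (W *\<^sub>v z) - (X * Y) *\<^sub>v (W *\<^sub>v z)"
    by (rule minus_mult_distrib_mat_vec[OF carr])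
  also have "(X * Y) *\<^sub>v (W *\<^sub>v z) = 0\<^sub>v (dim_row R)"
    by (simp add: assoc_mult_mat_vec_dim Yz)
  also have "R *\<^sub>v (W *\<^sub>v z) - 0\<^sub>v (dim_row R) = R *\<^sub>v (W *\<^sub>v z)" by (rule eq_vecI) simp_all
  finally have eq: "(R - X * Y) *\<^sub>v (W *\<^sub>v z) = R *\<^sub>v (W *\<^sub>v z)" .
  let ?s = "sing_vals R ! r"
  have s: "0 \<le> ?s" using r by (intro sing_vals_nonneg)
  have "(?s * vec_norm2 z)\<^sup>2 = (\<Sum>i<M. ?s\<^sup>2 * (cmod (z $ i))\<^sup>2)"
    unfolding power_mult_distrib vec_norm2_sq z by (rule sum_distrib_left)
  also have "\<dots> \<le> (\<Sum>i<M. (sing_vals R ! i)\<^sup>2 * (cmod (z $ i))\<^sup>2)"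
  proof (rule sum_mono)
    fix i assume i: "i \<in> {..<M}"
    show "?s\<^sup>2 * (cmod (z $ i))\<^sup>2 \<le> (sing_vals R ! i)\<^sup>2 * (cmod (z $ i))\<^sup>2"
    proof (cases "i \<le> r")
      case True
      then show ?thesis using s r by (intro mult_right_mono power_mono sing_vals_antimono) simp_all
    next
      case False
      then have "z $ i = 0" using i y(1) by (simp add: z_def incl_mat_mult_vec)
      then show ?thesis by simp
    qed
  qed
  also have "\<dots> = (vec_norm2 (R *\<^sub>v (W *\<^sub>v z)))\<^sup>2"
    using gram_diagonalizer_norm[OF W, of z] z by simp
  finally have "?s * vec_norm2 z \<le> vec_norm2 (R *\<^sub>v (W *\<^sub>v z))" by (rule power2_le_imp_le) simp
  also have "\<dots> \<le> c * vec_norm2 z"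
    using op_boundD[OF bound, of "W *\<^sub>v z"] unfolding eq nW by simp
  finally have le: "?s * vec_norm2 z \<le> c * vec_norm2 z" .
  have "vec_norm2 z \<noteq> 0" using y vec_norm2_eq_0D[OF _ y(1)] by (auto simp: nz)
  then have "0 < vec_norm2 z" using vec_norm2_nonneg[of z] by linarith
  with le show ?thesis by simp
qed

section \<open>Injectivity and positive singular values\<close>

lemma inj_mat_mult:
  assumes "inj_mat A" "inj_mat B" "dim_col A = dim_row B"
  shows "inj_mat (A * B)"
  unfolding inj_mat_def
proof (intro allI impI)
  fix x assume x: "dim_vec x = dim_col (A * B)" and zero: "A * B *\<^sub>v x = 0\<^sub>v (dim_row (A * B))"
  have "A *\<^sub>v (B *\<^sub>v x) = 0\<^sub>v (dim_row A)"
    using zero x assms(3) by (simp add: assoc_mult_mat_vec_dim)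
  then have "B *\<^sub>v x = 0\<^sub>v (dim_col A)" using assms(3) by (intro inj_matD[OF assms(1)]) simp_all
  then show "x = 0\<^sub>v (dim_col (A * B))" using x assms(3) inj_matD[OF assms(2), of x] by simp
qed

lemma inj_mat_of_left_inverse:
  assumes "L * B = 1\<^sub>m (dim_col B)" "dim_col L = dim_row B"
  shows "inj_mat B"
  unfolding inj_mat_def
proof (intro allI impI)
  fix x assume x: "dim_vec x = dim_col B" and zero: "B *\<^sub>v x = 0\<^sub>v (dim_row B)"
  have "dim_row L = dim_col B" using arg_cong[OF assms(1), of dim_row] by simp
  have "x = (L * B) *\<^sub>v x" by (simp add: assms(1) x)
  also have "\<dots> = L *\<^sub>v (B *\<^sub>v x)" using assms(2) x by (simp add: assoc_mult_mat_vec_dim)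
  also have "\<dots> = 0\<^sub>v (dim_row L)" unfolding zero using assms(2) by simp
  finally show "x = 0\<^sub>v (dim_col B)" using \<open>dim_row L = dim_col B\<close> by simp
qed

text \<open>If the list entry of index r vanishes, so do all later ones, and R kills every vector
  orthogonal to the first r right singular vectors. As Y has r + 1 columns, some nonzero x has Y x
  among these vectors, against the injectivity of R Y.\<close>

lemma sing_val_pos_of_inj_mult:
  assumes r: "Suc r \<le> dim_col R" and Y: "Y \<in> carrier_mat (dim_col R) (Suc r)" and inj: "inj_mat (R * Y)"
  shows "0 < sing_vals R ! r"
proof (rule ccontr)
  assume contr: "\<not> 0 < sing_vals R ! r"
  define M where "M = dim_col R"
  obtain W where W: "gram_diagonalizer R W" using gram_diagonalizer_exists by blast
  note [simp] = gram_diagonalizer_dims[OF W, folded M_def] M_def[symmetric]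
  have [simp]: "dim_row Y = M" "dim_col Y = Suc r" using Y by auto
  have WW: "W * mat_adjoint W = 1\<^sub>m M" using gram_diagonalizer_right_inverse[OF W] by simp
  have "incl_mat r M * (mat_adjoint W * Y) \<in> carrier_mat r (Suc r)" by (rule carrier_matI) simp_all
  then obtain x where x: "dim_vec x = Suc r" "x \<noteq> 0\<^sub>v (Suc r)"
    "incl_mat r M * (mat_adjoint W * Y) *\<^sub>v x = 0\<^sub>v r"
    by (rule wide_mat_kernel)
  define y where "y = mat_adjoint W *\<^sub>v (Y *\<^sub>v x)"
  have y: "dim_vec y = M" by (simp add: y_def)
  have "W *\<^sub>v y = (W * mat_adjoint W) *\<^sub>v (Y *\<^sub>v x)"
    by (simp add: y_def assoc_mult_mat_vec_dim)
  then have Wy: "W *\<^sub>v y = Y *\<^sub>v x" by (simp add: WW)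
  have iy: "incl_mat r M *\<^sub>v y = 0\<^sub>v r"
    using x by (simp add: y_def assoc_mult_mat_vec_dim)
  have y0: "y $ i = 0" if "i < r" for i
  proof -
    have "(incl_mat r M *\<^sub>v y) $ i = y $ i" using that r y by (simp add: incl_mat_mult_vec)
    then show ?thesis using that by (simp add: iy)
  qed
  have s0: "sing_vals R ! i = 0" if "r \<le> i" "i < M" for i
    using that contr sing_vals_antimono[of r i R] sing_vals_nonneg[of i R] by simp
  have "(vec_norm2 (R *\<^sub>v (Y *\<^sub>v x)))\<^sup>2 = (\<Sum>i<M. (sing_vals R ! i)\<^sup>2 * (cmod (y $ i))\<^sup>2)"
    using gram_diagonalizer_norm[OF W, of y] y by (simp add: Wy)
  also have "\<dots> = 0"
  proof (intro sum.neutral ballI)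
    fix i assume "i \<in> {..<M}"
    then show "(sing_vals R ! i)\<^sup>2 * (cmod (y $ i))\<^sup>2 = 0"
      by (cases "i < r") (simp_all add: y0 s0)
  qed
  finally have "vec_norm2 (R *\<^sub>v (Y *\<^sub>v x)) = 0" by simp
  then have "R *\<^sub>v (Y *\<^sub>v x) = 0\<^sub>v (dim_row R)" by (rule vec_norm2_eq_0D) simp
  then have "R * Y *\<^sub>v x = 0\<^sub>v (dim_row (R * Y))" using x(1) by (simp add: assoc_mult_mat_vec_dim)
  then have "x = 0\<^sub>v (dim_col (R * Y))" using x(1) by (intro inj_matD[OF inj]) simp_all
  then show False using x(2) by simp
qed

section \<open>The truncated singular value decomposition\<close>

lemma pick_lessThan: "j < r \<Longrightarrow> pick {..<r} j = j"
proof -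
  assume j: "j < r"
  then have "{a \<in> {..<r}. a < j} = {..<j}" by auto
  then show ?thesis using pick_card_in_set[of j "{..<r}"] j by simp
qed

lemma card_lessThan_inter: "r \<le> n \<Longrightarrow> card {i. i < n \<and> i \<in> {..<r}} = r"
proof -
  assume "r \<le> n"
  then have "{i. i < n \<and> i \<in> {..<r}} = {..<r}" by auto
  then show ?thesis by simp
qed

lemma submatrix_leading_cols:
  fixes P :: "complex mat"
  assumes "r \<le> dim_col P"
  shows "submatrix P UNIV {..<r} = P * incl_mat (dim_col P) r"
proof (rule eq_matI)
  fix i j assume "i < dim_row (P * incl_mat (dim_col P) r)" "j < dim_col (P * incl_mat (dim_col P) r)"
  then have ij: "i < dim_row P" "j < r" by simp_all
  have "submatrix P UNIV {..<r} $$ (i, j) = P $$ (i, j)"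
    using ij assms by (subst submatrix_index) (simp_all add: card_lessThan_inter[simplified] pick_UNIV pick_lessThan)
  also have "\<dots> = (P * incl_mat (dim_col P) r) $$ (i, j)"
    using ij assms by (simp add: scalar_prod_def incl_mat_def if_distrib[of "\<lambda>x. _ * x"] cong: if_cong)
  finally show "submatrix P UNIV {..<r} $$ (i, j) = (P * incl_mat (dim_col P) r) $$ (i, j)" .
qed (use assms in \<open>simp_all add: dim_submatrix card_lessThan_inter[simplified]\<close>)

lemma submatrix_leading_rows:
  fixes Q :: "complex mat"
  assumes "r \<le> dim_row Q"
  shows "submatrix Q {..<r} UNIV = incl_mat r (dim_row Q) * Q"
proof (rule eq_matI)
  fix i j assume "i < dim_row (incl_mat r (dim_row Q) * Q)" "j < dim_col (incl_mat r (dim_row Q) * Q)"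
  then have ij: "i < r" "j < dim_col Q" by simp_all
  have "submatrix Q {..<r} UNIV $$ (i, j) = Q $$ (i, j)"
    using ij assms by (subst submatrix_index) (simp_all add: card_lessThan_inter[simplified] pick_UNIV pick_lessThan)
  also have "\<dots> = (incl_mat r (dim_row Q) * Q) $$ (i, j)"
    using ij assms by (simp add: scalar_prod_def incl_mat_def if_distrib[of "\<lambda>x. x * _"] cong: if_cong)
  finally show "submatrix Q {..<r} UNIV $$ (i, j) = (incl_mat r (dim_row Q) * Q) $$ (i, j)" .
qed (use assms in \<open>simp_all add: dim_submatrix card_lessThan_inter[simplified]\<close>)

lemma submatrix_leading_block:
  assumes "r \<le> dim_row D" "r \<le> dim_col D"
  shows "submatrix D {..<r} {..<r} = mat r r (\<lambda>(i, j). D $$ (i, j))"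
  by (rule eq_matI)
    (use assms in \<open>simp_all add: submatrix_def card_lessThan_inter[simplified] pick_lessThan\<close>)

text \<open>Moves column selections to rows of the transpose, where the results on basis rows
  apply.\<close>

lemma submatrix_cols_transpose:
  "submatrix A UNIV J = (submatrix A\<^sup>T J UNIV)\<^sup>T"
proof (rule eq_matI)
  fix i j assume "i < dim_row (submatrix A\<^sup>T J UNIV)\<^sup>T" "j < dim_col (submatrix A\<^sup>T J UNIV)\<^sup>T"
  then have ij: "i < dim_row A" "j < card {j. j < dim_col A \<and> j \<in> J}" by (simp_all add: dim_submatrix)
  then show "submatrix A UNIV J $$ (i, j) = (submatrix A\<^sup>T J UNIV)\<^sup>T $$ (i, j)"
    using pick_le[OF ij(2)] by (simp add: submatrix_def pick_UNIV)
qed (simp_all add: dim_submatrix)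

text \<open>In R = P D Q, the leading columns of P and the leading rows of Q cut D down to its
  leading block S. The remainder is P D' Q with D' the tail of D, so its norm is at most that of
  D'.\<close>

lemma truncated_svd:
  assumes svd: "is_svd R P D Q" and r: "r \<le> dim_row R" "r < dim_col R" and c: "sing_vals R ! r \<le> c"
  defines "U \<equiv> submatrix P UNIV {..<r}" and "S \<equiv> submatrix D {..<r} {..<r}"
    and "V \<equiv> submatrix Q {..<r} UNIV"
  shows "U \<in> carrier_mat (dim_row R) r" "V \<in> carrier_mat r (dim_col R)"
    "S = mat_diag r (\<lambda>i. complex_of_real (sing_vals R ! i))"
    "mat_adjoint U * U = 1\<^sub>m r" "V * mat_adjoint V = 1\<^sub>m r" "mat_adjoint U * R = S * V"
    "op_bound (R - U * S * V) c"
proof -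
  define n M where "n = dim_row R" and "M = dim_col R"
  define s where "s = (\<lambda>i. complex_of_real (sing_vals R ! i))"
  have P: "P \<in> carrier_mat n n" "mat_adjoint P * P = 1\<^sub>m n"
    and Q: "Q \<in> carrier_mat M M" "mat_adjoint Q * Q = 1\<^sub>m M"
    and D0: "D = mat n M (\<lambda>(i, j). if i = j then complex_of_real (sing_val (i + 1) R) else 0)"
    and R: "R = P * D * Q"
    using svd unfolding is_svd_def n_def M_def by blast+
  have D: "D = mat n M (\<lambda>(i, j). if i = j then s i else 0)"
    unfolding D0 by (simp add: s_def sing_val_def cong: if_cong)
  have QQ: "Q * mat_adjoint Q = 1\<^sub>m M" by (rule unitary_right_inverse[OF Q])
  have rn: "r \<le> n" "r \<le> M" using r by (simp_all add: n_def M_def)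
  have [simp]: "dim_row P = n" "dim_col P = n" "dim_row Q = M" "dim_col Q = M" "dim_row D = n" "dim_col D = M"
    using P Q by (auto simp: D)
  have U: "U = P * incl_mat n r" using rn by (simp add: U_def submatrix_leading_cols)
  have V: "V = incl_mat r M * Q" using rn by (simp add: V_def submatrix_leading_rows)
  show S: "S = mat_diag r s"
    unfolding S_def using rn by (subst submatrix_leading_block) (auto simp: mat_diag_def D intro!: eq_matI)
  show "U \<in> carrier_mat n r" "V \<in> carrier_mat r M"
    by (rule carrier_matI; simp add: U V)+
  have "mat_adjoint U * U = incl_mat r n * ((mat_adjoint P * P) * incl_mat n r)"
    by (simp add: U mat_adjoint_mult incl_mat_adjoint assoc_mult_mat_dim)
  then show "mat_adjoint U * U = 1\<^sub>m r" by (simp add: P(2) incl_mat_left_inverse rn)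
  have "V * mat_adjoint V = incl_mat r M * ((Q * mat_adjoint Q) * incl_mat M r)"
    by (simp add: V mat_adjoint_mult incl_mat_adjoint assoc_mult_mat_dim)
  then show "V * mat_adjoint V = 1\<^sub>m r" by (simp add: QQ incl_mat_left_inverse rn)
  \<comment> \<open>The leading r rows of D vanish outside the leading block, since r \<le> n and r
    \<le> M. This is what yields U^H R = S V.\<close>
  have ED: "incl_mat r n * D = S * incl_mat r M"
    unfolding S mat_diag_mult_left[OF carrier_matI[OF incl_mat_dims]]
    using rn by (intro eq_matI)
      (auto simp: incl_mat_def D scalar_prod_def if_distrib[of "\<lambda>x. x * _"] cong: if_cong)
  have dS [simp]: "dim_row S = r" "dim_col S = r" by (simp_all add: S)
  have "mat_adjoint U * R = incl_mat r n * ((mat_adjoint P * P) * (D * Q))"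
    unfolding U R by (simp add: mat_adjoint_mult incl_mat_adjoint assoc_mult_mat_dim)
  also have "\<dots> = (incl_mat r n * D) * Q" by (simp add: P(2) assoc_mult_mat_dim)
  also have "\<dots> = S * V" unfolding ED V by (simp add: assoc_mult_mat_dim)
  finally show "mat_adjoint U * R = S * V" .
  define D' where "D' = mat n M (\<lambda>(i, j). if i = j \<and> r \<le> i then s i else 0)"
  have [simp]: "dim_row D' = n" "dim_col D' = M" by (simp_all add: D'_def)
  have diff: "D - incl_mat n r * S * incl_mat r M = D'"
  proof -
    have "incl_mat n r * S = mat n r (\<lambda>(i, j). incl_mat n r $$ (i, j) * s j)"
      unfolding S by (rule mat_diag_mult_right[OF carrier_matI[OF incl_mat_dims]])
    then have "incl_mat n r * S * incl_mat r M = mat n M (\<lambda>(i, j). if i = j \<and> i < r then s i else 0)"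
      by (intro eq_matI)
        (auto simp: incl_mat_def scalar_prod_def if_distrib[of "\<lambda>x. x * _"] cong: if_cong)
    then show ?thesis by (intro eq_matI) (auto simp: D D'_def)
  qed
  have "R - U * S * V = P * (D - incl_mat n r * S * incl_mat r M) * Q"
    unfolding R U V by (simp add: assoc_mult_mat_dim minus_mult_mat_dim mult_minus_mat_dim)
  then have E: "R - U * S * V = P * D' * Q" by (simp add: diff)
  have c0: "0 \<le> c" using c sing_vals_nonneg[OF r(2)] by simp
  have bound: "op_bound D' c"
    unfolding op_bound_def
  proof (intro conjI allI impI c0)
    fix v :: "complex vec" assume "dim_vec v = dim_col D'"
    then have v: "dim_vec v = M" by simp
    have ent: "(cmod ((D' *\<^sub>v v) $ i))\<^sup>2 = (if i < M \<and> r \<le> i then (cmod (s i * v $ i))\<^sup>2 else 0)" if "i < n" for i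
      using that v by (auto simp: D'_def scalar_prod_def if_distrib[of "\<lambda>x. x * _"] cong: if_cong)
    have "(vec_norm2 (D' *\<^sub>v v))\<^sup>2 = (\<Sum>i<n. if i < M \<and> r \<le> i then (cmod (s i * v $ i))\<^sup>2 else 0)"
      unfolding vec_norm2_sq using ent by simp
    \<comment> \<open>D' is rectangular: row indices beyond M contribute nothing. For r \<le> i < M
      the diagonal entry is at most that of index r, hence at most c.\<close>
    also have "\<dots> \<le> (\<Sum>i<n. if i < M then c\<^sup>2 * (cmod (v $ i))\<^sup>2 else 0)"
    proof (rule sum_mono)
      fix i
      have "(cmod (s i * v $ i))\<^sup>2 \<le> c\<^sup>2 * (cmod (v $ i))\<^sup>2" if "i < M" "r \<le> i"
      proof -
        have "0 \<le> sing_vals R ! i" "sing_vals R ! i \<le> c"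
          using that sing_vals_nonneg[of i R] sing_vals_antimono[of r i R] c by (simp_all add: M_def)
        then show ?thesis
          by (simp add: s_def norm_mult power_mult_distrib mult_right_mono power_mono)
      qed
      then show "(if i < M \<and> r \<le> i then (cmod (s i * v $ i))\<^sup>2 else 0) \<le>
          (if i < M then c\<^sup>2 * (cmod (v $ i))\<^sup>2 else 0)"
        by simp
    qed
    also have "\<dots> = (\<Sum>i\<in>{..<n} \<inter> {..<M}. c\<^sup>2 * (cmod (v $ i))\<^sup>2)"
      by (rule sum.mono_neutral_cong_right) auto
    also have "\<dots> \<le> (\<Sum>i<M. c\<^sup>2 * (cmod (v $ i))\<^sup>2)"
      by (rule sum_mono2) auto
    also have "\<dots> = (c * vec_norm2 v)\<^sup>2"
      unfolding power_mult_distrib vec_norm2_sq v by (rule sum_distrib_left[symmetric])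
    finally show "vec_norm2 (D' *\<^sub>v v) \<le> c * vec_norm2 v"
      by (rule power2_le_imp_le) (simp add: c0)
  qed
  have "op_bound (P * D' * Q) (1 * c * 1)"
    by (intro op_bound_mult op_bound_isometry bound) (simp_all add: P(2) Q(2))
  then show "op_bound (R - U * S * V) c" by (simp add: E)
qed

lemma mat_adjoint_transpose: "mat_adjoint (A\<^sup>T) = (mat_adjoint A)\<^sup>T"
  by (rule eq_matI) simp_all

lemma transpose_mult_dim:
  "dim_col A = dim_row B \<Longrightarrow> (A * B)\<^sup>T = B\<^sup>T * (A :: 'a :: comm_semiring_0 mat)\<^sup>T"
  by (rule transpose_mult[of A "dim_row A" "dim_row B" B "dim_col B"]) (rule carrier_matI; simp)+

section \<open>The error bound\<close>

theorem theorem4p6: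
  fixes A Z A' :: "complex mat" and K :: "complex set" and N M r n m :: nat
  assumes "K = UNIV \<or> K = \<real>"
    and "A \<in> carrier_mat N M" and "elements_mat A \<subseteq> K"
    and "r \<ge> 1" and "mat_rank A \<ge> r"
    and "best_rank_approx spectral_norm K r A Z"
    and "best_rank_approx frobenius_norm K r A Z"
    and "r \<le> n" and "n < N" and "r \<le> m" and "m < M"
    and "optimal_CGR_approximant r n m A Z A'"
  shows "spectral_norm (A - A') \<le>
           2 * t_const r N n * t_const r M m * sing_val (r + 1) A"
proof -
  have [simp]: "dim_row A = N" "dim_col A = M" using assms(2) by auto
  obtain ZU ZV I P D Q J where ZU: "ZU \<in> carrier_mat N r" "mat_rank ZU = r"
    and ZV: "ZV \<in> carrier_mat r M" "mat_rank ZV = r" and Z: "Z = ZU * ZV"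
    and optI: "optimal_basis_rows n ZU I"
    and svd: "is_svd (submatrix A I UNIV) P D Q"
    and optJ: "optimal_basis_cols m (submatrix Q {..<r} UNIV) J"
    and A': "A' = submatrix A UNIV J *
        pinv (submatrix P UNIV {..<r} * submatrix D {..<r} {..<r} * submatrix (submatrix Q {..<r} UNIV) UNIV J) *
        submatrix A I UNIV"
    using assms(12) unfolding optimal_CGR_approximant_def Let_def by auto
  have [simp]: "dim_row ZU = N" "dim_col ZU = r" "dim_row ZV = r" "dim_col ZV = M" using ZU ZV by auto
  have injZU: "inj_mat ZU" by (rule inj_mat_of_full_rank[OF ZU])
  have injZV: "inj_mat (mat_adjoint ZV)" by (rule inj_mat_adjoint_of_full_rank[OF ZV])
  \<comment> \<open>Lists are indexed from 0, so the entry of index r is sigma_{r+1}(A).\<close>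
  define t1 t2 c where "t1 = t_const r N n" and "t2 = t_const r M m" and "c = sing_vals A ! r"
  have rM: "r < M" and nN: "n \<le> N" and mM: "m \<le> M" using assms by simp_all
  define E0 where "E0 = A - Z"
  have [simp]: "dim_row Z = N" "dim_col Z = M" "dim_row E0 = N" "dim_col E0 = M" by (simp_all add: Z E0_def)
  have E0: "op_bound E0 c"
    unfolding E0_def c_def by (rule best_spectral_approx_bound[OF assms(1,3) _ assms(6)]) (simp add: rM)
  have orth: "E0 * mat_adjoint Z = 0\<^sub>m N N"
    using best_frobenius_approx_orthogonal[OF assms(1,3), of r ZU ZV] assms(7) ZU ZV by (simp add: Z E0_def)

  define PI L1 where "PI = row_selection N I" and "L1 = pinv (submatrix ZU I UNIV)"
  note rows = optimal_basis_rows_projection[OF assms(4,8) nN ZU(1) injZU optI,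
      folded PI_def L1_def t1_def]
  have I: "I \<subseteq> {..<N}" "card I = n" by (rule rows)+
  have [simp]: "dim_row PI = n" "dim_col PI = N" using I by (simp_all add: PI_def)
  have [simp]: "dim_row L1 = r" "dim_col L1 = n" using rows(3) by auto
  define R where "R = submatrix A I UNIV"
  have R: "R = PI * A" unfolding R_def PI_def by (rule submatrix_rows_eq_selection[OF I(1)]) simp
  have [simp]: "dim_row R = n" "dim_col R = M" by (simp_all add: R)
  have PIb: "op_bound PI 1" unfolding PI_def by (rule op_bound_row_selection[OF I(1)])

  \<comment> \<open>P_I Z = (P_I ZU) ZV factors through dimension r and approximates R with error
    P_I E0, which bounds sigma_{r+1}(R) by sigma_{r+1}(A).\<close>
  have "R - PI * ZU * ZV = PI * E0"
    by (simp add: R E0_def Z mult_minus_mat_dim assoc_mult_mat_dim)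
  then have "op_bound (R - PI * ZU * ZV) c"
    using op_bound_mult[OF PIb E0] by simp
  then have sr: "sing_vals R ! r \<le> c"
    by (intro sing_val_le_of_low_rank_approx[of r R "PI * ZU" ZV]) (simp_all add: rM ZV carrier_matI)

  define U S V where "U = submatrix P UNIV {..<r}" and "S = submatrix D {..<r} {..<r}"
    and "V = submatrix Q {..<r} UNIV"
  note tsvd = truncated_svd[OF svd[folded R_def] _ _ sr, folded U_def S_def V_def, simplified, OF assms(8) rM]
  have [simp]: "dim_row U = n" "dim_col U = r" "dim_row V = r" "dim_col V = M" using tsvd(1,2) by auto
  have [simp]: "dim_row S = r" "dim_col S = r" by (simp_all add: tsvd(3))

  have s_pos: "sing_vals R ! i \<noteq> 0" if "i < r" for i
  proof -
    obtain r' where r': "r = Suc r'" using assms(4) by (cases r) auto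
    \<comment> \<open>By \<open>orth\<close>, A and Z agree on the range of Z^H. So Z^H ZU is a test
      matrix with r columns on which R stays injective.\<close>
    have "A * mat_adjoint Z = E0 * mat_adjoint Z + Z * mat_adjoint Z"
      unfolding E0_def by (simp add: minus_mult_mat_dim) (intro eq_matI, simp_all)
    then have "A * mat_adjoint Z = Z * mat_adjoint Z" by (simp add: orth)
    then have "R * (mat_adjoint Z * ZU) = PI * (Z * mat_adjoint Z) * ZU"
      unfolding R by (simp add: assoc_mult_mat_dim flip: assoc_mult_mat_dim[of A])
    also have "\<dots> = PI * ZU * ((ZV * mat_adjoint ZV) * (mat_adjoint ZU * ZU))"
      by (simp add: Z mat_adjoint_mult assoc_mult_mat_dim)
    finally have RY: "R * (mat_adjoint Z * ZU) = PI * ZU * ((ZV * mat_adjoint ZV) * (mat_adjoint ZU * ZU))" .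
    have "inj_mat ((ZV * mat_adjoint ZV) * (mat_adjoint ZU * ZU))"
      by (rule inj_mat_mult) (use inj_mat_gram[OF injZU] inj_mat_gram[OF injZV] in simp_all)
    then have "inj_mat (R * (mat_adjoint Z * ZU))"
      unfolding RY by (rule inj_mat_mult[OF rows(9)]) simp
    then have "0 < sing_vals R ! r'"
      by (intro sing_val_pos_of_inj_mult[of r' R "mat_adjoint Z * ZU"]) (use rM r' in \<open>auto intro!: carrier_matI\<close>)
    moreover have "sing_vals R ! r' \<le> sing_vals R ! i"
      using that rM r' by (intro sing_vals_antimono) simp_all
    ultimately show ?thesis by simp
  qed
  define Si where "Si = mat_diag r (\<lambda>i. complex_of_real (inverse (sing_vals R ! i)))"
  have [simp]: "dim_row Si = r" "dim_col Si = r" by (simp_all add: Si_def)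
  have SSi: "S * Si = 1\<^sub>m r" "Si * S = 1\<^sub>m r"
    by (rule eq_matI; simp add: tsvd(3) Si_def; simp add: mat_diag_def s_pos)+

  \<comment> \<open>Transposing V V^H = 1 exhibits a left inverse of V^T.\<close>
  have VVT: "(mat_adjoint V)\<^sup>T * V\<^sup>T = 1\<^sub>m r"
    by (simp add: transpose_mult_dim[symmetric] tsvd(5))
  have injV: "inj_mat V\<^sup>T" by (rule inj_mat_of_left_inverse[of "(mat_adjoint V)\<^sup>T"]) (simp_all add: VVT)
  have VT: "V\<^sup>T \<in> carrier_mat M r" by (rule carrier_matI) simp_all
  define PJ L2 where "PJ = row_selection M J" and "L2 = pinv (submatrix V\<^sup>T J UNIV)"
  have optJ': "optimal_basis_rows m V\<^sup>T J" using optJ by (simp add: optimal_basis_cols_def V_def)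
  note cols = optimal_basis_rows_projection[OF assms(4,10) mM VT injV optJ',
      folded PJ_def L2_def t2_def]
  have J: "J \<subseteq> {..<M}" "card J = m" by (rule cols)+
  have [simp]: "dim_row PJ = m" "dim_col PJ = M" using J by (simp_all add: PJ_def)
  have [simp]: "dim_row L2 = r" "dim_col L2 = m" using cols(3) by auto
  define W where "W = submatrix V UNIV J"
  have W: "W = V * PJ\<^sup>T"
    unfolding W_def submatrix_cols_transpose[of V] PJ_def
    by (simp add: submatrix_rows_eq_selection[OF J(1)] transpose_mult_dim J(1))
  have C: "submatrix A UNIV J = A * PJ\<^sup>T"
    unfolding submatrix_cols_transpose[of A] PJ_def
    by (simp add: submatrix_rows_eq_selection[OF J(1)] transpose_mult_dim J(1))
  have [simp]: "dim_row W = r" "dim_col W = m" by (simp_all add: W)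
  have WT: "W\<^sup>T = PJ * V\<^sup>T" by (simp add: W transpose_mult_dim)
  have WL: "W * L2\<^sup>T = 1\<^sub>m r"
    using arg_cong[OF cols(4), of transpose_mat] by (simp add: transpose_mult_dim W)
  \<comment> \<open>The Penrose equation makes W^T L2 Hermitian, and transposition preserves
    this.\<close>
  have LW: "mat_adjoint (L2\<^sup>T * W) = L2\<^sup>T * W"
  proof -
    have "L2\<^sup>T * W = (W\<^sup>T * L2)\<^sup>T" by (simp add: transpose_mult_dim)
    then show ?thesis using cols(5) by (simp add: WT mat_adjoint_transpose)
  qed

  \<comment> \<open>The reverse order law for pseudo-inverses fails for general products. Here it
    holds because U^H U = 1, S is invertible and W has the right inverse L2^T, which is
    pinv(W).\<close>
  define X where "X = L2\<^sup>T * (Si * mat_adjoint U)"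
  have [simp]: "dim_row X = m" "dim_col X = n" by (simp_all add: X_def)
  have BX: "U * S * W * X = U * mat_adjoint U"
  proof -
    have "U * S * W * X = U * (S * ((W * L2\<^sup>T) * (Si * mat_adjoint U)))"
      by (simp add: X_def assoc_mult_mat_dim)
    also have "\<dots> = U * ((S * Si) * mat_adjoint U)" by (simp add: WL assoc_mult_mat_dim)
    finally show ?thesis by (simp add: SSi)
  qed
  have XB: "X * (U * S * W) = L2\<^sup>T * W"
  proof -
    have "X * (U * S * W) = L2\<^sup>T * (Si * ((mat_adjoint U * U) * (S * W)))"
      by (simp add: X_def assoc_mult_mat_dim)
    also have "\<dots> = L2\<^sup>T * ((Si * S) * W)" by (simp add: tsvd(4) assoc_mult_mat_dim)
    finally show ?thesis by (simp add: SSi)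
  qed
  have pinvX: "pinv (U * S * W) = X"
  proof (rule pinv_eqI)
    show "X \<in> carrier_mat (dim_col (U * S * W)) (dim_row (U * S * W))" by (rule carrier_matI) simp_all
    have "U * mat_adjoint U * (U * S * W) = U * ((mat_adjoint U * U) * (S * W))"
      by (simp add: assoc_mult_mat_dim)
    then show "U * S * W * X * (U * S * W) = U * S * W" unfolding BX by (simp add: tsvd(4) assoc_mult_mat_dim)
    have "L2\<^sup>T * W * X = L2\<^sup>T * ((W * L2\<^sup>T) * (Si * mat_adjoint U))"
      by (simp add: X_def assoc_mult_mat_dim)
    then show "X * (U * S * W) * X = X" unfolding XB by (simp add: WL X_def)
    show "mat_adjoint (U * S * W * X) = U * S * W * X" unfolding BX by (simp add: mat_adjoint_mult)
    show "mat_adjoint (X * (U * S * W)) = X * (U * S * W)" unfolding XB by (rule LW)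
  qed
  \<comment> \<open>The transpose of V^T L2 P_J, the oblique projection attached to the selected
    rows of V^T.\<close>
  define Pi2 where "Pi2 = PJ\<^sup>T * L2\<^sup>T * V"
  have [simp]: "dim_row Pi2 = M" "dim_col Pi2 = M" by (simp_all add: Pi2_def)
  \<comment> \<open>U^H R = S V cancels the inverse of S and leaves A times the projection.\<close>
  have "A' = A * PJ\<^sup>T * X * R"
    unfolding A' by (simp add: C pinvX R_def[symmetric] U_def[symmetric] S_def[symmetric] V_def[symmetric] W_def[symmetric])
  also have "\<dots> = A * (PJ\<^sup>T * (L2\<^sup>T * (Si * (mat_adjoint U * R))))"
    by (simp add: X_def assoc_mult_mat_dim)
  also have "\<dots> = A * (PJ\<^sup>T * (L2\<^sup>T * ((Si * S) * V)))"
    unfolding tsvd(6) by (simp add: assoc_mult_mat_dim)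
  also have "\<dots> = A * Pi2" by (simp add: SSi Pi2_def assoc_mult_mat_dim)
  finally have A'_eq: "A' = A * Pi2" .
  \<comment> \<open>V P_J^T L2^T = W L2^T = 1, so multiplying V by Pi2 on the right leaves it
    fixed.\<close>
  have V_compl: "V * (1\<^sub>m M - Pi2) = 0\<^sub>m r M"
  proof -
    have "V * Pi2 = (W * L2\<^sup>T) * V" by (simp add: Pi2_def W assoc_mult_mat_dim)
    then have "V * Pi2 = V" by (simp add: WL)
    then show ?thesis by (simp add: mult_minus_mat_dim) (intro eq_matI, simp_all)
  qed
  have Pi2_bound: "op_bound (1\<^sub>m M - Pi2) t2"
  proof -
    have "Pi2 = (V\<^sup>T * L2 * PJ)\<^sup>T" by (simp add: Pi2_def transpose_mult_dim assoc_mult_mat_dim)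
    then have "1\<^sub>m M - Pi2 = (1\<^sub>m M - V\<^sup>T * L2 * PJ)\<^sup>T" by (intro eq_matI) auto
    then show ?thesis using op_bound_transpose[OF cols(7)] by simp
  qed

  define T where "T = ZU * L1"
  have [simp]: "dim_row T = N" "dim_col T = n" by (simp_all add: T_def)
  have TZ: "T * PI * Z = Z"
  proof -
    have "T * PI * Z = ZU * ((L1 * (PI * ZU)) * ZV)" by (simp add: T_def Z assoc_mult_mat_dim)
    then show ?thesis by (simp add: rows(4) Z)
  qed
  \<comment> \<open>T P_I fixes Z, hence (1 - T P_I) E0 = A - T R; the terms T R then
    cancel.\<close>
  have split: "A - T * (U * S * V) = (1\<^sub>m N - T * PI) * E0 + T * (R - U * S * V)"
  proof -
    have "(1\<^sub>m N - T * PI) * E0 = E0 - T * PI * E0"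
      by (subst minus_mult_mat_dim) simp_all
    also have "T * PI * E0 = T * PI * A - Z"
      by (simp add: E0_def mult_minus_mat_dim TZ)
    finally have "(1\<^sub>m N - T * PI) * E0 = (A - Z) - (T * PI * A - Z)" by (simp add: E0_def)
    moreover have "T * (R - U * S * V) = T * R - T * (U * S * V)"
      by (rule mult_minus_mat_dim) simp_all
    moreover have "T * R = T * PI * A" by (simp add: R assoc_mult_mat_dim)
    ultimately show ?thesis by (intro eq_matI) auto
  qed
  \<comment> \<open>The projection error and the truncation error each cost t1 c; this is the factor
    2 of the theorem.\<close>
  have bound1: "op_bound (A - T * (U * S * V)) (t1 * c + t1 * c)"
    unfolding split
    by (intro op_bound_add op_bound_mult rows(7)[folded T_def] rows(6)[folded T_def] E0 tsvd(7)) simp_all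
  have "A - A' = A * (1\<^sub>m M - Pi2)"
    by (simp add: A'_eq mult_minus_mat_dim)
  \<comment> \<open>T U S V ends in V, which the complement annihilates, so it can be subtracted
    from A without changing the product.\<close>
  moreover have "T * (U * S * V) * (1\<^sub>m M - Pi2) = T * (U * (S * (V * (1\<^sub>m M - Pi2))))"
    by (simp add: assoc_mult_mat_dim)
  then have "T * (U * S * V) * (1\<^sub>m M - Pi2) = 0\<^sub>m N M" by (simp add: V_compl)
  then have "(A - T * (U * S * V)) * (1\<^sub>m M - Pi2) = A * (1\<^sub>m M - Pi2)"
    by (subst minus_mult_mat_dim) (simp_all, intro eq_matI, simp_all)
  ultimately have "A - A' = (A - T * (U * S * V)) * (1\<^sub>m M - Pi2)" by simp
  then have "op_bound (A - A') ((t1 * c + t1 * c) * t2)"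
    using op_bound_mult[OF bound1 Pi2_bound] by simp
  then have "spectral_norm (A - A') \<le> (t1 * c + t1 * c) * t2" by (rule spectral_norm_le)
  then show ?thesis by (simp add: t1_def t2_def c_def sing_val_def algebra_simps)
qed

end
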